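(* Let $k\ge -\tfrac12$ and $M=(a,b;c,d)\in SL(2,\mathbb{R})$ with $b\ne 0$. Let $E$ and $F$ be measurable subsets of $\mathbb{R}$, let $1<p_1<p_2\le 2$ with conjugate exponents $q_1,q_2$ respectively, and let $f\in L_k^{p_1}(\mathbb{R})\cap L^{p_2}_k(\mathbb{R})$. Let $0\le\epsilon_E<1$ and $0\le\epsilon_F<1$. If $f$ is $\epsilon_E$-concentrated to $E$ in $L_k^{p_1}(\mathbb{R})$ and $D_k^M(f)$ is $\epsilon_{F}$-concentrated to $F$ in $L_k^{q_2}(\mathbb{R})$, then $$\|D_k^M(f)\|_{L_k^{q_2}(\mathbb{R})} \le C_{k,b}^{1-\frac{2}{q_1}}\, \frac{(\gamma_k(E))^{\frac{p_2-p_1}{p_1p_2}}\, (\gamma_k(F))^{\frac{q_1-q_2}{q_1q_2}}}{(1-\epsilon_E)(1-\epsilon_{F})}\, \|f\|_{L_k^{p_2}(\mathbb{R})},$$ where $C_{k,b}=|b|^{-(k+1)}$ (the right-hand side is read in $[0,\infty]$ with $0\cdot\infty=0$).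
   Context: For $k\ge-\frac12$ let $d\mu_k(x)=\frac{|x|^{2k+1}}{2^{k+1}\Gamma(k+1)}\,dx$ on $\mathbb{R}$, and let $L^p_k(\mathbb{R})=L^p(\mathbb{R},\mu_k)$ (complex-valued functions) with its usual norm, $1\le p\le\infty$. For measurable $E\subseteq\mathbb{R}$, $\gamma_k(E)=\int_{\mathbb{R}}\chi_E\,d\mu_k\in[0,\infty]$, where $\chi_E$ is the characteristic function of $E$. The Dunkl kernel is $E_k(-i\lambda,x)=j_k(\lambda x)-\frac{i\lambda x}{2(k+1)}j_{k+1}(\lambda x)$, where $j_k(u)=\Gamma(k+1)\sum_{n\ge0}\frac{(-1)^n(u/2)^{2n}}{n!\,\Gamma(n+k+1)}$. For $M=(a,b;c,d)$, meaning the matrix $\begin{bmatrix}a&b\\c&d\end{bmatrix}\in SL(2,\mathbb{R})$, with $b\neq0$, the linear canonical Dunkl transform of $f\in L^1_k(\mathbb{R})$ is $$D_k^M(f)(\lambda)=\frac{1}{(ib)^{k+1}}\int_{\mathbb{R}}f(x)\,e^{\frac i2\left(\frac db\lambda^2+\frac ab x^2\right)}E_k(-i\lambda/b,x)\,d\mu_k(x),$$ with $(ib)^{k+1}$ the principal branch. For $1<p\le2$ with conjugate exponent $q$, $D_k^M$ on $L^p_k(\mathbb{R})$ denotes the unique bounded extension $L^p_k(\mathbb{R})\to L^q_k(\mathbb{R})$ of this integral transform from $L^1_k(\mathbb{R})\cap L^p_k(\mathbb{R})$. A function $f\in L^p_k(\mathbb{R})$, $1\le p\le 2$, is $\epsilon_E$-concentrated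 to $E$ in $L^p_k(\mathbb{R})$ (where $0\le\epsilon_E<1$) if $\|f-\chi_Ef\|_{L^p_k}\le\epsilon_E\|f\|_{L^p_k}$. Similarly, with $q$ the conjugate exponent of $p$, $D_k^M(f)$ is $\epsilon_F$-concentrated to $F$ in $L^q_k(\mathbb{R})$ if $\|D_k^M(f)-\chi_FD_k^M(f)\|_{L^q_k}\le\epsilon_F\|D_k^M(f)\|_{L^q_k}$. *)

theory Defs
  imports "HOL-Analysis.Analysis"
begin

(* Real powers on [0,\<infinity>]; only meant for exponents r > 0. *)
definition enn_powr :: "ennreal \<Rightarrow> real \<Rightarrow> ennreal" where
  "enn_powr x r = (if x = \<infinity> then \<infinity> else ennreal (enn2real x powr r))"

(* Weighted completed Lebesgue measure, so "measurable" means Lebesgue measurable.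
   For k = -1/2 the density is constant except at the origin, where 0 powr 0 = 0;
   this is a null set. *)
definition dunkl_measure :: "real \<Rightarrow> real measure" where
  "dunkl_measure k = density lebesgue
     (\<lambda>x. ennreal (\<bar>x\<bar> powr (2 * k + 1) / (2 powr (k + 1) * Gamma (k + 1))))"

definition Lp_norm :: "real \<Rightarrow> real \<Rightarrow> (real \<Rightarrow> complex) \<Rightarrow> ennreal" where
  "Lp_norm k p f = enn_powr (\<integral>\<^sup>+x. ennreal (norm (f x) powr p) \<partial>dunkl_measure k) (1 / p)"

(* Functions, not classes modulo a.e. equality; 1 \<le> p < \<infinity>. *)
definition Lp_space :: "real \<Rightarrow> real \<Rightarrow> (real \<Rightarrow> complex) set" where
  "Lp_space k p = {f. f \<in> borel_measurable (dunkl_measure k) \<and> Lp_norm k p f < \<infinity>}"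

definition dunkl_gamma :: "real \<Rightarrow> real set \<Rightarrow> ennreal" where
  "dunkl_gamma k E = (\<integral>\<^sup>+x. indicator E x \<partial>dunkl_measure k)"

definition bessel_j :: "real \<Rightarrow> real \<Rightarrow> real" where
  "bessel_j k u =
     Gamma (k + 1) * (\<Sum>n. (-1) ^ n * (u / 2) ^ (2 * n) / (fact n * Gamma (real n + k + 1)))"

(* dunkl_kernel k l x stands for the Dunkl kernel E_k(-i l, x). *)
definition dunkl_kernel :: "real \<Rightarrow> real \<Rightarrow> real \<Rightarrow> complex" where
  "dunkl_kernel k l x =
     of_real (bessel_j k (l * x))
     - \<i> * of_real (l * x) / of_real (2 * (k + 1)) * of_real (bessel_j (k + 1) (l * x))"

(* The matrix (a,b;c,d) has entries a = M$1$1, b = M$1$2, c = M$2$1, d = M$2$2.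
   Complex powr is the principal branch. *)
definition lcdt_integral :: "real \<Rightarrow> real^2^2 \<Rightarrow> (real \<Rightarrow> complex) \<Rightarrow> real \<Rightarrow> complex" where
  "lcdt_integral k M f l =
     1 / ((\<i> * of_real (M$1$2)) powr of_real (k + 1)) *
     (LINT x|dunkl_measure k.
        f x * exp (\<i> / 2 * of_real (M$2$2 / M$1$2 * l\<^sup>2 + M$1$1 / M$1$2 * x\<^sup>2))
            * dunkl_kernel k (l / M$1$2) x)"

(* T is a bounded linear operator from L^p to L^q, q = p/(p-1), extending the integral
   transform from L^1 \<inter> L^p. All identities between functions are a.e.; linearity and
   boundedness make T compatible with a.e. equality. *)
definition is_lcdt_extension ::
  "real \<Rightarrow> real^2^2 \<Rightarrow> real \<Rightarrow> ((real \<Rightarrow> complex) \<Rightarrow> real \<Rightarrow> complex) \<Rightarrow> bool" where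
  "is_lcdt_extension k M p T \<longleftrightarrow>
     (\<forall>f\<in>Lp_space k p. T f \<in> Lp_space k (p / (p - 1))) \<and>
     (\<forall>f\<in>Lp_space k p. \<forall>g\<in>Lp_space k p. \<forall>\<alpha> \<beta>.
        AE l in dunkl_measure k. T (\<lambda>x. \<alpha> * f x + \<beta> * g x) l = \<alpha> * T f l + \<beta> * T g l) \<and>
     (\<exists>C::real. \<forall>f\<in>Lp_space k p. Lp_norm k (p / (p - 1)) (T f) \<le> ennreal C * Lp_norm k p f) \<and>
     (\<forall>f\<in>Lp_space k 1 \<inter> Lp_space k p.
        AE l in dunkl_measure k. T f l = lcdt_integral k M f l)"

(* For 1 < p \<le> 2 such an extension is unique up to a.e. equality, since L^1 \<inter> L^p is dense
   in L^p; the choice operator only selects representatives. *)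
definition lcdt :: "real \<Rightarrow> real^2^2 \<Rightarrow> real \<Rightarrow> (real \<Rightarrow> complex) \<Rightarrow> real \<Rightarrow> complex" where
  "lcdt k M p = (SOME T. is_lcdt_extension k M p T)"

definition concentrated :: "real \<Rightarrow> real \<Rightarrow> real \<Rightarrow> real set \<Rightarrow> (real \<Rightarrow> complex) \<Rightarrow> bool" where
  "concentrated k p \<epsilon> E f \<longleftrightarrow>
     Lp_norm k p (\<lambda>x. f x - indicator E x * f x) \<le> ennreal \<epsilon> * Lp_norm k p f"

end

(* The inequality is a chain of Hoelder on F, the Hausdorff-Young inequality with its sharp constant
   for the exponent p1, and Hoelder on E; the two concentration hypotheses allow the norms on F and E
   to be replaced by full norms.

   Hausdorff-Young comes from complex interpolation (three lines theorem) between the kernel bound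
   |E_k| <= 1 and the Plancherel inequality. The first follows from the energy identity
   (j_k^2 + S^2)' <= 0 on (0, infinity), S(u) = u j_{k+1}(u) / (2(k+1)), a consequence of j_k' = - S and
   S' = j_k - (2k+1) S / u. For the second, the transform is damped by a Gaussian weight
   exp(-eps l^2); the resulting kernel is the Dunkl heat kernel by Weber's second exponential
   integral, which is nonnegative with constant mass, so Schur's test gives the L^2 bound.
   The same estimate and completeness of L^q make the extension to L^p exist, and identify
   any extension with the L^q limit of the transforms of f cut off to [-n, n], which no longer
   depends on the exponent. *)

theory Submission
  imports Defs "HOL-Complex_Analysis.Complex_Analysis"
begin

text \<open>Both Hoelder steps lower an exponent on a set: from \<open>p\<^sub>2\<close> to
  \<open>p\<^sub>1\<close> on \<open>E\<close> and, since conjugation reverses the order, from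
  \<open>q\<^sub>1\<close> to \<open>q\<^sub>2\<close> on \<open>F\<close>. The middle estimate
  therefore measures the transform belonging to \<open>p\<^sub>2\<close> in the
  \<open>q\<^sub>1\<close> norm, against the \<open>p\<^sub>1\<close> norm of \<open>f\<close>. This
  is why the transform has to be recognised as one object for both exponents. The constant is
  C^(1-\<theta>) 1^\<theta> with \<theta> = 2/q, q the conjugate exponent of
  \<open>p\<^sub>1\<close>: the norm is C from L^1 to the bounded functions and 1 on L^2. The value
  1 is a matter of scaling: replacing l by l/b costs |b|^(2(k+1)) in the squared L^2 norm, the
  prefactor (ib)^(-(k+1)) pays it back, and the quadratic exponentials have modulus one. The
  Gaussian weight is forced by the fact that the transform of an integrable function is at first
  only known to be bounded, so that the integral of its square cannot be expanded by Fubini.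
  Interpolation is done on simple functions, where the analytic family is a finite sum of
  exponentials.\<close>

lemmas integrable_dominated = Bochner_Integration.integrable_bound
lemmas bochner_nonneg = Bochner_Integration.integral_nonneg

section \<open>Riesz--Thorin interpolation\<close>

text \<open>Multiplying by \<open>m\<^sub>0\<close> to the power \<open>z - 1\<close> and
  \<open>m\<^sub>1\<close> to the power \<open>- z\<close> brings both boundary lines down to 1. The
  further factor \<open>exp (\<delta> * (z\<^sup>2 - 1))\<close> has modulus at most 1 in the strip
  and decays in the imaginary direction; this reduces the unbounded strip to a rectangle and the
  maximum modulus principle, after which \<delta> tends to 0.\<close>

lemma hadamard_three_lines:
  fixes \<Phi> :: "complex \<Rightarrow> complex"
  assumes hol: "\<Phi> holomorphic_on UNIV"
    and bdd: "\<And>z. 0 \<le> Re z \<Longrightarrow> Re z \<le> 1 \<Longrightarrow> norm (\<Phi> z) \<le> B"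
    and left: "\<And>z. Re z = 0 \<Longrightarrow> norm (\<Phi> z) \<le> m\<^sub>0"
    and right: "\<And>z. Re z = 1 \<Longrightarrow> norm (\<Phi> z) \<le> m\<^sub>1"
    and m: "0 < m\<^sub>0" "0 < m\<^sub>1" and \<theta>: "0 \<le> \<theta>" "\<theta> \<le> 1"
  shows "norm (\<Phi> (of_real \<theta>)) \<le> m\<^sub>0 powr (1 - \<theta>) * m\<^sub>1 powr \<theta>"
proof -
  define G where "G = (\<lambda>\<delta> z. \<Phi> z * exp ((z - 1) * of_real (ln m\<^sub>0) - z * of_real (ln m\<^sub>1)
    + of_real \<delta> * (z\<^sup>2 - 1)))"
  have norm_G: "norm (G \<delta> z) = norm (\<Phi> z) * exp ((Re z - 1) * ln m\<^sub>0 - Re z * ln m\<^sub>1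
      + \<delta> * ((Re z)\<^sup>2 - (Im z)\<^sup>2 - 1))" for \<delta> z
    by (simp add: G_def norm_mult power2_eq_square)
  define L where "L = \<bar>ln m\<^sub>0\<bar> + \<bar>ln m\<^sub>1\<bar>"
  have "norm (G \<delta> (of_real \<theta>)) \<le> 1" if \<delta>: "\<delta> > 0" for \<delta>
  proof -
    have B0: "B \<ge> 0"
      using bdd[of 0] norm_ge_zero[of "\<Phi> 0"] by (simp del: norm_ge_zero)
    \<comment> \<open>On the horizontal edges the decay \<open>- \<delta> * R\<^sup>2\<close> has to
      absorb the bound on \<open>\<Phi>\<close> and the powers of \<open>m\<^sub>0\<close> and
      \<open>m\<^sub>1\<close>, which contribute at most \<open>exp L\<close>. Using
      \<open>B + 1\<close> keeps the logarithm nonnegative when \<open>B = 0\<close>; the last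
      summand makes \<open>R\<close> positive.\<close>
    define R where "R = sqrt ((L + ln (B + 1)) / \<delta>) + 1"
    have L0: "L \<ge> 0" by (simp add: L_def)
    have R: "R > 0" "\<delta> * R\<^sup>2 \<ge> L + ln (B + 1)"
    proof -
      have nn: "(L + ln (B + 1)) / \<delta> \<ge> 0" using L0 B0 \<delta> by simp
      then show "R > 0" unfolding R_def by (intro add_nonneg_pos) auto
      have "(L + ln (B + 1)) / \<delta> = (sqrt ((L + ln (B + 1)) / \<delta>))\<^sup>2" using nn by simp
      also have "\<dots> \<le> R\<^sup>2" unfolding R_def using nn by (intro power_mono) auto
      finally show "\<delta> * R\<^sup>2 \<ge> L + ln (B + 1)" using \<delta> by (simp add: field_simps)
    qed
    show ?thesis
    proof (rule maximum_modulus_frontier[where f = "G \<delta>" and \<xi> = "of_real \<theta>" and S = "cbox (Complex 0 (-R)) (Complex 1 R)"])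
      show "G \<delta> holomorphic_on interior (cbox (Complex 0 (- R)) (Complex 1 R))"
        unfolding G_def by (intro holomorphic_intros holomorphic_on_subset[OF hol]) auto
      have "continuous_on UNIV \<Phi>" using hol holomorphic_on_imp_continuous_on by blast
      then show "continuous_on (closure (cbox (Complex 0 (- R)) (Complex 1 R))) (G \<delta>)"
        unfolding G_def by (intro continuous_intros continuous_on_subset[OF \<open>continuous_on UNIV \<Phi>\<close>]) auto
      show "complex_of_real \<theta> \<in> cbox (Complex 0 (- R)) (Complex 1 R)"
        using \<theta> R by (auto simp: in_cbox_complex_iff)
      fix z assume "z \<in> frontier (cbox (Complex 0 (- R)) (Complex 1 R))"
      then have z: "0 \<le> Re z" "Re z \<le> 1" "Re z = 0 \<or> Re z = 1 \<or> Im z = R \<or> Im z = -R"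
        by (auto simp: frontier_cbox in_cbox_complex_iff in_box_complex_iff)
      have sq: "(Re z)\<^sup>2 \<le> 1" using z by (simp add: power_le_one)
      then have D: "\<delta> * ((Re z)\<^sup>2 - (Im z)\<^sup>2 - 1) \<le> - \<delta> * (Im z)\<^sup>2"
        using \<delta> by (simp add: algebra_simps)
      then have D0: "\<delta> * ((Re z)\<^sup>2 - (Im z)\<^sup>2 - 1) \<le> 0"
        using \<delta> by (smt (verit) mult_nonneg_nonneg zero_le_power2 mult_minus_left)
      consider "Re z = 0" | "Re z = 1" | "(Im z)\<^sup>2 = R\<^sup>2" using z by auto
      then show "norm (G \<delta> z) \<le> 1"
      proof cases
        case 1
        then have "norm (G \<delta> z) \<le> m\<^sub>0 * exp (- ln m\<^sub>0)"
          unfolding norm_G using left[OF 1] D0 m by (intro mult_mono) auto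
        then show ?thesis using m by (simp add: exp_minus)
      next
        case 2
        then have "norm (G \<delta> z) \<le> m\<^sub>1 * exp (- ln m\<^sub>1)"
          unfolding norm_G using right[OF 2] D0 m by (intro mult_mono) auto
        then show ?thesis using m by (simp add: exp_minus)
      next
        case 3
        have "(Re z - 1) * ln m\<^sub>0 \<le> \<bar>(Re z - 1) * ln m\<^sub>0\<bar>" by (rule abs_ge_self)
        also have "\<dots> \<le> 1 * \<bar>ln m\<^sub>0\<bar>" unfolding abs_mult using z by (intro mult_right_mono) auto
        finally have i: "(Re z - 1) * ln m\<^sub>0 \<le> \<bar>ln m\<^sub>0\<bar>" by simp
        have "- (Re z * ln m\<^sub>1) \<le> \<bar>Re z * ln m\<^sub>1\<bar>" by (rule abs_ge_minus_self)
        also have "\<dots> \<le> 1 * \<bar>ln m\<^sub>1\<bar>" unfolding abs_mult using z by (intro mult_right_mono) auto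
        finally have ii: "- (Re z * ln m\<^sub>1) \<le> \<bar>ln m\<^sub>1\<bar>" by simp
        have "(Re z - 1) * ln m\<^sub>0 - Re z * ln m\<^sub>1 + \<delta> * ((Re z)\<^sup>2 - (Im z)\<^sup>2 - 1) \<le> - ln (B + 1)"
          using i ii D R(2) 3 unfolding L_def by simp
        then have "norm (G \<delta> z) \<le> (B + 1) * exp (- ln (B + 1))"
          unfolding norm_G using bdd[OF z(1,2)] B0 by (intro mult_mono) auto
        then show ?thesis using B0 by (simp add: exp_minus)
      qed
    qed auto
  qed
  then have ev: "eventually (\<lambda>\<delta>. norm (G \<delta> (of_real \<theta>)) \<le> 1) (at_right 0)"
    by (auto intro: eventually_at_right_less[THEN eventually_mono])
  have "((\<lambda>\<delta>. norm (G \<delta> (of_real \<theta>))) \<longlongrightarrow> norm (G 0 (of_real \<theta>))) (at_right 0)"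
    unfolding G_def by (intro tendsto_intros)
  from tendsto_upperbound[OF this ev] have "norm (G 0 (of_real \<theta>)) \<le> 1" by simp
  then have "norm (\<Phi> (of_real \<theta>)) * exp ((\<theta> - 1) * ln m\<^sub>0 - \<theta> * ln m\<^sub>1) \<le> 1"
    by (simp add: norm_G)
  then have "norm (\<Phi> (of_real \<theta>)) \<le> exp (- ((\<theta> - 1) * ln m\<^sub>0 - \<theta> * ln m\<^sub>1))"
    unfolding exp_minus by (simp add: inverse_eq_divide pos_le_divide_eq del: minus_diff_eq)
  also have "\<dots> = m\<^sub>0 powr (1 - \<theta>) * m\<^sub>1 powr \<theta>"
    using m by (simp add: powr_def exp_add[symmetric] algebra_simps)
  finally show ?thesis .
qed

section \<open>Interpolation for a kernel with a sup bound and an L^2 contraction property\<close>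

locale bounded_kernel_transform = sigma_finite_measure M for M :: "'a measure" +
  fixes N :: "'a \<Rightarrow> 'a \<Rightarrow> complex" and C :: real
  assumes N_meas: "(\<lambda>(l, x). N l x) \<in> borel_measurable (M \<Otimes>\<^sub>M M)"
    and C_pos: "0 < C"
    and N_bound: "\<And>l x. norm (N l x) \<le> C"
    and plancherel: "\<And>f :: 'a \<Rightarrow> complex. integrable M f \<Longrightarrow> integrable M (\<lambda>x. (norm (f x))\<^sup>2) \<Longrightarrow>
      integrable M (\<lambda>l. (norm (LINT x|M. f x * N l x))\<^sup>2) \<and>
      (LINT l|M. (norm (LINT x|M. f x * N l x))\<^sup>2) \<le> (LINT x|M. (norm (f x))\<^sup>2)"
begin

abbreviation simple_int :: "('a \<Rightarrow> 'b::real_vector) \<Rightarrow> bool" where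
  "simple_int \<equiv> Bochner_Integration.simple_bochner_integrable M"

definition T :: "('a \<Rightarrow> complex) \<Rightarrow> 'a \<Rightarrow> complex" where
  "T f l = (LINT x|M. f x * N l x)"

lemma N_meas_pair [measurable]: "(\<lambda>z. N (fst z) (snd z)) \<in> borel_measurable (M \<Otimes>\<^sub>M M)"
  using N_meas by (simp add: case_prod_beta')

lemma N_meas2 [measurable]: "l \<in> space M \<Longrightarrow> N l \<in> borel_measurable M"
  using measurable_compose[OF measurable_Pair1' N_meas] by simp

lemma integrable_N:
  assumes "integrable M f" "l \<in> space M"
  shows "integrable M (\<lambda>x. f x * N l x)"
proof (rule integrable_dominated[of M "\<lambda>x. C * norm (f x)"])
  note assms(2)[measurable] borel_measurable_integrable[OF assms(1), measurable]
  show "integrable M (\<lambda>x. C * norm (f x))" using assms by simp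
  show "(\<lambda>x. f x * N l x) \<in> borel_measurable M"
    using N_meas2[OF assms(2)] by measurable
  show "AE x in M. norm (f x * N l x) \<le> norm (C * norm (f x))"
    using C_pos mult_right_mono[OF N_bound norm_ge_zero]
    by (auto simp: norm_mult mult.commute[of "norm (f _)"])
qed

lemma T_measurable [measurable]:
  assumes [measurable]: "f \<in> borel_measurable M"
  shows "T f \<in> borel_measurable M"
proof -
  have "(\<lambda>z. f (snd z) * N (fst z) (snd z)) \<in> borel_measurable (M \<Otimes>\<^sub>M M)"
    by measurable
  then have "(\<lambda>l. LINT x|M. f x * N l x) \<in> borel_measurable M"
    by (intro borel_measurable_lebesgue_integral) (simp add: case_prod_beta')
  then show ?thesis by (simp add: T_def[abs_def])
qed

lemma norm_T_le:
  assumes "integrable M f" "l \<in> space M"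
  shows "norm (T f l) \<le> C * (LINT x|M. norm (f x))"
proof -
  have "norm (T f l) \<le> (LINT x|M. norm (f x * N l x))"
    unfolding T_def by (rule integral_norm_bound)
  also have "\<dots> \<le> (LINT x|M. C * norm (f x))"
    using integrable_N[OF assms] assms mult_right_mono[OF N_bound norm_ge_zero]
    by (intro integral_mono integrable_norm integrable_mult_right)
       (auto simp: norm_mult mult.commute[of "norm (f _)"])
  finally show ?thesis using assms by simp
qed

lemma T_tendsto:
  assumes f: "integrable M f" and u: "\<And>n. u n \<in> borel_measurable M"
    and le: "\<And>n x. x \<in> space M \<Longrightarrow> norm (u n x) \<le> K * norm (f x)"
    and lim: "\<And>x. x \<in> space M \<Longrightarrow> (\<lambda>n. u n x) \<longlonglongrightarrow> f x"
    and l: "l \<in> space M"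
  shows "(\<lambda>n. T (u n) l) \<longlonglongrightarrow> T f l"
  unfolding T_def
proof (rule integral_dominated_convergence[where w = "\<lambda>x. K * norm (f x) * C"])
  show "(\<lambda>x. f x * N l x) \<in> borel_measurable M" using integrable_N[OF f l] by simp
  show "(\<lambda>x. u n x * N l x) \<in> borel_measurable M" for n
    using u[of n] N_meas2[OF l] by measurable
  show "integrable M (\<lambda>x. K * norm (f x) * C)" using f by simp
  show "AE x in M. (\<lambda>n. u n x * N l x) \<longlonglongrightarrow> f x * N l x"
    using lim by (auto intro!: AE_I2 tendsto_mult)
  show "AE x in M. norm (u n x * N l x) \<le> K * norm (f x) * C" for n
    using le N_bound C_pos
    by (auto simp: norm_mult intro!: AE_I2 mult_mono intro: order_trans[OF norm_ge_zero])
qed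

text \<open>The analytic family \<open>sgn v |v|^(p (1 - z/2))\<close>: it is \<open>v\<close> at \<open>z = \<theta>\<close> when \<open>1/p = 1 - \<theta>/2\<close>, and turns an
  \<open>L^p\<close> unit vector into an \<open>L^1\<close> one on \<open>Re z = 0\<close> and an \<open>L^2\<close> one on \<open>Re z = 1\<close>.\<close>

definition interp :: "real \<Rightarrow> complex \<Rightarrow> complex \<Rightarrow> complex" where
  "interp p z v = sgn v * exp (of_real p * (1 - z / 2) * of_real (ln (norm v)))"

lemma interp_0 [simp]: "interp p z 0 = 0" by (simp add: interp_def)

lemma norm_interp: "norm (interp p z v) = norm v powr (p * (1 - Re z / 2))"
  by (auto simp: interp_def norm_mult norm_sgn powr_def)

lemma interp_eq_self: "p * (1 - \<theta> / 2) = 1 \<Longrightarrow> interp p (of_real \<theta>) v = v"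
proof -
  assume p: "p * (1 - \<theta> / 2) = 1"
  have "of_real p * (1 - of_real \<theta> / 2) * of_real (ln (norm v)) = 
    (of_real (p * (1 - \<theta>/2) * ln (norm v)) :: complex)" by simp
  then show ?thesis using p
    unfolding interp_def
    by (cases "v = 0") (simp_all only:, simp_all add: exp_of_real sgn_div_norm scaleR_conv_of_real)
qed

abbreviation fib :: "('a \<Rightarrow> 'b) \<Rightarrow> 'b \<Rightarrow> 'a \<Rightarrow> 'c::zero_neq_one" where
  "fib f v \<equiv> indicator (f -` {v} \<inter> space M)"

text \<open>With an analytic family in place of \<open>h\<close>, only the factors
  \<open>h v * h u\<close> depend on the parameter, so the bilinear form is a finite sum of
  exponentials and visibly entire. The condition \<open>h 0 = 0\<close> removes the value 0, whose
  fibre may have infinite measure.\<close>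

lemma simple_integral_expand:
  fixes f g :: "'a \<Rightarrow> complex" and h :: "complex \<Rightarrow> complex"
  assumes f: "simple_int f" and g: "simple_int g"
    and h0: "h 0 = (0::complex)"
  shows "(LINT l|M. T (\<lambda>x. h (f x)) l * h (g l)) =
     (\<Sum>v\<in>f ` space M - {0}. \<Sum>u\<in>g ` space M - {0}. h v * h u *
       (LINT l|M. T (fib f v) l * fib g u l))"
proof -
  have fin: "emeasure M (f -` {v} \<inter> space M) < \<infinity>" "f -` {v} \<inter> space M \<in> sets M"
    if "v \<noteq> 0" "simple_int f" for v and f :: "'a \<Rightarrow> complex"
  proof -
    have s: "simple_function M f" "emeasure M {y \<in> space M. f y \<noteq> 0} \<noteq> \<infinity>"
      using that(2) unfolding Bochner_Integration.simple_bochner_integrable.simps by auto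
    have [measurable]: "f \<in> borel_measurable M" using s(1) by (rule borel_measurable_simple_function)
    show "f -` {v} \<inter> space M \<in> sets M" by measurable
    have "emeasure M (f -` {v} \<inter> space M) \<le> emeasure M {y \<in> space M. f y \<noteq> 0}"
      using that by (intro emeasure_mono) auto
    then show "emeasure M (f -` {v} \<inter> space M) < \<infinity>"
      using s(2) by (simp add: less_top order_le_less_trans top.not_eq_extremum)
  qed
  have finV: "finite (f ` space M)" "finite (g ` space M)"
    using f g by (auto simp: Bochner_Integration.simple_bochner_integrable.simps simple_function_def)
  have expand: "h (f x) = (\<Sum>v\<in>f ` space M - {0}. h v * fib f v x)"
    if x: "x \<in> space M" and fin: "finite (f ` space M)" for x and f :: "'a \<Rightarrow> complex"
  proof -
    have "(\<Sum>v\<in>f ` space M - {0}. h v * fib f v x) =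
      (\<Sum>v\<in>f ` space M - {0}. if v = f x then h v else 0)"
      using x by (intro sum.cong) (auto simp: indicator_def)
    also have "\<dots> = h (f x)" using x fin h0 by (auto simp: sum.delta')
    finally show ?thesis by simp
  qed
  have int1: "integrable M (fib f v :: 'a \<Rightarrow> complex)" if "v \<noteq> 0" for v
  proof -
    have "complex_integrable M (\<lambda>x. of_real (fib f v x))"
      using fin[OF that f] by (intro integrable_of_real integrable_real_indicator) auto
    then show ?thesis by (simp add: indicator_def[abs_def] of_bool_def if_distrib cong: if_cong)
  qed
  have T1: "T (\<lambda>x. h (f x)) l = (\<Sum>v\<in>f ` space M - {0}. h v * T (fib f v) l)"
    if l: "l \<in> space M" for l
  proof -
    have "T (\<lambda>x. h (f x)) l = (LINT x|M. (\<Sum>v\<in>f ` space M - {0}. h v * (fib f v x * N l x)))"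
      unfolding T_def using expand[OF _ finV(1)]
      by (intro Bochner_Integration.integral_cong) (auto simp: sum_distrib_right mult.assoc)
    also have "\<dots> = (\<Sum>v\<in>f ` space M - {0}. LINT x|M. h v * (fib f v x * N l x))"
      using integrable_N[OF int1 l] by (intro Bochner_Integration.integral_sum integrable_mult_right) auto
    finally show ?thesis by (simp add: T_def)
  qed
  have int2: "integrable M (\<lambda>l. T (fib f v) l * fib g u l)"
    if "v \<noteq> 0" "u \<noteq> 0" for u v
  proof (rule integrable_dominated
      [of M "\<lambda>l. C * (LINT x|M. norm (fib f v x :: complex)) * fib g u l :: real"])
    note [measurable] = fin(2)[OF that(1) f] fin(2)[OF that(2) g]
    show "integrable M (\<lambda>l. C * (LINT x|M. norm (fib f v x :: complex)) * fib g u l :: real)"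
      using fin[OF that(2) g] by (auto simp: integrable_indicator_iff)
    show "(\<lambda>l. T (fib f v) l * fib g u l) \<in> borel_measurable M"
      by measurable
    show "AE l in M. norm (T (fib f v) l * fib g u l) \<le> 
      norm (C * (LINT x|M. norm (fib f v x :: complex)) * fib g u l :: real)"
      using norm_T_le[OF int1[OF that(1)]]
      by (intro AE_I2) (auto simp: indicator_def norm_mult intro: order_trans[OF _ abs_ge_self])
  qed
  have "(LINT l|M. T (\<lambda>x. h (f x)) l * h (g l)) =
    (LINT l|M. (\<Sum>v\<in>f ` space M - {0}. \<Sum>u\<in>g ` space M - {0}. h v * h u *
       (T (fib f v) l * fib g u l)))"
  proof (rule Bochner_Integration.integral_cong[OF refl], goal_cases)
    case (1 l)
    then show ?case
      unfolding T1[OF 1] expand[OF 1 finV(2)] sum_product by (intro sum.cong refl) (simp add: mult_ac)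
  qed
  also have "\<dots> = (\<Sum>v\<in>f ` space M - {0}. \<Sum>u\<in>g ` space M - {0}. LINT l|M. h v * h u *
       (T (fib f v) l * fib g u l))"
    using int2
    by (subst Bochner_Integration.integral_sum, (intro Bochner_Integration.integrable_sum integrable_mult_right; simp),
        intro sum.cong refl, subst Bochner_Integration.integral_sum)
       (auto intro!: integrable_mult_right)
  finally show ?thesis by simp
qed

lemma integrable_T_mult:
  assumes f: "integrable M f" and g: "integrable M g"
  shows "integrable M (\<lambda>l. T f l * g l)"
proof (rule integrable_dominated)
  note borel_measurable_integrable[OF f, measurable] borel_measurable_integrable[OF g, measurable]
  show "integrable M (\<lambda>l. (C * (LINT x|M. norm (f x))) * norm (g l))" using g by simp
  show "(\<lambda>l. T f l * g l) \<in> borel_measurable M" by measurable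
  show "AE l in M. norm (T f l * g l) \<le> norm ((C * (LINT x|M. norm (f x))) * norm (g l))"
  proof (rule AE_I2)
    fix l assume "l \<in> space M"
    then have "norm (T f l) \<le> \<bar>C * (LINT x|M. norm (f x))\<bar>"
      using norm_T_le[OF f] order_trans[OF _ abs_ge_self] by blast
    then show "norm (T f l * g l) \<le> norm ((C * (LINT x|M. norm (f x))) * norm (g l))"
      by (simp add: norm_mult abs_mult mult_right_mono)
  qed
qed

lemma simple_bochner_integrable_compose:
  fixes f :: "'a \<Rightarrow> 'b::real_normed_vector"
  assumes "simple_int f" "h 0 = 0"
  shows "simple_int (\<lambda>x. h (f x))"
  using simple_bochner_integrable_compose2[of "\<lambda>a b. h a" M f f] assms by simp

abbreviation pmom :: "real \<Rightarrow> ('a \<Rightarrow> complex) \<Rightarrow> real" where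
  "pmom p f \<equiv> LINT x|M. norm (f x) powr p"

text \<open>One exponent \<open>p\<close> serves both functions, because \<open>L^p\<close> is the predual of the target \<open>L^q\<close>.\<close>

lemma simple_bilinear_bound_normalized:
  assumes f: "simple_int f"
    and g: "simple_int g"
    and \<theta>: "0 \<le> \<theta>" "\<theta> \<le> 1" and p: "p * (1 - \<theta> / 2) = 1"
    and nf: "(pmom p f) = 1" and ng: "(pmom p g) = 1"
  shows "norm (LINT l|M. T f l * g l) \<le> C powr (1 - \<theta>)"
proof -
  have p0: "p \<ge> 0" using p \<theta> by (smt (verit) divide_le_eq_1 mult_nonneg_nonneg mult_minus_left)
  define c where "c v u = (LINT l|M. T (fib f v) l * fib g u l)"
    for v u
  define \<Phi> where "\<Phi> z = (\<Sum>v\<in>f ` space M - {0}. \<Sum>u\<in>g ` space M - {0}. interp p z v * interp p z u * c v u)" for z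
  have \<Phi>: "\<Phi> z = (LINT l|M. T (\<lambda>x. interp p z (f x)) l * interp p z (g l))" for z
    unfolding \<Phi>_def c_def using simple_integral_expand[OF f g, of "interp p z"] by simp
  have int: "integrable M (\<lambda>x. interp p z (f x))" "integrable M (\<lambda>x. (norm (interp p z (f x)))\<^sup>2)"
    if "simple_int f" for f z
    using simple_bochner_integrable_compose[OF that, of "interp p z"]
      simple_bochner_integrable_compose[OF that, of "\<lambda>v. (norm (interp p z v))\<^sup>2"]
    by (auto intro: integrableI_simple_bochner_integrable)
  have "norm (\<Phi> (of_real \<theta>)) \<le> C powr (1 - \<theta>) * 1 powr \<theta>"
  proof (rule hadamard_three_lines[OF _ _ _ _ C_pos _ \<theta>])
    show "\<Phi> holomorphic_on UNIV"
      unfolding \<Phi>_def interp_def by (intro holomorphic_intros) auto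
  next
    have wb: "norm (interp p z v) \<le> exp (p * \<bar>ln (norm v)\<bar>)" if "0 \<le> Re z" "Re z \<le> 1" for z v
    proof (cases "v = 0")
      case False
      have "p * (1 - Re z / 2) * ln (norm v) \<le> \<bar>p * (1 - Re z / 2)\<bar> * \<bar>ln (norm v)\<bar>"
        by (metis abs_ge_self abs_mult)
      also have "\<dots> \<le> p * \<bar>ln (norm v)\<bar>"
        using that p0 by (intro mult_right_mono) (auto simp: abs_mult mult_left_le)
      finally show ?thesis using False by (simp add: norm_interp powr_def)
    qed simp
    fix z assume z: "0 \<le> Re z" "Re z \<le> 1"
    show "norm (\<Phi> z) \<le> (\<Sum>v\<in>f ` space M - {0}. \<Sum>u\<in>g ` space M - {0}.
        exp (p * \<bar>ln (norm v)\<bar>) * exp (p * \<bar>ln (norm u)\<bar>) * norm (c v u))"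
      unfolding \<Phi>_def using wb[OF z]
      by (intro sum_norm_le) (auto simp: norm_mult intro!: mult_mono mult_right_mono)
  next
    fix z assume z: "Re z = 0"
    \<comment> \<open>Both moduli are now \<open>p\<close>-th powers with integral 1, so the sup
      bound of the kernel alone gives \<open>C\<close>.\<close>
    have n: "norm (interp p z v) = norm v powr p" for v using z by (simp add: norm_interp)
    have "norm (\<Phi> z) \<le> (LINT l|M. norm (T (\<lambda>x. interp p z (f x)) l * interp p z (g l)))"
      unfolding \<Phi> by (rule integral_norm_bound)
    also have "\<dots> \<le> (LINT l|M. C * (LINT x|M. norm (interp p z (f x))) * norm (interp p z (g l)))"
      using norm_T_le[OF int(1)[OF f]] int(1)[OF g]
      by (intro integral_mono integrable_norm integrable_T_mult int f g integrable_mult_right)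
         (auto simp: norm_mult intro!: mult_right_mono)
    also have "\<dots> = C" using int(1)[OF g] nf ng by (simp add: n)
    finally show "norm (\<Phi> z) \<le> C" .
  next
    fix z assume z: "Re z = 1"
    have n: "(norm (interp p z v))\<^sup>2 = norm v powr p" for v
      using z by (simp add: norm_interp powr_numeral[symmetric] powr_powr del: powr_numeral)
    define F where "F = T (\<lambda>x. interp p z (f x))"
    define G where "G = (\<lambda>l. interp p z (g l))"
    have pl: "integrable M (\<lambda>l. (norm (F l))\<^sup>2)" "(LINT l|M. (norm (F l))\<^sup>2) \<le> 1"
      using plancherel[OF int[OF f, of z]] nf by (auto simp: n F_def T_def)
    have g2: "integrable M (\<lambda>l. (norm (G l))\<^sup>2)" "(LINT l|M. (norm (G l))\<^sup>2) = 1"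
      using int(2)[OF g, of z] ng by (auto simp: n G_def)
    have "norm (\<Phi> z) \<le> (LINT l|M. norm (F l * G l))"
      unfolding \<Phi> F_def G_def by (rule integral_norm_bound)
    \<comment> \<open>The mean of the squares takes the place of the Cauchy-Schwarz inequality,
      because both L^2 norms are at most 1.\<close>
    also have "\<dots> \<le> (LINT l|M. ((norm (F l))\<^sup>2 + (norm (G l))\<^sup>2) / 2)"
    proof (rule integral_mono)
      show "integrable M (\<lambda>l. norm (F l * G l))"
        unfolding F_def G_def by (intro integrable_norm integrable_T_mult int f g)
      show "integrable M (\<lambda>l. ((norm (F l))\<^sup>2 + (norm (G l))\<^sup>2) / 2)" using pl g2 by simp
      show "norm (F l * G l) \<le> ((norm (F l))\<^sup>2 + (norm (G l))\<^sup>2) / 2" for l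
        using sum_squares_bound[of "norm (F l)" "norm (G l)"] by (simp add: norm_mult)
    qed
    also have "\<dots> = ((LINT l|M. (norm (F l))\<^sup>2) + (LINT l|M. (norm (G l))\<^sup>2)) / 2"
      using pl g2 by simp
    also have "\<dots> \<le> 1" using pl g2 by simp
    finally show "norm (\<Phi> z) \<le> 1" .
  qed simp
  moreover have "\<Phi> (of_real \<theta>) = (LINT l|M. T f l * g l)"
    unfolding \<Phi> by (simp add: interp_eq_self[OF p])
  ultimately show ?thesis by simp
qed

text \<open>Homogeneity: \<open>f\<close> and \<open>g\<close> are divided by their \<open>p\<close>
  norms. A function of norm 0 cannot be divided, but it vanishes almost everywhere and both sides
  are 0.\<close>

lemma simple_bilinear_bound:
  assumes f: "simple_int f"
    and g: "simple_int g"
    and \<theta>: "0 \<le> \<theta>" "\<theta> \<le> 1" and p: "p * (1 - \<theta> / 2) = 1"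
  shows "norm (LINT l|M. T f l * g l) \<le> C powr (1 - \<theta>) *
     (pmom p f) powr (1 / p) * (pmom p g) powr (1 / p)"
proof -
  have p0: "p > 0" using p \<theta> by (smt (verit) divide_le_eq_1 mult_nonneg_nonneg mult_minus_left mult_zero_left)
  have intp: "integrable M (\<lambda>x. norm (f x) powr p)"
    if "simple_int f" for f :: "'a \<Rightarrow> complex"
    using simple_bochner_integrable_compose[OF that, of "\<lambda>v. norm v powr p"] 
    by (auto intro: integrableI_simple_bochner_integrable)
  have nn: "(pmom p f) \<ge> 0" for f :: "'a \<Rightarrow> complex" by (rule bochner_nonneg) simp
  have zero: "AE x in M. f x = 0" if "simple_int f" 
     "(pmom p f) = 0" for f :: "'a \<Rightarrow> complex"
    using that(2) integral_nonneg_eq_0_iff_AE[OF intp[OF that(1)]] by simp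
  have sc: "simple_int (\<lambda>x. f x / of_real a)"
     "(LINT x|M. norm (f x / of_real a) powr p) = 1" 
    if "simple_int f" "(pmom p f) > 0"
      "a = (pmom p f) powr (1 / p)" for f :: "'a \<Rightarrow> complex" and a
  proof -
    show "simple_int (\<lambda>x. f x / of_real a)"
      using simple_bochner_integrable_compose[OF that(1), of "\<lambda>v. v / of_real a"] by simp
    have "a > 0" using that by simp
    then have "(LINT x|M. norm (f x / of_real a) powr p) = (LINT x|M. norm (f x) powr p / a powr p)"
      by (simp add: norm_divide powr_divide)
    also have "\<dots> = 1" using that p0 by (simp add: powr_powr)
    finally show "(LINT x|M. norm (f x / of_real a) powr p) = 1" .
  qed
  define a where "a = (pmom p f) powr (1 / p)"
  define b where "b = (pmom p g) powr (1 / p)"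
  consider "(pmom p f) = 0" | "(pmom p g) = 0" |
    "(pmom p f) > 0" "(pmom p g) > 0"
    using nn[of f] nn[of g] by linarith
  then show ?thesis
  proof cases
    case 1
    have "T f l = 0" for l
      unfolding T_def by (rule integral_eq_zero_AE) (use zero[OF f 1] in auto)
    then show ?thesis using 1 by simp
  next
    case 2
    have "(LINT l|M. T f l * g l) = 0"
      by (rule integral_eq_zero_AE) (use zero[OF g 2] in auto)
    then show ?thesis using 2 by simp
  next
    case 3
    have ab: "a > 0" "b > 0" using 3 by (auto simp: a_def b_def)
    have "norm (LINT l|M. T (\<lambda>x. f x / of_real a) l * (g l / of_real b)) \<le> C powr (1 - \<theta>)"
      by (rule simple_bilinear_bound_normalized[OF sc(1)[OF f 3(1) a_def] sc(1)[OF g 3(2) b_def] \<theta> p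
          sc(2)[OF f 3(1) a_def] sc(2)[OF g 3(2) b_def]])
    also have "(LINT l|M. T (\<lambda>x. f x / of_real a) l * (g l / of_real b)) = (LINT l|M. T f l * g l) / of_real (a * b)"
      by (simp add: T_def)
    finally have "norm (LINT l|M. T f l * g l) / (a * b) \<le> C powr (1 - \<theta>)"
      using ab by (simp add: norm_divide norm_mult)
    then show ?thesis using ab unfolding a_def[symmetric] b_def[symmetric] by (simp add: field_simps)
  qed
qed

text \<open>The pointwise bound by \<open>2 * norm (f x)\<close> supplies the majorant under which
  the \<open>p\<close> moments converge. It also makes \<open>norm (s i x) powr p\<close>
  integrable, which for a simple function means that its support has finite measure.\<close>

lemma simple_function_approx:
  fixes f :: "'a \<Rightarrow> complex"
  assumes [measurable]: "f \<in> borel_measurable M" and "p > 0" and int: "integrable M (\<lambda>x. norm (f x) powr p)"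
  obtains s where "\<And>i. simple_int (s i)"
    "\<And>x. x \<in> space M \<Longrightarrow> (\<lambda>i. s i x) \<longlonglongrightarrow> f x"
    "\<And>i x. x \<in> space M \<Longrightarrow> norm (s i x) \<le> 2 * norm (f x)"
    "(\<lambda>i. pmom p (s i)) \<longlonglongrightarrow> (pmom p f)"
proof -
  obtain s where s: "\<And>i. simple_function M (s i)"
    "\<And>x. x \<in> space M \<Longrightarrow> (\<lambda>i. s i x) \<longlonglongrightarrow> f x"
    "\<And>i x. x \<in> space M \<Longrightarrow> norm (s i x) \<le> 2 * norm (f x)"
    using borel_measurable_implies_sequence_metric[OF assms(1), of 0] unfolding dist_norm diff_0_right by metis
  have [measurable]: "s i \<in> borel_measurable M" for i by (rule borel_measurable_simple_function[OF s(1)])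
  have le: "norm (s i x) powr p \<le> 2 powr p * norm (f x) powr p" if "x \<in> space M" for i x
    using powr_mono2[OF _ _ s(3)[OF that], of p] \<open>p > 0\<close> by (simp add: powr_mult)
  have dom: "integrable M (\<lambda>x. 2 powr p * norm (f x) powr p)" using int by simp
  have si: "integrable M (\<lambda>x. norm (s i x) powr p)" for i
    by (rule integrable_dominated[OF dom]) (auto intro!: AE_I2 le)
  have "simple_int (s i)" for i
  proof -
    have "simple_int (\<lambda>x. norm (s i x) powr p)"
    proof (rule simple_bochner_integrableI_bounded)
      show "simple_function M (\<lambda>x. norm (s i x) powr p)"
        using simple_function_compose1[OF s(1), of "\<lambda>v. norm v powr p"] by simp
      show "(\<integral>\<^sup>+ x. ennreal (norm (norm (s i x) powr p)) \<partial>M) < \<infinity>"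
        using si[of i] unfolding integrable_iff_bounded by auto
    qed
    then show ?thesis
      using s(1) unfolding Bochner_Integration.simple_bochner_integrable.simps by simp
  qed
  moreover have "(\<lambda>i. pmom p (s i)) \<longlonglongrightarrow> (pmom p f)"
  proof (rule integral_dominated_convergence[OF _ _ dom])
    show "AE x in M. (\<lambda>i. norm (s i x) powr p) \<longlonglongrightarrow> norm (f x) powr p"
      using s(2) \<open>p > 0\<close> by (intro AE_I2 tendsto_powr' tendsto_norm tendsto_const) auto
    show "AE x in M. norm (norm (s i x) powr p) \<le> 2 powr p * norm (f x) powr p" for i
      using le by (auto intro!: AE_I2)
  qed auto
  ultimately show ?thesis using that s by blast
qed

lemma conjugate_exponent:
  fixes p q :: real
  assumes p: "1 < p" "p \<le> 2" and pq: "1 / p + 1 / q = 1"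
  shows "q \<ge> 2" "p + q = p * q" "p / q = p - 1"
proof -
  have a: "1 / q = 1 - 1 / p" using pq by simp
  then have "1 / q > 0" using p by simp
  then have q0: "q > 0" by simp
  have "1 / q \<le> 1 / 2" unfolding a using p by (simp add: field_simps)
  then show "q \<ge> 2" using q0 by (simp add: field_simps)
  have "p * q * (1 / p + 1 / q) = q + p" using p q0 by (simp add: distrib_left)
  then show "p + q = p * q" unfolding pq by simp
  have "p * (1 / q) = p - 1" unfolding a using p by (simp add: right_diff_distrib)
  then show "p / q = p - 1" by simp
qed

text \<open>Duality with \<open>g = conj (sgn u) |u|^(q-1)\<close>, \<open>u = T f\<close>; the a priori finiteness of the \<open>L^q\<close> norm of \<open>u\<close>,
  needed to cancel, holds because \<open>u\<close> is bounded and square integrable.\<close>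

lemma hausdorff_young_simple:
  assumes f: "simple_int f"
    and p: "1 < p" "p \<le> 2" and pq: "1 / p + 1 / q = 1"
  shows "integrable M (\<lambda>l. norm (T f l) powr q)"
    "(LINT l|M. norm (T f l) powr q) \<le> (C powr (1 - 2 / q) * (pmom p f) powr (1 / p)) powr q"
proof -
  note q = conjugate_exponent[OF p pq]
  define u where "u = T f"
  have fi: "integrable M f" by (rule integrableI_simple_bochner_integrable[OF f])
  have f2: "integrable M (\<lambda>x. (norm (f x))\<^sup>2)"
    using simple_bochner_integrable_compose[OF f, of "\<lambda>v. (norm v)\<^sup>2"]
    by (auto intro: integrableI_simple_bochner_integrable)
  have fp: "integrable M (\<lambda>x. norm (f x) powr p)"
    using simple_bochner_integrable_compose[OF f, of "\<lambda>v. norm v powr p"]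
    by (auto intro: integrableI_simple_bochner_integrable)
  have [measurable]: "u \<in> borel_measurable M" unfolding u_def using fi by measurable
  define K where "K = C * (LINT x|M. norm (f x))"
  have u_le: "norm (u l) \<le> K" if "l \<in> space M" for l
    unfolding u_def K_def by (rule norm_T_le[OF fi that])
  have uq: "integrable M (\<lambda>l. norm (u l) powr q)"
  proof (rule integrable_dominated)
    show "integrable M (\<lambda>l. K powr (q - 2) * (norm (u l))\<^sup>2)"
      using plancherel[OF fi f2] by (simp add: u_def T_def)
    show "AE l in M. norm (norm (u l) powr q) \<le> norm (K powr (q - 2) * (norm (u l))\<^sup>2)"
    proof (rule AE_I2)
      fix l assume l: "l \<in> space M"
      have "norm (u l) powr q = norm (u l) powr (q - 2) * (norm (u l))\<^sup>2"
        by (cases "u l = 0") (simp_all add: powr_numeral[symmetric] powr_add[symmetric] del: powr_numeral)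
      also have "\<dots> \<le> K powr (q - 2) * (norm (u l))\<^sup>2"
        using u_le[OF l] q by (intro mult_right_mono powr_mono2) auto
      finally show "norm (norm (u l) powr q) \<le> norm (K powr (q - 2) * (norm (u l))\<^sup>2)" by simp
    qed
  qed measurable
  then show "integrable M (\<lambda>l. norm (T f l) powr q)" by (simp add: u_def)
  define g where "g l = cnj (sgn (u l)) * of_real (norm (u l) powr (q - 1))" for l
  have [measurable]: "cnj \<in> borel_measurable borel" "(of_real :: real \<Rightarrow> complex) \<in> borel_measurable borel"
    by (auto intro!: borel_measurable_continuous_onI continuous_intros)
  have gm [measurable]: "g \<in> borel_measurable M" unfolding g_def sgn_div_norm by measurable
  have ng: "norm (g l) = norm (u l) powr (q - 1)" for l
    using q by (cases "u l = 0") (auto simp: g_def norm_mult norm_sgn)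
  have ngp: "norm (g l) powr p = norm (u l) powr q" for l
  proof -
    have "(q - 1) * p = q" using q(2) by (simp add: algebra_simps)
    then show ?thesis by (simp add: ng powr_powr)
  qed
  have ug: "u l * g l = of_real (norm (u l) powr q)" for l
  proof (cases "u l = 0")
    case False
    have "u l * cnj (sgn (u l)) = (u l * cnj (u l)) / of_real (norm (u l))" by (simp add: sgn_eq)
    also have "\<dots> = of_real ((norm (u l))\<^sup>2) / of_real (norm (u l))"
      by (simp only: complex_norm_square)
    also have "\<dots> = of_real (norm (u l))" using False by (simp add: power2_eq_square)
    finally have "u l * cnj (sgn (u l)) = of_real (norm (u l))" .
    then have "u l * g l = of_real (norm (u l) * norm (u l) powr (q - 1))"
      by (simp add: g_def mult.assoc[symmetric])
    also have "norm (u l) * norm (u l) powr (q - 1) = norm (u l) powr q"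
      using False powr_add[of "norm (u l)" 1 "q - 1"] by simp
    finally show ?thesis .
  qed (use q in simp)
  define J where "J = (LINT l|M. norm (u l) powr q)"
  have J0: "J \<ge> 0" unfolding J_def by (rule bochner_nonneg) simp
  obtain s where s: "\<And>i. simple_int (s i)"
    "\<And>x. x \<in> space M \<Longrightarrow> (\<lambda>i. s i x) \<longlonglongrightarrow> g x"
    "\<And>i x. x \<in> space M \<Longrightarrow> norm (s i x) \<le> 2 * norm (g x)"
    "(\<lambda>i. pmom p (s i)) \<longlonglongrightarrow> J"
    using simple_function_approx[OF gm, of p] p uq unfolding ngp J_def by auto
  have [measurable]: "s i \<in> borel_measurable M" for i
    using s(1)[of i] unfolding Bochner_Integration.simple_bochner_integrable.simps
    by (auto intro: borel_measurable_simple_function)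
  define R where "R = C powr (1 - 2 / q) * (pmom p f) powr (1 / p)"
  have bnd: "norm (LINT l|M. u l * s i l) \<le> R * (pmom p (s i)) powr (1 / p)" for i
  proof -
    \<comment> \<open>The interpolation parameter is \<theta> = 2/q, because 1 - \<theta>/2 = 1 -
      1/q = 1/p.\<close>
    have "p * (1 - (2 / q) / 2) = 1" using p q by (simp add: right_diff_distrib)
    from simple_bilinear_bound[OF f s(1) _ _ this] show ?thesis using q unfolding R_def u_def by simp
  qed
  have lim: "(\<lambda>i. LINT l|M. u l * s i l) \<longlonglongrightarrow> (LINT l|M. u l * g l)"
  proof (rule integral_dominated_convergence[where w = "\<lambda>l. 2 * norm (u l) powr q"])
    show "AE l in M. (\<lambda>i. u l * s i l) \<longlonglongrightarrow> u l * g l"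
      using s(2) by (auto intro!: AE_I2 tendsto_mult)
    show "AE l in M. norm (u l * s i l) \<le> 2 * norm (u l) powr q" for i
    proof (rule AE_I2)
      fix l assume l: "l \<in> space M"
      have "norm (u l * s i l) \<le> norm (u l) * (2 * norm (g l))"
        unfolding norm_mult using s(3)[OF l] by (intro mult_left_mono) auto
      also have "\<dots> = 2 * norm (u l * g l)" by (simp add: norm_mult)
      finally show "norm (u l * s i l) \<le> 2 * norm (u l) powr q" by (simp add: ug)
    qed
  qed (use uq in auto)
  have "norm (LINT l|M. u l * g l) \<le> R * J powr (1 / p)"
  proof (rule LIMSEQ_le[OF tendsto_norm[OF lim]])
    show "(\<lambda>i. R * (pmom p (s i)) powr (1 / p)) \<longlonglongrightarrow> R * J powr (1 / p)"
      using p by (intro tendsto_intros tendsto_powr' s(4)) (auto intro!: always_eventually bochner_nonneg)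
  qed (use bnd in auto)
  then have main: "J \<le> R * J powr (1 / p)"
    using J0 by (simp add: ug J_def[symmetric])
  have "J \<le> R powr q"
  proof (cases "J = 0")
    case False
    then have J: "J > 0" using J0 by simp
    have "J = J powr (1 / q) * J powr (1 / p)" using J pq by (simp add: powr_add[symmetric] add.commute)
    then have "J powr (1 / q) * J powr (1 / p) \<le> R * J powr (1 / p)" using main by simp
    then have "J powr (1 / q) \<le> R" using J by simp
    then have "(J powr (1 / q)) powr q \<le> R powr q" using q by (intro powr_mono2) auto
    then show ?thesis using J q by (simp add: powr_powr)
  qed simp
  then show "(LINT l|M. norm (T f l) powr q) \<le> (C powr (1 - 2 / q) * (pmom p f) powr (1 / p)) powr q"
    by (simp add: J_def R_def u_def)
qed

text \<open>Integrability of \<open>f\<close> makes \<open>T (s i)\<close> converge to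
  \<open>T f\<close> at every point along simple approximations. Fatou's lemma then transfers the
  bound, since the right-hand sides depend continuously on the \<open>p\<close> moments.\<close>

theorem hausdorff_young:
  assumes f: "integrable M f" and fp: "integrable M (\<lambda>x. norm (f x) powr p)"
    and p: "1 < p" "p \<le> 2" and pq: "1 / p + 1 / q = 1"
  shows "(\<integral>\<^sup>+l. norm (T f l) powr q \<partial>M) \<le>
    ennreal ((C powr (1 - 2 / q) * (pmom p f) powr (1 / p)) powr q)"
proof -
  have q0: "q > 0" using conjugate_exponent(1)[OF p pq] by simp
  note borel_measurable_integrable[OF f, measurable]
  obtain s where s: "\<And>i. simple_int (s i)"
    "\<And>x. x \<in> space M \<Longrightarrow> (\<lambda>i. s i x) \<longlonglongrightarrow> f x"
    "\<And>i x. x \<in> space M \<Longrightarrow> norm (s i x) \<le> 2 * norm (f x)"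
    "(\<lambda>i. pmom p (s i)) \<longlonglongrightarrow> (pmom p f)"
    using simple_function_approx[OF _ _ fp] p by auto
  have sm [measurable]: "s i \<in> borel_measurable M" for i
    using s(1)[of i] unfolding Bochner_Integration.simple_bochner_integrable.simps
    by (auto intro: borel_measurable_simple_function)
  define R where "R P = (C powr (1 - 2 / q) * P powr (1 / p)) powr q" for P
  have "(\<integral>\<^sup>+l. norm (T f l) powr q \<partial>M) = (\<integral>\<^sup>+l. liminf (\<lambda>i. ennreal (norm (T (s i) l) powr q)) \<partial>M)"
  proof (rule nn_integral_cong)
    fix l assume l: "l \<in> space M"
    have "(\<lambda>i. ennreal (norm (T (s i) l) powr q)) \<longlonglongrightarrow> ennreal (norm (T f l) powr q)"
      using q0 by (intro tendsto_ennrealI tendsto_powr' tendsto_norm tendsto_const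
        T_tendsto[OF f sm s(3) s(2) l]) auto
    then show "ennreal (norm (T f l) powr q) = liminf (\<lambda>i. ennreal (norm (T (s i) l) powr q))"
      by (intro lim_imp_Liminf[symmetric]) simp_all
  qed
  also have "\<dots> \<le> liminf (\<lambda>i. \<integral>\<^sup>+l. norm (T (s i) l) powr q \<partial>M)"
    by (rule nn_integral_liminf) measurable
  also have "\<dots> \<le> liminf (\<lambda>i. ennreal (R (pmom p (s i))))"
  proof (intro Liminf_mono always_eventually allI)
    fix i
    show "(\<integral>\<^sup>+l. norm (T (s i) l) powr q \<partial>M) \<le> ennreal (R (pmom p (s i)))"
      using hausdorff_young_simple[OF s(1)[of i] p pq] unfolding R_def
      by (subst nn_integral_eq_integral) auto
  qed
  also have "\<dots> = ennreal (R (pmom p f))"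
  proof (intro lim_imp_Liminf tendsto_ennrealI)
    show "(\<lambda>i. R (pmom p (s i))) \<longlonglongrightarrow> R (pmom p f)"
      unfolding R_def using p q0 
      by (intro tendsto_powr' tendsto_mult tendsto_const s(4) disjI2 conjI always_eventually allI)
         (auto intro!: bochner_nonneg)
  qed simp
  finally show ?thesis by (simp add: R_def)
qed

end

section \<open>Bessel series and the Dunkl kernel\<close>

abbreviation poch :: "real \<Rightarrow> nat \<Rightarrow> real" where
  "poch \<nu> n \<equiv> pochhammer (\<nu> + 1) n"

text \<open>The series of \<open>0F1(\<nu> + 1; t)\<close>, so that \<open>j_\<nu>(u) = hyp01 \<nu> (- u^2/4)\<close>; positive arguments give the
  modified Bessel functions of the heat kernel.\<close>

definition hyp01 :: "real \<Rightarrow> real \<Rightarrow> real" where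
  "hyp01 \<nu> t = (\<Sum>n. t ^ n / (fact n * poch \<nu> n))"

text \<open>All factors after the first are at least 1 because \<open>\<nu> > -1\<close>. The bound
  is uniform in \<open>n\<close>, which is what allows the comparison of \<open>hyp01\<close> with
  the exponential series.\<close>

lemma pochhammer_lower_bound:
  fixes \<nu> :: real
  assumes "\<nu> > -1"
  shows "poch \<nu> n \<ge> (if n = 0 then 1 else (\<nu> + 1))" "poch \<nu> n > 0"
proof -
  show pos: "poch \<nu> n > 0" for n using assms by (intro pochhammer_pos) simp
  show "poch \<nu> n \<ge> (if n = 0 then 1 else (\<nu> + 1))"
  proof (induction n)
    case (Suc n)
    show ?case
    proof (cases "n = 0")
      case False
      have "(\<nu> + 1) * 1 \<le> poch \<nu> n * (\<nu> + 1 + real n)"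
        using Suc False assms by (intro mult_mono) auto
      then show ?thesis by (simp add: pochhammer_Suc)
    qed simp
  qed simp
qed

lemma summable_hyp01:
  fixes \<nu> t :: real
  assumes "\<nu> > -1"
  shows "summable (\<lambda>n. norm (t ^ n / (fact n * poch \<nu> n)))"
proof (rule summable_comparison_test')
  define d where "d = min 1 (\<nu> + 1)"
  have d: "d > 0" using assms by (auto simp: d_def min_def)
  show "summable (\<lambda>n. inverse d * (\<bar>t\<bar> ^ n / fact n))"
    using summable_exp[of "\<bar>t\<bar>"] by (intro summable_mult) (simp add: field_simps)
  fix n
  have "poch \<nu> n \<ge> d"
    using pochhammer_lower_bound(1)[OF assms, of n] by (auto simp: d_def split: if_splits)
  then have "\<bar>t\<bar> ^ n / (fact n * poch \<nu> n) \<le> \<bar>t\<bar> ^ n / (fact n * d)"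
    using d by (intro divide_left_mono mult_left_mono mult_pos_pos) auto
  then show "norm (norm (t ^ n / (fact n * poch \<nu> n))) \<le> inverse d * (\<bar>t\<bar> ^ n / fact n)"
    using pochhammer_lower_bound(2)[OF assms, of n] by (simp add: abs_mult power_abs field_simps)
qed

lemma hyp01_sums: "\<nu> > -1 \<Longrightarrow> (\<lambda>n. t ^ n / (fact n * poch \<nu> n)) sums hyp01 \<nu> t"
  unfolding hyp01_def by (intro summable_sums summable_norm_cancel[OF summable_hyp01])

lemma hyp01_0: "\<nu> > -1 \<Longrightarrow> hyp01 \<nu> 0 = 1"
  using sums_unique2[OF hyp01_sums[of \<nu> 0]]
    powser_sums_zero[of "\<lambda>n. 1 / (fact n * poch \<nu> n)"] by simp

lemma hyp01_pos: "\<nu> > -1 \<Longrightarrow> t \<ge> 0 \<Longrightarrow> hyp01 \<nu> t > 0"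
  unfolding hyp01_def
  by (intro suminf_pos2[where i = 0] summable_norm_cancel[OF summable_hyp01])
     (auto intro!: divide_nonneg_nonneg mult_nonneg_nonneg less_imp_le[OF pochhammer_lower_bound(2)])

lemma hyp01_deriv:
  assumes "\<nu> > -1"
  shows "(hyp01 \<nu> has_real_derivative hyp01 (\<nu> + 1) t / (\<nu> + 1)) (at t)"
proof -
  define c where "c n = 1 / (fact n * poch \<nu> n)" for n
  have sm: "summable (\<lambda>n. c n * x ^ n)" for x
    using summable_norm_cancel[OF summable_hyp01[OF assms, of x]] by (simp add: c_def)
  have "DERIV (\<lambda>x. \<Sum>n. c n * x ^ n) t :> (\<Sum>n. diffs c n * t ^ n)"
    by (rule termdiffs_strong_converges_everywhere[OF sm])
  moreover have "(\<lambda>x. \<Sum>n. c n * x ^ n) = hyp01 \<nu>"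
    by (simp add: hyp01_def[abs_def] c_def)
  moreover have "(\<lambda>n. diffs c n * t ^ n) sums (hyp01 (\<nu> + 1) t / (\<nu> + 1))"
  proof -
    have "diffs c n * t ^ n = (t ^ n / (fact n * pochhammer (\<nu> + 1 + 1) n)) / (\<nu> + 1)" for n
      unfolding diffs_def c_def fact_Suc pochhammer_rec using of_nat_neq_0[of n, where 'a = real]
      by (simp del: of_nat_Suc)
    then show ?thesis
      using sums_divide[OF hyp01_sums[of "\<nu> + 1" t], of "\<nu> + 1"] assms by simp
  qed
  ultimately show ?thesis by (simp add: sums_iff)
qed

text \<open>A contiguous relation of 0F1, equivalent to the three-term recurrence of the Bessel
  functions. It is compared power by power; the factor \<open>t\<close> shifts the last series by
  one index, hence \<open>g\<close> with value 0 at 0.\<close>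

lemma hyp01_rec:
  assumes "\<nu> > -1"
  shows "hyp01 \<nu> t = hyp01 (\<nu> + 1) t + t * hyp01 (\<nu> + 2) t / ((\<nu> + 1) * (\<nu> + 2))"
proof -
  define h where "h = (\<lambda>n. t ^ n / (fact n * pochhammer (\<nu> + 3) n))"
  define g where "g n = (case n of 0 \<Rightarrow> 0 | Suc m \<Rightarrow> t * h m / ((\<nu> + 1) * (\<nu> + 2)))" for n
  have "h sums hyp01 (\<nu> + 2) t"
    using hyp01_sums[of "\<nu> + 2" t] assms by (simp add: h_def add.assoc)
  then have "(\<lambda>m. g (Suc m)) sums (t * hyp01 (\<nu> + 2) t / ((\<nu> + 1) * (\<nu> + 2)))"
    unfolding g_def by (simp add: sums_divide sums_mult)
  then have g: "g sums (t * hyp01 (\<nu> + 2) t / ((\<nu> + 1) * (\<nu> + 2)))"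
    by (subst (asm) sums_Suc_iff) (simp add: g_def)
  have eq: "t ^ n / (fact n * poch \<nu> n) = t ^ n / (fact n * pochhammer (\<nu> + 1 + 1) n) + g n" for n
  proof (cases n)
    case (Suc m)
    have p3: "pochhammer (\<nu> + 3) m > 0" using assms by (intro pochhammer_pos) simp
    have 1: "poch \<nu> (Suc m) * (\<nu> + 2 + m) = (\<nu> + 1) * (\<nu> + 2) * pochhammer (\<nu> + 3) m"
      using pochhammer_rec[of "\<nu> + 1" m] pochhammer_rec[of "\<nu> + 2" m] pochhammer_Suc[of "\<nu> + 2" m]
      by (simp add: add.assoc mult.assoc)
    have 2: "pochhammer (\<nu> + 2) (Suc m) = (\<nu> + 2) * pochhammer (\<nu> + 3) m"
      using pochhammer_rec[of "\<nu> + 2" m] by (simp add: add.assoc)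
    have 3: "poch \<nu> (Suc m) = (\<nu> + 1) * (\<nu> + 2) * pochhammer (\<nu> + 3) m / (\<nu> + 2 + m)"
      using 1 assms by (simp add: field_simps)
    define P where "P = pochhammer (\<nu> + 3) m"
    have nz: "\<nu> + 1 \<noteq> 0" "\<nu> + 2 \<noteq> 0" "\<nu> + 2 + real m \<noteq> 0" "P \<noteq> 0" "1 + real m \<noteq> 0"
      using assms p3 by (auto simp: P_def)
    show ?thesis
      unfolding Suc g_def h_def nat.case 3 P_def[symmetric] fact_Suc power_Suc
      using 2[folded P_def] nz
      by (simp add: add.assoc divide_simps) (simp add: algebra_simps)
  qed (simp add: g_def)
  have "(\<lambda>n. t ^ n / (fact n * poch \<nu> n)) sums
      (hyp01 (\<nu> + 1) t + t * hyp01 (\<nu> + 2) t / ((\<nu> + 1) * (\<nu> + 2)))"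
    unfolding eq using sums_add[OF hyp01_sums[of "\<nu> + 1" t] g] assms by simp
  from sums_unique2[OF hyp01_sums this] assms show ?thesis by simp
qed

text \<open>With \<open>A = hyp01 k (\<sigma> u^2/4)\<close> and \<open>B = u hyp01 (k+1) (\<sigma> u^2/4) / (2(k+1))\<close> one has \<open>A' = \<sigma> B\<close> and
  \<open>B' = A - (2k+1) B / u\<close>, so \<open>\<sigma> (A^2 - \<sigma> B^2)\<close> increases away from \<open>0\<close>. The case \<open>\<sigma> = -1\<close> bounds the
  Dunkl kernel, the case \<open>\<sigma> = 1\<close> gives positivity of the heat kernel.\<close>

lemma hyp01_energy:
  fixes k \<sigma> u :: real
  assumes k: "k \<ge> -1/2" and \<sigma>: "\<sigma> = 1 \<or> \<sigma> = -1"
  shows "\<sigma> * ((hyp01 k (\<sigma> * u\<^sup>2 / 4))\<^sup>2 - \<sigma> * (u / (2 * (k + 1)) * hyp01 (k + 1) (\<sigma> * u\<^sup>2 / 4))\<^sup>2) \<ge> \<sigma>"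
proof -
  define A where "A u = hyp01 k (\<sigma> * u\<^sup>2 / 4)" for u
  define G where "G u = hyp01 (k + 1) (\<sigma> * u\<^sup>2 / 4)" for u
  define B where "B u = u / (2 * (k + 1)) * G u" for u
  define D where "D u = \<sigma> * ((A u)\<^sup>2 - \<sigma> * (B u)\<^sup>2)" for u
  have k1: "k > -1" "k + 1 > 0" "k + 1 \<noteq> 0" "k + 2 \<noteq> 0" using k by auto
  have \<sigma>2: "\<sigma> * \<sigma> = 1" using \<sigma> by auto
  have dt: "((\<lambda>u. \<sigma> * u\<^sup>2 / 4) has_real_derivative \<sigma> * u / 2) (at u)" for u
    by (auto intro!: derivative_eq_intros)
  have dA: "(A has_real_derivative \<sigma> * B u) (at u)" for u
    using DERIV_chain2[OF hyp01_deriv[OF k1(1)] dt[of u]] k1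
    by (simp add: A_def[abs_def] B_def G_def field_simps)
  have dG: "(G has_real_derivative hyp01 (k + 2) (\<sigma> * u\<^sup>2 / 4) / (k + 2) * (\<sigma> * u / 2)) (at u)" for u
    using DERIV_chain2[OF hyp01_deriv[of "k + 1"] dt[of u]] k1
    by (simp add: G_def[abs_def] add.assoc)
  \<comment> \<open>The term \<open>(2 * k + 1) * B u / u\<close> is written as a multiple of
    \<open>G u\<close>, so that the formula also holds at \<open>u = 0\<close>. The recurrence
    \<open>hyp01_rec\<close> identifies the part coming from the derivative of \<open>G\<close> as
    \<open>A u - G u\<close>.\<close>
  have dB: "(B has_real_derivative A u - (2 * k + 1) / (2 * (k + 1)) * G u) (at u)" for u
  proof -
    have "(B has_real_derivative 1 / (2 * (k + 1)) * G u + 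
        (hyp01 (k + 2) (\<sigma> * u\<^sup>2 / 4) / (k + 2) * (\<sigma> * u / 2)) * (u / (2 * (k + 1)))) (at u)"
      unfolding B_def[abs_def] by (rule DERIV_mult[OF _ dG]) (use k1 in \<open>auto intro!: derivative_eq_intros\<close>)
    also have "(hyp01 (k + 2) (\<sigma> * u\<^sup>2 / 4) / (k + 2) * (\<sigma> * u / 2)) * (u / (2 * (k + 1))) = 
       (\<sigma> * u\<^sup>2 / 4) * hyp01 (k + 2) (\<sigma> * u\<^sup>2 / 4) / ((k + 1) * (k + 2))"
      unfolding power2_eq_square using k1 by (simp add: divide_simps) (simp add: algebra_simps)
    also have "\<dots> = A u - G u"
      using hyp01_rec[OF k1(1), of "\<sigma> * u\<^sup>2 / 4"] by (simp add: A_def G_def)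
    also have "1 / (2 * (k + 1)) * G u + (A u - G u) = A u - (2 * k + 1) / (2 * (k + 1)) * G u"
      using k1 by (simp add: field_simps)
    finally show ?thesis .
  qed
  \<comment> \<open>The products of \<open>A\<close> and \<open>B\<close> cancel. What remains has
    the sign of \<open>(2 * k + 1) * u\<close>, so \<open>D\<close> increases on the positive
    half-line; it is even, which covers negative arguments.\<close>
  have dD: "(D has_real_derivative (2 * k + 1) / (k + 1) * (u / (2 * (k + 1))) * (G u)\<^sup>2) (at u)" for u
  proof -
    have "(D has_real_derivative \<sigma> * (2 * A u * (\<sigma> * B u) - \<sigma> * (2 * B u * (A u - (2 * k + 1) / (2 * (k + 1)) * G u)))) (at u)"
      unfolding D_def[abs_def] by (auto intro!: derivative_eq_intros dA dB simp: algebra_simps)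
    also have "\<sigma> * (2 * A u * (\<sigma> * B u) - \<sigma> * (2 * B u * (A u - (2 * k + 1) / (2 * (k + 1)) * G u)))
       = (\<sigma> * \<sigma>) * (2 * B u * ((2 * k + 1) / (2 * (k + 1)) * G u))" by (simp add: algebra_simps)
    also have "\<dots> = (2 * k + 1) / (k + 1) * (u / (2 * (k + 1))) * (G u)\<^sup>2"
      unfolding \<sigma>2 B_def power2_eq_square using k1 by (simp add: divide_simps)
    finally show ?thesis .
  qed
  have "D 0 \<le> D \<bar>u\<bar>"
    by (rule DERIV_nonneg_imp_nondecreasing[of 0 "\<bar>u\<bar>"])
       (use dD k k1 in \<open>auto intro!: exI mult_nonneg_nonneg divide_nonneg_nonneg\<close>)
  moreover have "D 0 = \<sigma>" using k1 by (simp add: D_def A_def B_def hyp01_0)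
  moreover have "D \<bar>u\<bar> = D u"
    by (cases "u \<ge> 0") (auto simp: D_def A_def B_def G_def power_mult_distrib)
  ultimately have "\<sigma> \<le> D u" by simp
  then show ?thesis unfolding D_def A_def B_def G_def .
qed

text \<open>A quotient of two Gamma values at distance \<open>n\<close> is a Pochhammer symbol; the
  leading factor \<open>Gamma (\<nu> + 1)\<close> normalises the series.\<close>

lemma bessel_j_eq_hyp01:
  assumes "\<nu> > -1"
  shows "bessel_j \<nu> u = hyp01 \<nu> (- u\<^sup>2 / 4)"
proof -
  have nz: "\<nu> + 1 \<notin> \<int>\<^sub>\<le>\<^sub>0" using assms by (auto elim!: nonpos_Ints_cases)
  then have G: "Gamma (\<nu> + 1) \<noteq> 0" by (simp add: Gamma_eq_zero_iff)
  have "(-1) ^ n * (u / 2) ^ (2 * n) / (fact n * Gamma (real n + \<nu> + 1)) =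
    ((- u\<^sup>2 / 4) ^ n / (fact n * poch \<nu> n)) / Gamma (\<nu> + 1)" for n
  proof -
    have "(- u\<^sup>2 / 4) = (-1) * (u / 2)\<^sup>2" by (simp add: power2_eq_square)
    then have 1: "(- u\<^sup>2 / 4) ^ n = (-1) ^ n * (u / 2) ^ (2 * n)"
      by (simp only: power_mult_distrib power_mult)
    have "Gamma (real n + \<nu> + 1) = poch \<nu> n * Gamma (\<nu> + 1)"
      using pochhammer_Gamma[OF nz, of n] G by (simp add: add_ac)
    then show ?thesis unfolding 1 by simp
  qed
  then have "bessel_j \<nu> u = Gamma (\<nu> + 1) * (\<Sum>n. ((- u\<^sup>2 / 4) ^ n / (fact n * poch \<nu> n)) / Gamma (\<nu> + 1))"
    by (simp add: bessel_j_def)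
  also have "(\<Sum>n. ((- u\<^sup>2 / 4) ^ n / (fact n * poch \<nu> n)) / Gamma (\<nu> + 1)) = hyp01 \<nu> (- u\<^sup>2 / 4) / Gamma (\<nu> + 1)"
    using sums_divide[OF hyp01_sums[OF assms]] by (intro sums_unique[symmetric])
  finally show ?thesis using G by simp
qed

section \<open>Products of two 0F1 series\<close>

lemma pochhammer_Vandermonde_sum:
  fixes \<nu> :: real
  assumes "\<nu> > -1"
  shows "poch \<nu> (m + n) / (fact m * fact n * poch \<nu> m * poch \<nu> n) =
    (\<Sum>l\<le>min m n. 1 / (fact (m - l) * fact (n - l) * fact l * poch \<nu> l))"
proof -
  note pos = pochhammer_lower_bound(2)[OF assms]
  have pnz: "poch \<nu> n \<noteq> 0" for n using pos[of n] by simp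
  have A: "(real m gchoose l) * ((\<nu> + n) gchoose (n - l)) =
      (if l \<le> m then fact m / (fact l * fact (m - l)) * (poch \<nu> n / (poch \<nu> l * fact (n - l))) else 0)"
    if l: "l \<le> n" for l
  proof (cases "l \<le> m")
    case True
    have "poch \<nu> n = poch \<nu> l * pochhammer (\<nu> + 1 + l) (n - l)"
      using pochhammer_product[OF l, of "\<nu> + 1"] by simp
    moreover have "((\<nu> + n) gchoose (n - l)) = pochhammer (\<nu> + 1 + l) (n - l) / fact (n - l)"
      using l by (simp add: gbinomial_pochhammer' of_nat_diff algebra_simps)
    ultimately show ?thesis
      using True pnz[of l] by (simp add: binomial_gbinomial[symmetric] binomial_fact)
  next
    case False
    then show ?thesis by (simp add: binomial_gbinomial[symmetric])
  qed
  \<comment> \<open>Chu-Vandermonde convolution with one integer upper argument: the terms with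
    \<open>l > m\<close> vanish, which is why the sum finally stops at
    \<open>min m n\<close>.\<close>
  have "((real m + (\<nu> + n)) gchoose n) = (\<Sum>l\<in>{0..n}. (real m gchoose l) * ((\<nu> + n) gchoose (n - l)))"
    by (rule gbinomial_Vandermonde[symmetric])
  also have "\<dots> = (\<Sum>l\<in>{0..n}. if l \<le> m then fact m / (fact l * fact (m - l)) * (poch \<nu> n / (poch \<nu> l * fact (n - l))) else 0)"
    using A by (intro sum.cong) auto
  also have "\<dots> = (\<Sum>l\<le>min m n. fact m / (fact l * fact (m - l)) * (poch \<nu> n / (poch \<nu> l * fact (n - l))))"
    by (subst sum.inter_filter[symmetric]) (auto intro!: sum.cong)
  finally have B: "((real m + (\<nu> + n)) gchoose n) = fact m * poch \<nu> n *
     (\<Sum>l\<le>min m n. 1 / (fact (m - l) * fact (n - l) * fact l * poch \<nu> l))"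
    by (simp add: sum_distrib_left mult_ac)
  have "((real m + (\<nu> + n)) gchoose n) = pochhammer (\<nu> + 1 + m) n / fact n"
    by (simp add: gbinomial_pochhammer' algebra_simps)
  also have "\<dots> = poch \<nu> (m + n) / (poch \<nu> m * fact n)"
    using pochhammer_product'[of "\<nu> + 1" m n] pnz[of m] by simp
  finally have "poch \<nu> (m + n) / (poch \<nu> m * fact n) = fact m * poch \<nu> n *
     (\<Sum>l\<le>min m n. 1 / (fact (m - l) * fact (n - l) * fact l * poch \<nu> l))" using B by simp
  then show ?thesis using pnz[of n] pnz[of m] by (simp add: field_simps)
qed

text \<open>The part of \<open>hyp01 \<nu> X * hyp01 \<nu> Y\<close> that is homogeneous of degree \<open>N\<close>.\<close>

definition weber_coeff :: "real \<Rightarrow> nat \<Rightarrow> real \<Rightarrow> real \<Rightarrow> real" where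
  "weber_coeff \<nu> N X Y = (\<Sum>i\<le>N. X ^ i * Y ^ (N - i) /
     (fact i * fact (N - i) * poch \<nu> i * poch \<nu> (N - i)))"

lemma hyp01_mult_sums:
  assumes "\<nu> > -1"
  shows "(\<lambda>N. weber_coeff \<nu> N X Y) sums (hyp01 \<nu> X * hyp01 \<nu> Y)"
  using Cauchy_product_sums[OF summable_hyp01[OF assms, of X] summable_hyp01[OF assms, of Y]]
  by (simp add: weber_coeff_def hyp01_def mult_ac)

text \<open>The factor \<open>poch \<nu> N\<close> is what a Gaussian moment of degree
  \<open>2 * N\<close> contributes. \<open>pochhammer_Vandermonde_sum\<close> spreads it over a sum
  in \<open>l\<close>; after the substitution \<open>i = a + l\<close> the sum over \<open>a\<close>
  is a binomial expansion of \<open>(X + Y) ^ (N - 2 * l)\<close>, and only \<open>X * Y\<close> and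
  \<open>X + Y\<close> are left.\<close>

lemma weber_coeff_eq:
  assumes "\<nu> > -1"
  shows "poch \<nu> N * weber_coeff \<nu> N X Y =
    (\<Sum>l\<le>N div 2. (X * Y) ^ l / (fact l * poch \<nu> l) * ((X + Y) ^ (N - 2 * l) / fact (N - 2 * l)))"
proof -
  have bin: "(X + Y) ^ n / fact n = (\<Sum>a\<le>n. X ^ a * Y ^ (n - a) / (fact a * fact (n - a)))" for n
    unfolding binomial_ring sum_divide_distrib
    by (intro sum.cong) (auto simp: binomial_fact)
  have "(\<Sum>l\<le>N div 2. (X * Y) ^ l / (fact l * poch \<nu> l) * ((X + Y) ^ (N - 2 * l) / fact (N - 2 * l)))
    = (\<Sum>l\<le>N div 2. \<Sum>a\<le>N - 2 * l. (X * Y) ^ l * (X ^ a * Y ^ (N - 2 * l - a)) /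
        (fact a * fact (N - 2 * l - a) * fact l * poch \<nu> l))"
    unfolding bin sum_distrib_left by (simp add: mult_ac)
  also have "\<dots> = (\<Sum>(l, a)\<in>Sigma {..N div 2} (\<lambda>l. {..N - 2 * l}). (X * Y) ^ l * (X ^ a * Y ^ (N - 2 * l - a)) /
        (fact a * fact (N - 2 * l - a) * fact l * poch \<nu> l))"
    by (subst sum.Sigma) auto
  also have "\<dots> = (\<Sum>(i, l)\<in>Sigma {..N} (\<lambda>i. {..min i (N - i)}). X ^ i * Y ^ (N - i) *
        (1 / (fact (i - l) * fact (N - i - l) * fact l * poch \<nu> l)))"
  proof (rule sum.reindex_bij_witness[where i = "\<lambda>(i, l). (l, i - l)" and j = "\<lambda>(l, a). (a + l, l)"], goal_cases)
    case (5 z)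
    then obtain l a where z: "z = (l, a)" and la: "2 * l + a \<le> N" by (cases z) auto
    then have e: "N - 2 * l - a = N - (a + l) - l" "N - (a + l) = N - (a + l) - l + l" by auto
    have "Y ^ (N - (a + l)) = Y ^ l * Y ^ (N - (a + l) - l)"
      by (subst e(2)) (simp add: power_add mult.commute)
    then have "X ^ (a + l) * Y ^ (N - (a + l)) = (X * Y) ^ l * (X ^ a * Y ^ (N - (a + l) - l))"
      by (simp only: power_mult_distrib power_add mult_ac)
    then show ?case unfolding z prod.case e(1) by (simp only: add_diff_cancel_right') simp
  qed auto
  also have "\<dots> = (\<Sum>i\<le>N. X ^ i * Y ^ (N - i) *
      (\<Sum>l\<le>min i (N - i). 1 / (fact (i - l) * fact (N - i - l) * fact l * poch \<nu> l)))"
    unfolding sum_distrib_left by (subst sum.Sigma) auto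
  also have "\<dots> = (\<Sum>i\<le>N. poch \<nu> N * (X ^ i * Y ^ (N - i) /
      (fact i * fact (N - i) * poch \<nu> i * poch \<nu> (N - i))))"
  proof (rule sum.cong)
    fix i assume "i \<in> {..N}"
    then have "i + (N - i) = N" by simp
    then show "X ^ i * Y ^ (N - i) * (\<Sum>l\<le>min i (N - i). 1 / (fact (i - l) * fact (N - i - l) * fact l * poch \<nu> l)) =
      poch \<nu> N * (X ^ i * Y ^ (N - i) / (fact i * fact (N - i) * poch \<nu> i * poch \<nu> (N - i)))"
      unfolding pochhammer_Vandermonde_sum[OF assms, symmetric] by simp
  qed simp
  finally show ?thesis by (simp add: weber_coeff_def sum_distrib_left)
qed

text \<open>By \<open>weber_coeff_eq\<close> the terms are those of the Cauchy product of the two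
  series on the right. Since \<open>X * Y\<close> has degree 2, its coefficients are first spread
  over the even indices, in \<open>b\<close>, so that the index of a product term is its
  degree.\<close>

lemma weber_coeff_sums:
  assumes "\<nu> > -1"
  shows "(\<lambda>N. poch \<nu> N * weber_coeff \<nu> N X Y) sums (exp (X + Y) * hyp01 \<nu> (X * Y))"
proof -
  define c where "c l = (X * Y) ^ l / (fact l * poch \<nu> l)" for l
  define b where "b j = (if even j then c (j div 2) else 0)" for j
  define a where "a i = (X + Y) ^ i / fact i" for i
  have sm: "strict_mono (\<lambda>n::nat. 2 * n)" by (rule strict_monoI) simp
  have range: "j \<in> range (\<lambda>n. 2 * n) \<longleftrightarrow> even j" for j :: nat by (auto elim!: evenE)
  have b: "b sums hyp01 \<nu> (X * Y)"
    using hyp01_sums[OF assms, of "X * Y"] sums_mono_reindex[OF sm, of b] by (simp add: b_def c_def range)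
  have "summable (\<lambda>l. norm (c l))" unfolding c_def by (rule summable_hyp01[OF assms])
  then have nb: "summable (\<lambda>j. norm (b j))"
    using summable_mono_reindex[OF sm, of "\<lambda>j. norm (b j)"] by (simp add: b_def range)
  have a: "a sums exp (X + Y)"
    using exp_converges[of "X + Y"] by (simp add: a_def[abs_def] scaleR_conv_of_real field_simps)
  have na: "summable (\<lambda>j. norm (a j))"
    using summable_norm_exp[of "X + Y"] by (simp add: a_def[abs_def] scaleR_conv_of_real field_simps)
  have "(\<lambda>N. \<Sum>j\<le>N. b j * a (N - j)) sums (hyp01 \<nu> (X * Y) * exp (X + Y))"
    using Cauchy_product_sums[OF nb na] a b by (simp add: sums_iff)
  moreover have "(\<Sum>j\<le>N. b j * a (N - j)) = poch \<nu> N * weber_coeff \<nu> N X Y" for N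
  proof -
    have "(\<Sum>j\<le>N. b j * a (N - j)) = (\<Sum>j | j \<le> N \<and> even j. c (j div 2) * a (N - j))"
      by (rule sum.mono_neutral_cong_right) (auto simp: b_def)
    also have "\<dots> = (\<Sum>l\<le>N div 2. c l * a (N - 2 * l))"
      by (rule sum.reindex_bij_witness[where i = "\<lambda>l. 2 * l" and j = "\<lambda>j. j div 2"]) auto
    finally show ?thesis unfolding weber_coeff_eq[OF assms] by (simp add: c_def a_def)
  qed
  ultimately show ?thesis by (simp add: mult.commute)
qed

lemma weber_coeff_scale: "weber_coeff \<nu> N (r * X) (r * Y) = r ^ N * weber_coeff \<nu> N X Y"
  unfolding weber_coeff_def sum_distrib_left
proof (rule sum.cong)
  fix i assume "i \<in> {..N}"
  then have "r ^ N = r ^ i * r ^ (N - i)" by (simp add: power_add[symmetric])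
  then show "(r * X) ^ i * (r * Y) ^ (N - i) / (fact i * fact (N - i) * poch \<nu> i * poch \<nu> (N - i)) =
    r ^ N * (X ^ i * Y ^ (N - i) / (fact i * fact (N - i) * poch \<nu> i * poch \<nu> (N - i)))"
    by (simp add: power_mult_distrib)
qed simp

lemma weber_coeff_nonneg: "\<nu> > -1 \<Longrightarrow> X \<ge> 0 \<Longrightarrow> Y \<ge> 0 \<Longrightarrow> weber_coeff \<nu> N X Y \<ge> 0"
  unfolding weber_coeff_def
  by (intro sum_nonneg divide_nonneg_nonneg mult_nonneg_nonneg less_imp_le[OF pochhammer_lower_bound(2)]) auto

section \<open>Gaussian integrals\<close>

text \<open>The substitution \<open>t = s * x\<^sup>2\<close> in the Gamma integral, made on the
  compact intervals \<open>{0..real n}\<close> and carried to the half-line by monotone convergence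
  on both sides.\<close>

lemma gaussian_moment_half_line:
  fixes s a :: real
  assumes s: "s > 0" and a: "a > 0"
  shows "(\<integral>\<^sup>+x. ennreal (indicator {0..} x * (x powr (2 * a - 1) * exp (- s * x\<^sup>2))) \<partial>lborel) =
    ennreal (Gamma a / (2 * s powr a))"
proof -
  define f where "f t = t powr (a - 1) / exp t" for t :: real
  define h where "h x = x powr (2 * a - 1) * exp (- s * x\<^sup>2)" for x
  let ?F = "\<lambda>n x. ennreal (f x * indicator {0..s * (real n)\<^sup>2} x)"
  let ?H = "\<lambda>n x. ennreal (2 * s powr a) * ennreal (h x * indicator {0..real n} x)"
  let ?G = "\<lambda>x. ennreal (2 * s powr a) * ennreal (h x * indicator {0..} x)"
  have eq: "(\<integral>\<^sup>+x. ?F n x \<partial>lborel) =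
      (\<integral>\<^sup>+x. ?H n x \<partial>lborel)" for n
  proof -
    have "(\<integral>\<^sup>+x. ennreal (f x * indicator {s * 0\<^sup>2..s * (real n)\<^sup>2} x) \<partial>lborel) =
      (\<integral>\<^sup>+x. ennreal (f (s * x\<^sup>2) * (2 * s * x) * indicator {0..real n} x) \<partial>lborel)"
    proof (rule nn_integral_substitution)
      show "set_borel_measurable borel {s * 0\<^sup>2..s * (real n)\<^sup>2} f"
        unfolding f_def set_borel_measurable_def by measurable
      show "((\<lambda>x. s * x\<^sup>2) has_real_derivative 2 * s * x) (at x)" for x
        by (auto intro!: derivative_eq_intros)
    qed (use s in \<open>auto intro!: continuous_intros\<close>)
    also have "\<dots> = (\<integral>\<^sup>+x. ?H n x \<partial>lborel)"
    proof (rule nn_integral_cong)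
      fix x :: real
      have "f (s * x\<^sup>2) * (2 * s * x) = 2 * s powr a * h x" if x: "x > 0"
      proof -
        have "(s * x\<^sup>2) powr (a - 1) = s powr (a - 1) * x powr (2 * (a - 1))"
          using s x by (simp add: powr_mult powr_powr flip: powr_numeral)
        moreover have "s powr (a - 1) * s = s powr a" "x powr (2 * (a - 1)) * x = x powr (2 * a - 1)"
          using s x powr_add[of s "a - 1" 1] powr_add[of x "2 * (a - 1)" 1] by (simp_all add: algebra_simps)
        moreover have "f (s * x\<^sup>2) * (2 * s * x) = 2 * exp (- s * x\<^sup>2) *
            (s powr (a - 1) * s) * (x powr (2 * (a - 1)) * x)"
          unfolding f_def calculation(1) by (simp add: exp_minus divide_inverse mult_ac)
        ultimately show ?thesis by (simp add: h_def mult_ac)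
      qed
      \<comment> \<open>By the convention \<open>0 powr r = 0\<close> the two integrands agree at
        the origin as well.\<close>
      moreover have "h 0 = 0" by (simp add: h_def)
      ultimately have "f (s * x\<^sup>2) * (2 * s * x) * indicator {0..real n} x =
          2 * s powr a * (h x * indicator {0..real n} x)"
        by (cases "x > 0"; cases "x = 0") (auto simp: indicator_def)
      then show "ennreal (f (s * x\<^sup>2) * (2 * s * x) * indicator {0..real n} x) =
          ?H n x"
        by (simp only: ennreal_mult'[of "2 * s powr a"] powr_ge_zero mult_nonneg_nonneg zero_le_numeral)
    qed
    finally show ?thesis by simp
  qed
  have "(\<lambda>n. \<integral>\<^sup>+x. ?F n x \<partial>lborel) \<longlonglongrightarrow>
      (\<integral>\<^sup>+x. ennreal (f x * indicator {0..} x) \<partial>lborel)"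
  proof (rule nn_integral_LIMSEQ)
    show "incseq (\<lambda>n x. ?F n x)"
    proof (intro monoI le_funI ennreal_leI mult_left_mono)
      fix m n :: nat and x :: real assume "m \<le> n"
      then have "s * (real m)\<^sup>2 \<le> s * (real n)\<^sup>2" using s by (intro mult_left_mono power_mono) auto
      then show "indicator {0..s * (real m)\<^sup>2} x \<le> (indicator {0..s * (real n)\<^sup>2} x :: real)"
        by (auto simp: indicator_def)
    qed (simp add: f_def)
    show "(\<lambda>x. ?F n x) \<in> borel_measurable lborel" for n
      unfolding f_def by measurable
    show "(\<lambda>n. ?F n x) \<longlonglongrightarrow> ennreal (f x * indicator {0..} x)" for x
    proof (rule tendsto_eventually)
      obtain m where m: "x / s \<le> real m" using real_arch_simple by blast
      show "\<forall>\<^sub>F n in sequentially. ?F n x = ennreal (f x * indicator {0..} x)"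
        using eventually_ge_at_top[of "max m 1"]
      proof eventually_elim
        case (elim n)
        have "x / s \<le> real n" using m elim by simp
        then have "x \<le> s * real n" using s by (simp add: field_simps)
        also have "\<dots> \<le> s * (real n)\<^sup>2" using s elim by (intro mult_left_mono) (auto simp: power2_eq_square)
        finally show ?case by (simp add: indicator_def)
      qed
    qed
  qed
  moreover have "(\<lambda>n. \<integral>\<^sup>+x. ?H n x \<partial>lborel) \<longlonglongrightarrow>
      (\<integral>\<^sup>+x. ?G x \<partial>lborel)"
  proof (rule nn_integral_LIMSEQ)
    show "incseq (\<lambda>n x. ?H n x)"
      by (intro monoI le_funI ennreal_leI mult_left_mono) (auto simp: h_def indicator_def)
    show "(\<lambda>x. ?H n x) \<in> borel_measurable lborel" for n
      unfolding h_def by measurable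
    show "(\<lambda>n. ?H n x) \<longlonglongrightarrow>
      ?G x" for x
    proof (rule tendsto_eventually)
      obtain m where m: "x \<le> real m" using real_arch_simple by blast
      show "\<forall>\<^sub>F n in sequentially. ?H n x =
         ?G x"
        using eventually_ge_at_top[of m] by eventually_elim (use m in \<open>auto simp: indicator_def\<close>)
    qed
  qed
  ultimately have "(\<integral>\<^sup>+x. ennreal (f x * indicator {0..} x) \<partial>lborel) =
     (\<integral>\<^sup>+x. ?G x \<partial>lborel)"
    unfolding eq by (rule LIMSEQ_unique)
  also have "(\<integral>\<^sup>+x. ennreal (f x * indicator {0..} x) \<partial>lborel) = ennreal (Gamma a)"
    unfolding Gamma_conv_nn_integral_real[OF a] f_def by (intro nn_integral_cong) (simp add: indicator_def)
  also have "(\<integral>\<^sup>+x. ?G x \<partial>lborel) =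
    ennreal (2 * s powr a) * (\<integral>\<^sup>+x. ennreal (h x * indicator {0..} x) \<partial>lborel)"
    by (rule nn_integral_cmult) (simp add: h_def)
  finally have e: "ennreal (Gamma a) = ennreal (2 * s powr a) * (\<integral>\<^sup>+x. ennreal (h x * indicator {0..} x) \<partial>lborel)" .
  define I where "I = (\<integral>\<^sup>+x. ennreal (h x * indicator {0..} x) \<partial>lborel)"
  define c where "c = 2 * s powr a"
  have c: "c > 0" using s by (simp add: c_def)
  have e': "ennreal (Gamma a) = ennreal c * I" using e by (simp only: I_def c_def)
  have "ennreal (Gamma a / c) = ennreal (inverse c) * ennreal (Gamma a)"
    using c by (subst ennreal_mult'[symmetric]) (simp_all add: divide_inverse mult.commute)
  also have "\<dots> = (ennreal (inverse c) * ennreal c) * I" by (simp only: e' mult.assoc)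
  also have "ennreal (inverse c) * ennreal c = 1"
    using c by (subst ennreal_mult'[symmetric]) simp_all
  finally have "I = ennreal (Gamma a / c)" by simp
  moreover have "I = (\<integral>\<^sup>+x. ennreal (indicator {0..} x * (x powr (2 * a - 1) * exp (- s * x\<^sup>2))) \<partial>lborel)"
    unfolding I_def h_def by (simp only: mult.commute)
  ultimately show ?thesis unfolding c_def by (simp only:)
qed

section \<open>Integration against the Dunkl measure and Weber's exponential integrals\<close>

lemma space_dunkl [simp]: "space (dunkl_measure \<nu>) = UNIV"
  and sets_dunkl [simp, measurable_cong]: "sets (dunkl_measure \<nu>) = sets lebesgue"
  by (simp_all add: dunkl_measure_def)

lemma borel_measurable_dunklI: "f \<in> borel_measurable borel \<Longrightarrow> f \<in> measurable (dunkl_measure \<nu>) N"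
  if "sets N = sets borel" for f :: "real \<Rightarrow> 'b::topological_space"
  using that by (simp add: dunkl_measure_def measurable_completion cong: measurable_cong_sets)

lemma nn_integral_dunkl:
  fixes f :: "real \<Rightarrow> ennreal"
  assumes "f \<in> borel_measurable borel"
  shows "(\<integral>\<^sup>+x. f x \<partial>dunkl_measure \<nu>) =
    (\<integral>\<^sup>+x. ennreal (\<bar>x\<bar> powr (2 * \<nu> + 1) / (2 powr (\<nu> + 1) * Gamma (\<nu> + 1))) * f x \<partial>lborel)"
  unfolding dunkl_measure_def using assms
  by (subst nn_integral_density) (auto simp: nn_integral_completion intro!: measurable_completion)

lemma nn_integral_even:
  fixes f :: "real \<Rightarrow> ennreal"
  assumes [measurable]: "f \<in> borel_measurable borel" and even: "\<And>x. f (- x) = f x"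
  shows "(\<integral>\<^sup>+x. f x \<partial>lborel) = 2 * (\<integral>\<^sup>+x. f x * indicator {0..} x \<partial>lborel)"
proof -
  have "(\<integral>\<^sup>+x. f x \<partial>lborel) = (\<integral>\<^sup>+x. f x * indicator {0..} x + f x * indicator {..<0} x \<partial>lborel)"
    by (intro nn_integral_cong) (auto simp: indicator_def)
  also have "\<dots> = (\<integral>\<^sup>+x. f x * indicator {0..} x \<partial>lborel) + (\<integral>\<^sup>+x. f x * indicator {..<0} x \<partial>lborel)"
    by (rule nn_integral_add) measurable
  also have "(\<integral>\<^sup>+x. f x * indicator {..<0} x \<partial>lborel) = (\<integral>\<^sup>+x. f (- x) * indicator {..<0} (- x) \<partial>lborel)"
    by (subst nn_integral_real_affine[where c = "-1" and t = 0]) (auto simp: ennreal_mult)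
  also have "\<dots> = (\<integral>\<^sup>+x. f x * indicator {0..} x \<partial>lborel)"
  proof (rule nn_integral_cong_AE)
    show "AE x in lborel. f (- x) * indicator {..<0} (- x) = f x * indicator {0..} x"
      using AE_lborel_singleton[of 0] by eventually_elim (auto simp: even indicator_def)
  qed
  finally show ?thesis by (simp add: mult_2)
qed

text \<open>Folding the line onto the half-line leads to \<open>a = N + \<nu> + 1\<close> in the
  Gamma integral. The normalisation of the measure cancels \<open>Gamma (\<nu> + 1)\<close> and
  leaves a Pochhammer symbol, the very factor that stands in the denominators of
  \<open>hyp01\<close>.\<close>

lemma dunkl_gaussian_moment:
  assumes \<nu>: "\<nu> > -1" and s: "s > 0"
  shows "(\<integral>\<^sup>+x. ennreal (exp (- s * x\<^sup>2) * x ^ (2 * N)) \<partial>dunkl_measure \<nu>) =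
    ennreal ((2 * s) powr (- (\<nu> + 1)) * poch \<nu> N / s ^ N)"
proof -
  define D where "D = 2 powr (\<nu> + 1) * Gamma (\<nu> + 1)"
  have G: "Gamma (\<nu> + 1) > 0" using \<nu> by (intro Gamma_real_pos) simp
  then have D: "D > 0" by (simp add: D_def)
  define a where "a = real N + \<nu> + 1"
  have a: "a > 0" using \<nu> by (simp add: a_def)
  define g where "g x = ennreal (\<bar>x\<bar> powr (2 * \<nu> + 1) / D) * ennreal (exp (- s * x\<^sup>2) * x ^ (2 * N))" for x
  have gm: "g \<in> borel_measurable borel" unfolding g_def by measurable
  have "(\<integral>\<^sup>+x. ennreal (exp (- s * x\<^sup>2) * x ^ (2 * N)) \<partial>dunkl_measure \<nu>) = (\<integral>\<^sup>+x. g x \<partial>lborel)"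
    by (subst nn_integral_dunkl) (auto simp: g_def[abs_def] D_def)
  also have "\<dots> = 2 * (\<integral>\<^sup>+x. g x * indicator {0..} x \<partial>lborel)"
    by (rule nn_integral_even[OF gm]) (simp add: g_def)
  also have "(\<integral>\<^sup>+x. g x * indicator {0..} x \<partial>lborel) =
     (\<integral>\<^sup>+x. ennreal (1 / D) * ennreal (indicator {0..} x * (x powr (2 * a - 1) * exp (- s * x\<^sup>2))) \<partial>lborel)"
  proof (rule nn_integral_cong)
    fix x :: real
    have "x powr (2 * \<nu> + 1) * x ^ (2 * N) = x powr (2 * a - 1)" if "x > 0"
      using that by (simp add: a_def powr_realpow[symmetric] powr_add[symmetric] algebra_simps)
    then have "\<bar>x\<bar> powr (2 * \<nu> + 1) * (exp (- s * x\<^sup>2) * x ^ (2 * N)) = x powr (2 * a - 1) * exp (- s * x\<^sup>2)" if "x \<ge> 0"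
      using that by (cases "x = 0") (auto simp: mult_ac)
    then show "g x * indicator {0..} x = ennreal (1 / D) * ennreal (indicator {0..} x * (x powr (2 * a - 1) * exp (- s * x\<^sup>2)))"
      using D by (cases "x \<ge> 0") (auto simp: g_def indicator_def ennreal_mult'[symmetric] ennreal_mult''[symmetric])
  qed
  also have "\<dots> = ennreal (1 / D) * ennreal (Gamma a / (2 * s powr a))"
    by (subst nn_integral_cmult) (auto simp: gaussian_moment_half_line[OF s a, simplified])
  also have "2 * (ennreal (1 / D) * ennreal (Gamma a / (2 * s powr a))) = ennreal (2 * (1 / D * (Gamma a / (2 * s powr a))))"
    unfolding ennreal_numeral[symmetric]
    by (subst ennreal_mult', simp, subst ennreal_mult', simp add: less_imp_le[OF D], rule refl)
  also have "2 * (1 / D * (Gamma a / (2 * s powr a))) = (2 * s) powr (- (\<nu> + 1)) * poch \<nu> N / s ^ N"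
  proof -
    have nz: "\<nu> + 1 \<notin> \<int>\<^sub>\<le>\<^sub>0" using \<nu> by (auto elim!: nonpos_Ints_cases)
    have 1: "Gamma a = poch \<nu> N * Gamma (\<nu> + 1)"
      using pochhammer_Gamma[OF nz, of N] G by (simp add: a_def add_ac)
    have 2: "s powr a = s ^ N * s powr (\<nu> + 1)"
      using s by (simp add: a_def powr_add powr_realpow mult_ac)
    have 3: "(2 * s) powr (- (\<nu> + 1)) = 1 / (2 powr (\<nu> + 1) * s powr (\<nu> + 1))"
      using s by (simp add: powr_minus powr_mult divide_inverse del: minus_add_distrib)
    show ?thesis unfolding 1 2 3 D_def using G s by simp
  qed
  finally show ?thesis .
qed

lemma hyp01_measurable [measurable]:
  assumes "\<nu> > -1" shows "hyp01 \<nu> \<in> borel_measurable borel"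
  by (intro borel_measurable_continuous_onI continuous_at_imp_continuous_on ballI
      DERIV_isCont[OF hyp01_deriv[OF assms]])

lemma gaussian_moment_has_integral:
  assumes \<nu>: "\<nu> > -1" and s: "s > 0"
  shows "has_bochner_integral (dunkl_measure \<nu>) (\<lambda>x. exp (- s * x\<^sup>2) * x ^ (2 * N))
    ((2 * s) powr (- (\<nu> + 1)) * poch \<nu> N / s ^ N)"
proof (rule has_bochner_integral_nn_integral[OF _ _ _ dunkl_gaussian_moment[OF \<nu> s]])
  show "(\<lambda>x. exp (- s * x\<^sup>2) * x ^ (2 * N)) \<in> borel_measurable (dunkl_measure \<nu>)"
    by (rule borel_measurable_dunklI) auto
  show "0 \<le> (2 * s) powr (- (\<nu> + 1)) * poch \<nu> N / s ^ N"
    using pochhammer_lower_bound(2)[OF \<nu>, of N] s by (intro divide_nonneg_nonneg mult_nonneg_nonneg) auto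
qed simp

text \<open>Up to a common factor, integration against the Gaussian multiplies the coefficient of
  \<open>l ^ (2 * n)\<close> by \<open>poch \<nu> n / s ^ n\<close>. The last assumption expresses
  that the L^1 norms of the terms are summable, which is what permits termwise integration.\<close>

lemma gaussian_power_series:
  assumes \<nu>: "\<nu> > -1" and s: "s > 0"
    and h: "\<And>l. (\<lambda>n. c n * l ^ (2 * n)) sums h l"
    and abs: "\<And>l. summable (\<lambda>n. \<bar>c n\<bar> * l ^ (2 * n))"
    and sm: "summable (\<lambda>n. poch \<nu> n * \<bar>c n\<bar> / s ^ n)"
  shows "has_bochner_integral (dunkl_measure \<nu>) (\<lambda>l. exp (- s * l\<^sup>2) * h l)
    ((2 * s) powr (- (\<nu> + 1)) * (\<Sum>n. poch \<nu> n * c n / s ^ n))"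
proof -
  define P where "P = (2 * s) powr (- (\<nu> + 1))"
  define f where "f n l = c n * (exp (- s * l\<^sup>2) * l ^ (2 * n))" for n l
  have f: "has_bochner_integral (dunkl_measure \<nu>) (f n) (c n * (P * poch \<nu> n / s ^ n))" for n
    unfolding f_def P_def by (intro has_bochner_integral_mult_right gaussian_moment_has_integral \<nu> s)
  have nf: "has_bochner_integral (dunkl_measure \<nu>) (\<lambda>l. norm (f n l)) (\<bar>c n\<bar> * (P * poch \<nu> n / s ^ n))" for n
  proof -
    have "(\<lambda>l. norm (f n l)) = (\<lambda>l. \<bar>c n\<bar> * (exp (- s * l\<^sup>2) * l ^ (2 * n)))"
      by (simp add: f_def abs_mult)
    then show ?thesis
      unfolding P_def by (simp only:) (intro has_bochner_integral_mult_right gaussian_moment_has_integral \<nu> s)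
  qed
  have int: "integrable (dunkl_measure \<nu>) (f n)" for n
    using f by (rule integrable.intros)
  have fs: "(\<lambda>n. f n l) sums (exp (- s * l\<^sup>2) * h l)" for l
    using sums_mult[OF h[of l], of "exp (- s * l\<^sup>2)"] by (simp add: f_def mult_ac)
  have ae: "AE l in dunkl_measure \<nu>. summable (\<lambda>n. norm (f n l))"
  proof (rule AE_I2)
    fix l
    have "norm (f n l) = exp (- s * l\<^sup>2) * (\<bar>c n\<bar> * l ^ (2 * n))" for n
      by (simp add: f_def abs_mult)
    then show "summable (\<lambda>n. norm (f n l))"
      using summable_mult[OF abs[of l], of "exp (- s * l\<^sup>2)"] by simp
  qed
  have sI: "summable (\<lambda>n. LINT l|dunkl_measure \<nu>. norm (f n l))"
  proof -
    have "(LINT l|dunkl_measure \<nu>. norm (f n l)) = P * (poch \<nu> n * \<bar>c n\<bar> / s ^ n)" for n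
      using has_bochner_integral_integral_eq[OF nf[of n]] by (simp add: mult_ac)
    then show ?thesis using summable_mult[OF sm, of P] by simp
  qed
  have eq: "(\<Sum>n. f n l) = exp (- s * l\<^sup>2) * h l" for l using fs[of l] by (simp add: sums_iff)
  have "integrable (dunkl_measure \<nu>) (\<lambda>l. exp (- s * l\<^sup>2) * h l)"
    using integrable_suminf[OF int ae sI] by (simp add: eq)
  moreover have "(LINT l|dunkl_measure \<nu>. exp (- s * l\<^sup>2) * h l) = P * (\<Sum>n. poch \<nu> n * c n / s ^ n)"
  proof -
    have "(LINT l|dunkl_measure \<nu>. exp (- s * l\<^sup>2) * h l) = (\<Sum>n. LINT l|dunkl_measure \<nu>. f n l)"
      using integral_suminf[OF int ae sI] by (simp add: eq)
    also have "\<dots> = (\<Sum>n. P * (poch \<nu> n * c n / s ^ n))"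
      using has_bochner_integral_integral_eq[OF f] by (simp add: mult_ac)
    also have "\<dots> = P * (\<Sum>n. poch \<nu> n * c n / s ^ n)"
    proof (rule suminf_mult)
      have "summable (\<lambda>n. norm (poch \<nu> n * c n / s ^ n))"
        using sm s less_imp_le[OF pochhammer_lower_bound(2)[OF \<nu>]] by (simp add: abs_mult)
      then show "summable (\<lambda>n. poch \<nu> n * c n / s ^ n)" by (rule summable_norm_cancel)
    qed
    finally show ?thesis .
  qed
  ultimately show ?thesis unfolding P_def by (metis has_bochner_integral_iff)
qed

text \<open>Weber's first exponential integral: the moments cancel the Pochhammer symbols and leave
  the exponential series in \<open>t / s\<close>. It yields the total mass of the heat
  kernel.\<close>

lemma gaussian_hyp01:
  assumes \<nu>: "\<nu> > -1" and s: "s > 0"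
  shows "has_bochner_integral (dunkl_measure \<nu>) (\<lambda>l. exp (- s * l\<^sup>2) * hyp01 \<nu> (t * l\<^sup>2))
    ((2 * s) powr (- (\<nu> + 1)) * exp (t / s))"
proof -
  define c where "c n = t ^ n / (fact n * poch \<nu> n)" for n
  note pos = pochhammer_lower_bound(2)[OF \<nu>]
  have pc: "poch \<nu> n * c n / s ^ n = (t / s) ^ n / fact n" for n
    using pos[of n] by (simp add: c_def power_divide)
  have pc': "poch \<nu> n * \<bar>c n\<bar> / s ^ n = (\<bar>t\<bar> / s) ^ n / fact n" for n
    using pos[of n] by (simp add: c_def power_divide abs_mult power_abs)
  have e: "(\<lambda>n. x ^ n / fact n) sums exp x" for x :: real
    using exp_converges[of x] by (simp add: scaleR_conv_of_real field_simps)
  have "has_bochner_integral (dunkl_measure \<nu>) (\<lambda>l. exp (- s * l\<^sup>2) * hyp01 \<nu> (t * l\<^sup>2))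
    ((2 * s) powr (- (\<nu> + 1)) * (\<Sum>n. poch \<nu> n * c n / s ^ n))"
  proof (rule gaussian_power_series[OF \<nu> s])
    show "(\<lambda>n. c n * l ^ (2 * n)) sums hyp01 \<nu> (t * l\<^sup>2)" for l
      using hyp01_sums[OF \<nu>, of "t * l\<^sup>2"] by (simp add: c_def power_mult_distrib power_mult)
    show "summable (\<lambda>n. \<bar>c n\<bar> * l ^ (2 * n))" for l
      using summable_hyp01[OF \<nu>, of "t * l\<^sup>2"] 
      by (simp add: c_def power_mult_distrib power_mult abs_mult power_abs)
    show "summable (\<lambda>n. poch \<nu> n * \<bar>c n\<bar> / s ^ n)"
      unfolding pc' using e sums_summable by blast
  qed
  also have "(\<Sum>n. poch \<nu> n * c n / s ^ n) = exp (t / s)"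
    unfolding pc by (rule sums_unique[OF e, symmetric])
  finally show ?thesis .
qed

text \<open>By homogeneity the coefficients for \<open>(- X, - Y)\<close> differ from those for
  \<open>(X, Y)\<close>, which are nonnegative, only by the sign \<open>(-1) ^ n\<close>. One
  series, \<open>weber_coeff_sums\<close>, therefore gives both the absolute convergence and the
  value. As the product of \<open>- X\<close> and \<open>- Y\<close> is nonnegative, two Bessel
  functions turn into a modified one.\<close>

lemma weber_integral:
  assumes \<nu>: "\<nu> > -1" and s: "s > 0" and XY: "X \<ge> 0" "Y \<ge> 0"
  shows "has_bochner_integral (dunkl_measure \<nu>) (\<lambda>l. exp (- s * l\<^sup>2) * (hyp01 \<nu> (- X * l\<^sup>2) * hyp01 \<nu> (- Y * l\<^sup>2)))
    ((2 * s) powr (- (\<nu> + 1)) * (exp (- (X + Y) / s) * hyp01 \<nu> (X * Y / s\<^sup>2)))"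
proof -
  define c where "c n = weber_coeff \<nu> n (- X) (- Y)" for n
  have cr: "weber_coeff \<nu> n X Y * r ^ n = weber_coeff \<nu> n (r * X) (r * Y)" for n X Y r
    by (simp add: weber_coeff_scale)
  have lp: "l ^ (2 * n) = (l\<^sup>2) ^ n" for l :: real and n by (rule power_mult)
  have c: "c n = (-1) ^ n * weber_coeff \<nu> n X Y" for n
    unfolding c_def using weber_coeff_scale[of \<nu> n "-1" X Y] by simp
  have ac: "\<bar>c n\<bar> = weber_coeff \<nu> n X Y" for n
    unfolding c using weber_coeff_nonneg[OF \<nu> XY, of n] by (simp add: abs_mult)
  have sc: "poch \<nu> n * weber_coeff \<nu> n X Y / s ^ n =
    poch \<nu> n * weber_coeff \<nu> n (X / s) (Y / s)" for n X Y
  proof -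
    have "weber_coeff \<nu> n (X / s) (Y / s) = weber_coeff \<nu> n X Y / s ^ n"
      using cr[of n X Y "1 / s"] by (simp add: power_divide)
    then show ?thesis by simp
  qed
  have "has_bochner_integral (dunkl_measure \<nu>) (\<lambda>l. exp (- s * l\<^sup>2) * (hyp01 \<nu> (- X * l\<^sup>2) * hyp01 \<nu> (- Y * l\<^sup>2)))
    ((2 * s) powr (- (\<nu> + 1)) * (\<Sum>n. poch \<nu> n * c n / s ^ n))"
  proof (rule gaussian_power_series[OF \<nu> s])
    show "(\<lambda>n. c n * l ^ (2 * n)) sums (hyp01 \<nu> (- X * l\<^sup>2) * hyp01 \<nu> (- Y * l\<^sup>2))" for l
      using hyp01_mult_sums[OF \<nu>, of "- X * l\<^sup>2" "- Y * l\<^sup>2"] cr[of _ "-X" "-Y" "l\<^sup>2"]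
      unfolding lp by (simp add: c_def mult.commute)
    show "summable (\<lambda>n. \<bar>c n\<bar> * l ^ (2 * n))" for l
      using sums_summable[OF hyp01_mult_sums[OF \<nu>, of "X * l\<^sup>2" "Y * l\<^sup>2"]] cr[of _ X Y "l\<^sup>2"]
      unfolding lp by (simp add: ac mult.commute)
    show "summable (\<lambda>n. poch \<nu> n * \<bar>c n\<bar> / s ^ n)"
      unfolding ac sc by (rule sums_summable[OF weber_coeff_sums[OF \<nu>]])
  qed
  also have "(\<Sum>n. poch \<nu> n * c n / s ^ n) = exp (- (X + Y) / s) * hyp01 \<nu> (X * Y / s\<^sup>2)"
    unfolding c_def sc sums_unique[OF weber_coeff_sums[OF \<nu>], symmetric]
    by (simp add: power2_eq_square add_divide_distrib diff_divide_distrib)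
  finally show ?thesis .
qed

lemma dunkl_integral_lborel:
  fixes f :: "real \<Rightarrow> 'b::{banach, second_countable_topology}"
  assumes [measurable]: "f \<in> borel_measurable borel" and \<nu>: "\<nu> > -1"
  shows "(LINT x|dunkl_measure \<nu>. f x) =
    (LINT x|lborel. (\<bar>x\<bar> powr (2 * \<nu> + 1) / (2 powr (\<nu> + 1) * Gamma (\<nu> + 1))) *\<^sub>R f x)"
proof -
  have G: "Gamma (\<nu> + 1) > 0" using \<nu> by (intro Gamma_real_pos) simp
  have "(LINT x|dunkl_measure \<nu>. f x) = (LINT x|lebesgue. (\<bar>x\<bar> powr (2 * \<nu> + 1) / (2 powr (\<nu> + 1) * Gamma (\<nu> + 1))) *\<^sub>R f x)"
    unfolding dunkl_measure_def using G
    by (intro integral_density) (auto intro!: measurable_completion)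
  also have "\<dots> = (LINT x|lborel. (\<bar>x\<bar> powr (2 * \<nu> + 1) / (2 powr (\<nu> + 1) * Gamma (\<nu> + 1))) *\<^sub>R f x)"
    by (rule integral_completion) simp
  finally show ?thesis .
qed

text \<open>The reflection \<open>x \<mapsto> - x\<close> preserves the measure and gives
  \<open>?I = - ?I\<close>. A non-integrable \<open>f\<close> is covered too, its Bochner integral
  being 0 by convention.\<close>

lemma dunkl_integral_odd:
  fixes f :: "real \<Rightarrow> real"
  assumes m: "f \<in> borel_measurable borel" and \<nu>: "\<nu> > -1" and odd: "\<And>x. f (- x) = - f x"
  shows "(LINT x|dunkl_measure \<nu>. f x) = 0"
proof -
  have "(LINT x|dunkl_measure \<nu>. f x) =
      (LINT x|lborel. (\<bar>x\<bar> powr (2 * \<nu> + 1) / (2 powr (\<nu> + 1) * Gamma (\<nu> + 1))) *\<^sub>R f x)" (is "_ = ?I")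
    by (rule dunkl_integral_lborel[OF m \<nu>])
  moreover have "?I = - ?I"
    by (subst lborel_integral_real_affine[where c = "-1" and t = 0]) (simp_all add: odd)
  ultimately show ?thesis by simp
qed

text \<open>A factor \<open>x\<^sup>2\<close> raises the order of the density by one. This is how a
  product of two \<open>dunkl_sin\<close>, each carrying a factor \<open>l\<close>, comes within
  reach of \<open>weber_integral\<close> at order \<open>k + 1\<close>.\<close>

lemma dunkl_integral_square:
  fixes f :: "real \<Rightarrow> real"
  assumes m [measurable]: "f \<in> borel_measurable borel" and \<nu>: "\<nu> > -1"
  shows "(LINT x|dunkl_measure \<nu>. x\<^sup>2 * f x) = 2 * (\<nu> + 1) * (LINT x|dunkl_measure (\<nu> + 1). f x)"
proof -
  have G: "Gamma (\<nu> + 1) > 0" using \<nu> by (intro Gamma_real_pos) simp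
  have "Gamma (\<nu> + 1 + 1) = (\<nu> + 1) * Gamma (\<nu> + 1)" using Gamma_plus1[of "\<nu> + 1"] \<nu>
    by (metis Gamma_eq_zero_iff G less_irrefl)
  then have D: "2 powr (\<nu> + 1 + 1) * Gamma (\<nu> + 1 + 1) = 2 * (\<nu> + 1) * (2 powr (\<nu> + 1) * Gamma (\<nu> + 1))"
    by (simp add: powr_add)
  have eq: "(\<bar>x\<bar> powr (2 * \<nu> + 1) / (2 powr (\<nu> + 1) * Gamma (\<nu> + 1))) *\<^sub>R (x\<^sup>2 * f x) =
     2 * (\<nu> + 1) * ((\<bar>x\<bar> powr (2 * (\<nu> + 1) + 1) / (2 powr (\<nu> + 1 + 1) * Gamma (\<nu> + 1 + 1))) *\<^sub>R f x)" for x
  proof (cases "x = 0")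
    case False
    have "\<bar>x\<bar> powr (2 * (\<nu> + 1) + 1) = \<bar>x\<bar> powr (2 * \<nu> + 1) * x\<^sup>2"
      using False powr_add[of "\<bar>x\<bar>" "2 * \<nu> + 1" 2] by (simp add: powr_numeral algebra_simps)
    then show ?thesis unfolding D using \<nu> G by (simp add: divide_simps)
  qed simp
  have "(LINT x|dunkl_measure \<nu>. x\<^sup>2 * f x) =
      (LINT x|lborel. (\<bar>x\<bar> powr (2 * \<nu> + 1) / (2 powr (\<nu> + 1) * Gamma (\<nu> + 1))) *\<^sub>R (x\<^sup>2 * f x))"
    by (rule dunkl_integral_lborel) (use \<nu> in auto)
  also have "\<dots> = 2 * (\<nu> + 1) * (LINT x|lborel. (\<bar>x\<bar> powr (2 * (\<nu> + 1) + 1) / (2 powr (\<nu> + 1 + 1) * Gamma (\<nu> + 1 + 1))) *\<^sub>R f x)"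
    unfolding eq by (rule integral_mult_right_zero)
  also have "(LINT x|lborel. (\<bar>x\<bar> powr (2 * (\<nu> + 1) + 1) / (2 powr (\<nu> + 1 + 1) * Gamma (\<nu> + 1 + 1))) *\<^sub>R f x) =
      (LINT x|dunkl_measure (\<nu> + 1). f x)"
    by (rule dunkl_integral_lborel[symmetric]) (use \<nu> in auto)
  finally show ?thesis .
qed

section \<open>The Dunkl kernel and its heat kernel\<close>

definition dunkl_cos :: "real \<Rightarrow> real \<Rightarrow> real" where
  "dunkl_cos k u = hyp01 k (- u\<^sup>2 / 4)"

definition dunkl_sin :: "real \<Rightarrow> real \<Rightarrow> real" where
  "dunkl_sin k u = u / (2 * (k + 1)) * hyp01 (k + 1) (- u\<^sup>2 / 4)"

text \<open>The model case is \<open>k = -1/2\<close>, where \<open>dunkl_cos\<close> and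
  \<open>dunkl_sin\<close> are the cosine and the sine and the kernel is exp(-ilx). The kernel
  depends on \<open>l * x\<close> only.\<close>

lemma dunkl_kernel_eq:
  assumes "k \<ge> -1/2"
  shows "dunkl_kernel k l x = Complex (dunkl_cos k (l * x)) (- dunkl_sin k (l * x))"
proof -
  have "dunkl_kernel k l x = of_real (dunkl_cos k (l * x)) - \<i> * of_real (dunkl_sin k (l * x))"
    using assms by (simp add: dunkl_kernel_def dunkl_cos_def dunkl_sin_def bessel_j_eq_hyp01)
  then show ?thesis by (simp add: complex_eq_iff)
qed

lemma dunkl_cos_sin_le:
  assumes "k \<ge> -1/2"
  shows "(dunkl_cos k u)\<^sup>2 + (dunkl_sin k u)\<^sup>2 \<le> 1"
  using hyp01_energy[OF assms, of "-1" u] by (simp add: dunkl_cos_def dunkl_sin_def)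

lemma norm_dunkl_kernel_le:
  assumes "k \<ge> -1/2"
  shows "norm (dunkl_kernel k l x) \<le> 1"
  using dunkl_cos_sin_le[OF assms, of "l * x"] by (simp add: dunkl_kernel_eq[OF assms] cmod_def)

text \<open>The Dunkl heat kernel at time \<open>\<epsilon>\<close>. The bracket is the Dunkl kernel
  at a real exponent, the analogue of exp(z) for \<open>z = x * y / (2 * \<epsilon>)\<close>, split
  into its even and its odd part.\<close>

definition heat :: "real \<Rightarrow> real \<Rightarrow> real \<Rightarrow> real \<Rightarrow> real" where
  "heat k \<epsilon> x y = (2 * \<epsilon>) powr (- (k + 1)) * exp (- (x\<^sup>2 + y\<^sup>2) / (4 * \<epsilon>)) *
     (hyp01 k ((x * y / (2 * \<epsilon>))\<^sup>2 / 4) + x * y / (2 * \<epsilon>) / (2 * (k + 1)) * hyp01 (k + 1) ((x * y / (2 * \<epsilon>))\<^sup>2 / 4))"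

lemma heat_sym: "heat k \<epsilon> x y = heat k \<epsilon> y x"
  by (simp add: heat_def mult.commute add.commute)

text \<open>The energy inequality with \<sigma> = 1; for \<open>k = -1/2\<close> it says that |sinh
  z| is at most cosh z. It keeps the heat kernel nonnegative for either sign of
  \<open>x * y\<close>.\<close>

lemma hyp01_odd_le_even:
  assumes k: "k \<ge> -1/2"
  shows "\<bar>z / (2 * (k + 1)) * hyp01 (k + 1) (z\<^sup>2 / 4)\<bar> \<le> hyp01 k (z\<^sup>2 / 4)"
proof -
  have "(z / (2 * (k + 1)) * hyp01 (k + 1) (z\<^sup>2 / 4))\<^sup>2 \<le> (hyp01 k (z\<^sup>2 / 4))\<^sup>2"
    using hyp01_energy[OF k, of 1 z] by simp
  then show ?thesis
    using hyp01_pos[of k "z\<^sup>2 / 4"] k by (simp add: abs_le_square_iff[symmetric])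
qed

lemma heat_nonneg:
  assumes k: "k \<ge> -1/2"
  shows "heat k \<epsilon> x y \<ge> 0"
proof -
  have "0 \<le> hyp01 k ((x * y / (2 * \<epsilon>))\<^sup>2 / 4) +
      x * y / (2 * \<epsilon>) / (2 * (k + 1)) * hyp01 (k + 1) ((x * y / (2 * \<epsilon>))\<^sup>2 / 4)"
    using hyp01_odd_le_even[OF k, of "x * y / (2 * \<epsilon>)"] by linarith
  then show ?thesis unfolding heat_def by (intro mult_nonneg_nonneg) auto
qed

lemma gaussian_integrable:
  assumes "\<nu> > -1" "s > 0"
  shows "integrable (dunkl_measure \<nu>) (\<lambda>l. exp (- s * l\<^sup>2))"
  using gaussian_moment_has_integral[OF assms, of 0] by (auto intro: integrable.intros)

text \<open>In the real part the product of cosines is \<open>weber_integral\<close> at order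
  \<open>k\<close> and the product of sines is the same at order \<open>k + 1\<close>, after
  \<open>dunkl_integral_square\<close>; they yield the even and the odd half of the heat kernel. The
  imaginary part is odd in \<open>l\<close>.\<close>

lemma heat_kernel_integral:
  assumes k: "k \<ge> -1/2" and \<epsilon>: "\<epsilon> > 0"
  shows "(LINT l|dunkl_measure k. of_real (exp (- \<epsilon> * l\<^sup>2)) * (dunkl_kernel k l x * cnj (dunkl_kernel k l y)))
    = of_real (heat k \<epsilon> x y)"
proof -
  have k1: "k > -1" "k + 1 > -1" "k + 1 > 0" using k by auto
  note [measurable] = hyp01_measurable[OF k1(1)] hyp01_measurable[OF k1(2)]
  define w where "w l = exp (- \<epsilon> * l\<^sup>2)" for l
  define c where "c = dunkl_cos k"
  define s where "s = dunkl_sin k"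
  have m [measurable]: "c \<in> borel_measurable borel" "s \<in> borel_measurable borel" "w \<in> borel_measurable borel"
    unfolding c_def s_def w_def[abs_def] dunkl_cos_def[abs_def] dunkl_sin_def[abs_def] by measurable
  have iw: "integrable (dunkl_measure k) w"
    using gaussian_integrable[OF k1(1) \<epsilon>] by (simp add: w_def[abs_def])
  have w0: "w l \<ge> 0" for l by (simp add: w_def)
  have le1: "\<bar>c u\<bar> \<le> 1" "\<bar>s u\<bar> \<le> 1" for u
  proof -
    have "(c u)\<^sup>2 \<le> 1\<^sup>2" "(s u)\<^sup>2 \<le> 1\<^sup>2"
      using dunkl_cos_sin_le[OF k, of u] zero_le_power2[of "c u"] zero_le_power2[of "s u"]
      unfolding c_def s_def one_power2 by linarith+
    then show "\<bar>c u\<bar> \<le> 1" "\<bar>s u\<bar> \<le> 1" by (auto simp only: abs_le_square_iff[symmetric] abs_one)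
  qed
  have int: "integrable (dunkl_measure k) (\<lambda>l. w l * (f (l * x) * g (l * y)))"
    if [measurable]: "f \<in> borel_measurable borel" "g \<in> borel_measurable borel"
      and fg: "\<And>u. \<bar>f u\<bar> \<le> 1" "\<And>u. \<bar>g u\<bar> \<le> 1" for f g :: "real \<Rightarrow> real"
  proof (rule integrable_dominated[OF iw])
    show "(\<lambda>l. w l * (f (l * x) * g (l * y))) \<in> borel_measurable (dunkl_measure k)"
      by (rule borel_measurable_dunklI) measurable
    show "AE l in dunkl_measure k. norm (w l * (f (l * x) * g (l * y))) \<le> norm (w l)"
    proof (rule AE_I2)
      fix l
      have "\<bar>f (l * x)\<bar> * \<bar>g (l * y)\<bar> \<le> 1 * 1" using fg by (intro mult_mono) auto
      then show "norm (w l * (f (l * x) * g (l * y))) \<le> norm (w l)"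
        using w0[of l] by (simp add: abs_mult mult_left_le)
    qed
  qed
  define P where "P = (2 * \<epsilon>) powr (- (k + 1))"
  define Q where "Q = exp (- (x\<^sup>2 + y\<^sup>2) / (4 * \<epsilon>))"
  define z where "z = x * y / (2 * \<epsilon>)"
  have Q: "exp (- (x\<^sup>2 / 4 + y\<^sup>2 / 4) / \<epsilon>) = Q" unfolding Q_def using \<epsilon> by (simp add: field_simps)
  have z: "x\<^sup>2 / 4 * (y\<^sup>2 / 4) / \<epsilon>\<^sup>2 = z\<^sup>2 / 4" unfolding z_def by (simp add: power_mult_distrib power_divide)
  have arg: "- (l * t)\<^sup>2 / 4 = - (t\<^sup>2 / 4) * l\<^sup>2" for l t :: real by (simp add: power_mult_distrib)
  have cc: "(LINT l|dunkl_measure k. w l * (c (l * x) * c (l * y))) = P * (Q * hyp01 k (z\<^sup>2 / 4))"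
    using has_bochner_integral_integral_eq[OF weber_integral[OF k1(1) \<epsilon>, of "x\<^sup>2 / 4" "y\<^sup>2 / 4"]]
    unfolding Q z w_def c_def dunkl_cos_def arg P_def by simp
  have ss: "(LINT l|dunkl_measure k. w l * (s (l * x) * s (l * y))) = P * Q * (z / (2 * (k + 1)) * hyp01 (k + 1) (z\<^sup>2 / 4))"
  proof -
    define F where "F l = w l * (hyp01 (k + 1) (- (x\<^sup>2 / 4) * l\<^sup>2) * hyp01 (k + 1) (- (y\<^sup>2 / 4) * l\<^sup>2))" for l
    have Fm [measurable]: "F \<in> borel_measurable borel" unfolding F_def[abs_def] by measurable
    define C where "C = x * y / (2 * (k + 1))\<^sup>2"
    have "(LINT l|dunkl_measure k. w l * (s (l * x) * s (l * y))) = (LINT l|dunkl_measure k. l\<^sup>2 * (C * F l))"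
      unfolding F_def s_def dunkl_sin_def arg C_def by (simp add: power2_eq_square mult_ac)
    also have "\<dots> = 2 * (k + 1) * (LINT l|dunkl_measure (k + 1). C * F l)"
      by (rule dunkl_integral_square[OF _ k1(1)]) measurable
    also have "(LINT l|dunkl_measure (k + 1). C * F l) = C * ((2 * \<epsilon>) powr (- (k + 1 + 1)) * (Q * hyp01 (k + 1) (z\<^sup>2 / 4)))"
      using has_bochner_integral_integral_eq[OF weber_integral[OF k1(2) \<epsilon>, of "x\<^sup>2 / 4" "y\<^sup>2 / 4"]]
      unfolding Q z F_def w_def by simp
    also have "(2 * \<epsilon>) powr (- (k + 1 + 1)) = P / (2 * \<epsilon>)"
      using \<epsilon> powr_add[of "2 * \<epsilon>" "- (k + 1)" "-1"] by (simp add: P_def powr_minus_divide)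
    also have "2 * (k + 1) * (C * (P / (2 * \<epsilon>) * (Q * hyp01 (k + 1) (z\<^sup>2 / 4)))) =
        P * Q * (z / (2 * (k + 1)) * hyp01 (k + 1) (z\<^sup>2 / 4))"
    proof -
      have "2 * (k + 1) * C = x * y / (2 * (k + 1))" using k1 by (simp add: C_def power2_eq_square)
      then have "2 * (k + 1) * C / (2 * \<epsilon>) = z / (2 * (k + 1))" by (simp add: z_def)
      moreover have "2 * (k + 1) * (C * (P / (2 * \<epsilon>) * (Q * hyp01 (k + 1) (z\<^sup>2 / 4)))) =
         P * Q * (2 * (k + 1) * C / (2 * \<epsilon>) * hyp01 (k + 1) (z\<^sup>2 / 4))" by simp
      ultimately show ?thesis by simp
    qed
    finally show ?thesis .
  qed
  define G where "G l = of_real (w l) * (dunkl_kernel k l x * cnj (dunkl_kernel k l y))" for l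
  have ReG: "Re (G l) = w l * (c (l * x) * c (l * y)) + w l * (s (l * x) * s (l * y))" for l
    by (simp add: G_def dunkl_kernel_eq[OF k] c_def s_def algebra_simps)
  have ImG: "Im (G l) = w l * (c (l * x) * s (l * y)) - w l * (s (l * x) * c (l * y))" for l
    by (simp add: G_def dunkl_kernel_eq[OF k] c_def s_def algebra_simps)
  have iG: "integrable (dunkl_measure k) G"
  proof -
    have "G = (\<lambda>l. of_real (w l * (c (l * x) * c (l * y)) + w l * (s (l * x) * s (l * y))) +
        \<i> * of_real (w l * (c (l * x) * s (l * y)) - w l * (s (l * x) * c (l * y))))"
      by (rule ext) (simp add: complex_eq_iff ReG ImG)
    then show ?thesis
      by (simp only:) (intro integrable_of_real Bochner_Integration.integrable_add
        Bochner_Integration.integrable_diff integrable_mult_right int m le1)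
  qed
  have "Re (LINT l|dunkl_measure k. G l) = (LINT l|dunkl_measure k. Re (G l))"
    using iG by simp
  also have "\<dots> = P * (Q * hyp01 k (z\<^sup>2 / 4)) + P * Q * (z / (2 * (k + 1)) * hyp01 (k + 1) (z\<^sup>2 / 4))"
    unfolding ReG by (subst Bochner_Integration.integral_add) (auto simp: cc ss intro!: int m le1)
  also have "\<dots> = heat k \<epsilon> x y"
    by (simp add: heat_def P_def Q_def z_def algebra_simps)
  finally have 1: "Re (LINT l|dunkl_measure k. G l) = heat k \<epsilon> x y" .
  have "Im (LINT l|dunkl_measure k. G l) = (LINT l|dunkl_measure k. Im (G l))"
    using iG by simp
  also have "\<dots> = 0"
    unfolding ImG
  proof (rule dunkl_integral_odd[OF _ k1(1)])
    have "c (- u) = c u" "s (- u) = - s u" "w (- u) = w u" for u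
      by (simp_all add: c_def s_def w_def dunkl_cos_def dunkl_sin_def)
    then show "w (- l) * (c (- l * x) * s (- l * y)) - w (- l) * (s (- l * x) * c (- l * y)) =
      - (w l * (c (l * x) * s (l * y)) - w l * (s (l * x) * c (l * y)))" for l by simp
  qed measurable
  finally have 2: "Im (LINT l|dunkl_measure k. G l) = 0" .
  show ?thesis using 1 2 unfolding G_def w_def by (simp add: complex_eq_iff)
qed

text \<open>The part odd in \<open>y\<close> is dominated by the even part, hence integrable, and
  integrates to 0; the even part is \<open>gaussian_hyp01\<close>. That the mass depends neither on
  \<open>x\<close> nor on \<open>\<epsilon>\<close> is what Schur's test and the limit
  \<open>\<epsilon> \<rightarrow> 0\<close> require; its value is the Jacobian of
  \<open>y \<mapsto> y / b\<close>.\<close>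

lemma heat_nn_integral:
  assumes k: "k \<ge> -1/2" and \<epsilon>: "\<epsilon> > 0" and b: "b \<noteq> 0"
  shows "(\<integral>\<^sup>+y. ennreal (heat k \<epsilon> (x / b) (y / b)) \<partial>dunkl_measure k) = ennreal (\<bar>b\<bar> powr (2 * (k + 1)))"
proof -
  have k1: "k > -1" "k + 1 > -1" "k + 1 > 0" using k by auto
  note [measurable] = hyp01_measurable[OF k1(1)] hyp01_measurable[OF k1(2)]
  \<comment> \<open>The Gaussian rate after rescaling by \<open>b\<close>, common to
    \<open>x\<close> and \<open>y\<close>. The factor \<open>exp (- s * x\<^sup>2)\<close> in
    \<open>P\<close> will cancel the \<open>exp ((s * x)\<^sup>2 / s)\<close> produced by the
    integration.\<close>
  define s where "s = 1 / (4 * \<epsilon> * b\<^sup>2)"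
  have s: "s > 0" using \<epsilon> b by (simp add: s_def)
  define P where "P = (2 * \<epsilon>) powr (- (k + 1)) * exp (- s * x\<^sup>2)"
  define z where "z y = 2 * s * x * y" for y
  define e where "e y = P * (exp (- s * y\<^sup>2) * hyp01 k ((s * x)\<^sup>2 * y\<^sup>2))" for y
  define d where "d y = P * (exp (- s * y\<^sup>2) * (z y / (2 * (k + 1)) * hyp01 (k + 1) ((s * x)\<^sup>2 * y\<^sup>2)))" for y
  have zz: "(z y)\<^sup>2 / 4 = (s * x)\<^sup>2 * y\<^sup>2" for y by (simp add: z_def power_mult_distrib)
  have heat: "heat k \<epsilon> (x / b) (y / b) = e y + d y" for y
  proof -
    have 1: "x / b * (y / b) / (2 * \<epsilon>) = z y" using \<epsilon> b by (simp add: z_def s_def power2_eq_square)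
    have 2: "- ((x / b)\<^sup>2 + (y / b)\<^sup>2) / (4 * \<epsilon>) = - s * x\<^sup>2 + - s * y\<^sup>2"
      using \<epsilon> b by (simp add: s_def power_divide divide_simps)
    show ?thesis unfolding heat_def 1 2 zz e_def d_def P_def exp_add by (simp add: algebra_simps)
  qed
  have P0: "P \<ge> 0" by (simp add: P_def)
  have e: "has_bochner_integral (dunkl_measure k) e (P * ((2 * s) powr (- (k + 1)) * exp ((s * x)\<^sup>2 / s)))"
    unfolding e_def[abs_def] by (intro has_bochner_integral_mult_right gaussian_hyp01 k1 s)
  have de: "\<bar>d y\<bar> \<le> e y" for y
  proof -
    have "\<bar>d y\<bar> = P * (exp (- s * y\<^sup>2) * \<bar>z y / (2 * (k + 1)) * hyp01 (k + 1) ((s * x)\<^sup>2 * y\<^sup>2)\<bar>)"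
      using P0 by (simp add: d_def abs_mult)
    also have "\<dots> \<le> e y"
      using hyp01_odd_le_even[OF k, of "z y"] P0 unfolding zz e_def by (intro mult_left_mono) auto
    finally show ?thesis .
  qed
  have dm: "d \<in> borel_measurable borel" unfolding d_def[abs_def] z_def by measurable
  have ie: "integrable (dunkl_measure k) e" using e by (rule integrable.intros)
  have id: "integrable (dunkl_measure k) d"
    by (rule integrable_dominated[OF ie borel_measurable_dunklI[OF _ dm]])
       (use de in \<open>auto intro: order_trans[OF _ abs_ge_self]\<close>)
  have "(LINT y|dunkl_measure k. heat k \<epsilon> (x / b) (y / b)) = (LINT y|dunkl_measure k. e y) + (LINT y|dunkl_measure k. d y)"
    unfolding heat using ie id by simp
  also have "(LINT y|dunkl_measure k. d y) = 0"
    by (rule dunkl_integral_odd[OF dm k1(1)]) (simp add: d_def z_def)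
  also have "(LINT y|dunkl_measure k. e y) = P * ((2 * s) powr (- (k + 1)) * exp ((s * x)\<^sup>2 / s))"
    by (rule has_bochner_integral_integral_eq[OF e])
  also have "P * ((2 * s) powr (- (k + 1)) * exp ((s * x)\<^sup>2 / s)) = \<bar>b\<bar> powr (2 * (k + 1))"
  proof -
    have 1: "(s * x)\<^sup>2 / s = s * x\<^sup>2" using s by (simp add: power2_eq_square)
    have "(2 * \<epsilon>) powr (- (k + 1)) * (2 * s) powr (- (k + 1)) = (1 / b\<^sup>2) powr (- (k + 1))"
      using s \<epsilon> b by (subst powr_mult[symmetric]) (auto simp: s_def)
    also have "1 / b\<^sup>2 = \<bar>b\<bar> powr (- 2)" using b by (simp add: powr_minus_divide powr_numeral)
    also have "(\<bar>b\<bar> powr (- 2)) powr (- (k + 1)) = \<bar>b\<bar> powr (2 * (k + 1))"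
      by (simp add: powr_powr algebra_simps)
    finally have 2: "(2 * \<epsilon>) powr (- (k + 1)) * (2 * s) powr (- (k + 1)) = \<bar>b\<bar> powr (2 * (k + 1))" .
    have "P * ((2 * s) powr (- (k + 1)) * exp ((s * x)\<^sup>2 / s)) = 
       ((2 * \<epsilon>) powr (- (k + 1)) * (2 * s) powr (- (k + 1))) * (exp (- s * x\<^sup>2) * exp (s * x\<^sup>2))"
      unfolding P_def 1 by (simp only: mult_ac)
    also have "exp (- s * x\<^sup>2) * exp (s * x\<^sup>2) = 1" by (simp add: exp_add[symmetric])
    finally show ?thesis unfolding 2 by simp
  qed
  finally have "(LINT y|dunkl_measure k. heat k \<epsilon> (x / b) (y / b)) = \<bar>b\<bar> powr (2 * (k + 1))" by simp
  moreover have "integrable (dunkl_measure k) (\<lambda>y. heat k \<epsilon> (x / b) (y / b))"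
    unfolding heat using ie id by simp
  ultimately show ?thesis
    using heat_nonneg[OF k] by (subst nn_integral_eq_integral) auto
qed

section \<open>The Plancherel inequality\<close>

text \<open>The Gaussian has finite integral and is bounded below by
  \<open>exp (- (real n)\<^sup>2)\<close> on the interval.\<close>

lemma emeasure_dunkl_interval:
  assumes "\<nu> > -1"
  shows "emeasure (dunkl_measure \<nu>) {- real n..real n} \<noteq> \<infinity>"
proof -
  define G where "G x = ennreal (exp (- 1 * x\<^sup>2) * x ^ (2 * 0))" for x :: real
  have G: "(\<integral>\<^sup>+x. G x \<partial>dunkl_measure \<nu>) < \<infinity>"
    unfolding G_def dunkl_gaussian_moment[OF assms zero_less_one] by simp
  have [measurable]: "G \<in> borel_measurable (dunkl_measure \<nu>)"
    unfolding G_def by (rule borel_measurable_dunklI) auto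
  have "emeasure (dunkl_measure \<nu>) {- real n..real n} = (\<integral>\<^sup>+x. indicator {- real n..real n} x \<partial>dunkl_measure \<nu>)"
    by simp
  also have "\<dots> \<le> (\<integral>\<^sup>+x. ennreal (exp ((real n)\<^sup>2)) * G x \<partial>dunkl_measure \<nu>)"
  proof (rule nn_integral_mono)
    fix x :: real
    have "1 \<le> exp ((real n)\<^sup>2) * (exp (- 1 * x\<^sup>2) * x ^ (2 * 0))" if "\<bar>x\<bar> \<le> real n"
      using that power_mono[of "\<bar>x\<bar>" "real n" 2] by (simp add: exp_add[symmetric])
    then show "indicator {- real n..real n} x \<le> ennreal (exp ((real n)\<^sup>2)) * G x"
      unfolding G_def by (auto simp: indicator_def ennreal_mult'[symmetric] abs_le_iff)
  qed
  also have "\<dots> = ennreal (exp ((real n)\<^sup>2)) * (\<integral>\<^sup>+x. G x \<partial>dunkl_measure \<nu>)"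
    by (rule nn_integral_cmult) measurable
  also have "\<dots> < \<infinity>" using G by (simp add: ennreal_mult_less_top)
  finally show ?thesis by simp
qed

lemma sigma_finite_dunkl:
  assumes "\<nu> > -1"
  shows "sigma_finite_measure (dunkl_measure \<nu>)"
proof
  let ?A = "range (\<lambda>n::nat. {- real n..real n})"
  show "\<exists>A. countable A \<and> A \<subseteq> sets (dunkl_measure \<nu>) \<and> \<Union> A = space (dunkl_measure \<nu>) \<and> (\<forall>a\<in>A. emeasure (dunkl_measure \<nu>) a \<noteq> \<infinity>)"
  proof (intro exI[of _ ?A] conjI)
    show "\<Union> ?A = space (dunkl_measure \<nu>)"
    proof (intro set_eqI iffI)
      fix x assume "x \<in> space (dunkl_measure \<nu>)"
      obtain n where "\<bar>x\<bar> \<le> real n" using real_arch_simple by blast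
      then have "x \<in> {- real n..real n}" by auto
      then show "x \<in> \<Union> ?A" by blast
    qed simp
  qed (use emeasure_dunkl_interval[OF assms] in auto)
qed

text \<open>If \<open>f\<close> is not integrable, its Bochner integral is 0 and the bound is
  trivial. This spares the Schur estimate a separate proof that its iterated integrals
  exist.\<close>

lemma norm_integral_le_nn_integral:
  fixes f :: "'a \<Rightarrow> 'b::{banach, second_countable_topology}"
  shows "ennreal (norm (LINT x|M. f x)) \<le> (\<integral>\<^sup>+x. norm (f x) \<partial>M)"
  by (cases "integrable M f") (auto simp: integral_norm_bound_ennreal not_integrable_integral_eq)

lemma (in sigma_finite_measure) fubini_bounded_kernel:
  fixes g h :: "'a \<Rightarrow> complex" and Q :: "'a \<Rightarrow> 'a \<Rightarrow> complex"
  assumes g: "integrable M g" and h: "integrable M h"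
    and Q: "(\<lambda>z. Q (fst z) (snd z)) \<in> borel_measurable (M \<Otimes>\<^sub>M M)" and le: "\<And>l x. norm (Q l x) \<le> 1"
  shows "(LINT l|M. h l * (LINT x|M. g x * Q l x)) = (LINT x|M. g x * (LINT l|M. h l * Q l x))"
proof -
  interpret P: pair_sigma_finite M M ..
  note [measurable] = Q borel_measurable_integrable[OF g] borel_measurable_integrable[OF h]
  have Ql: "Q l \<in> borel_measurable M" if "l \<in> space M" for l
    using measurable_compose[OF measurable_Pair1'[OF that] Q] by simp
  have gQ: "integrable M (\<lambda>x. g x * Q l x)" if "l \<in> space M" for l
    by (rule integrable_dominated[OF g])
       (use Ql[OF that] le in \<open>auto simp: norm_mult intro!: mult_left_le AE_I2\<close>)
  have "integrable (M \<Otimes>\<^sub>M M) (\<lambda>z. h (fst z) * (g (snd z) * Q (fst z) (snd z)))"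
  proof (rule P.Fubini_integrable)
    show "integrable M (\<lambda>x. LINT y|M. norm (h (fst (x, y)) * (g (snd (x, y)) * Q (fst (x, y)) (snd (x, y)))))"
    proof (rule integrable_dominated[where f = "\<lambda>x. h x * of_real (LINT y|M. norm (g y))"])
      show "integrable M (\<lambda>x. h x * of_real (LINT y|M. norm (g y)))" using h by simp
      have "(\<lambda>z. norm (h (fst z) * (g (snd z) * Q (fst z) (snd z)))) \<in> borel_measurable (M \<Otimes>\<^sub>M M)"
        by measurable
      then show "(\<lambda>x. LINT y|M. norm (h (fst (x, y)) * (g (snd (x, y)) * Q (fst (x, y)) (snd (x, y))))) \<in> borel_measurable M"
        by (intro borel_measurable_lebesgue_integral) (simp add: case_prod_beta')
      show "AE x in M. norm (LINT y|M. norm (h (fst (x, y)) * (g (snd (x, y)) * Q (fst (x, y)) (snd (x, y))))) \<le>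
        norm (h x * of_real (LINT y|M. norm (g y)))"
      proof (rule AE_I2)
        fix x assume x: "x \<in> space M"
        have "(LINT y|M. norm (g y * Q x y)) \<le> (LINT y|M. norm (g y))"
          using gQ[OF x] g le by (intro integral_mono integrable_norm) (auto simp: norm_mult intro!: mult_left_le)
        then have "norm (h x) * (LINT y|M. norm (g y * Q x y)) \<le> norm (h x) * \<bar>LINT y|M. norm (g y)\<bar>"
          by (intro mult_left_mono) auto
        then show "norm (LINT y|M. norm (h (fst (x, y)) * (g (snd (x, y)) * Q (fst (x, y)) (snd (x, y))))) \<le>
        norm (h x * of_real (LINT y|M. norm (g y)))"
          by (simp add: norm_mult[of "h x"] abs_mult abs_of_nonneg[OF bochner_nonneg])
      qed
    qed
    show "AE x in M. integrable M (\<lambda>y. h (fst (x, y)) * (g (snd (x, y)) * Q (fst (x, y)) (snd (x, y))))"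
      using gQ by (auto intro!: AE_I2)
  qed measurable
  then have "(LINT x|M. LINT l|M. h l * (g x * Q l x)) = (LINT l|M. LINT x|M. h l * (g x * Q l x))"
    by (intro P.Fubini_integral) (simp add: case_prod_beta')
  moreover have "(LINT x|M. LINT l|M. h l * (g x * Q l x)) = (LINT x|M. g x * (LINT l|M. h l * Q l x))"
    by (simp only: mult.left_commute[of "h _"] integral_mult_right_zero)
  ultimately show ?thesis by (simp only: integral_mult_right_zero)
qed

lemma fst_snd_dunkl_measurable [measurable]:
  "fst \<in> borel_measurable (dunkl_measure \<nu> \<Otimes>\<^sub>M dunkl_measure \<nu>')"
  "snd \<in> borel_measurable (dunkl_measure \<nu> \<Otimes>\<^sub>M dunkl_measure \<nu>')"
proof -
  have "(\<lambda>x. x) \<in> borel_measurable (dunkl_measure \<nu>)" for \<nu>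
    by (rule borel_measurable_dunklI) auto
  from measurable_compose[OF measurable_fst this] measurable_compose[OF measurable_snd this]
  show "fst \<in> borel_measurable (dunkl_measure \<nu> \<Otimes>\<^sub>M dunkl_measure \<nu>')"
    "snd \<in> borel_measurable (dunkl_measure \<nu> \<Otimes>\<^sub>M dunkl_measure \<nu>')" by auto
qed

lemma dunkl_kernel_measurable_pair:
  assumes k: "k \<ge> -1/2"
  shows "(\<lambda>z. dunkl_kernel k (fst z / b) (snd z)) \<in> borel_measurable (dunkl_measure k \<Otimes>\<^sub>M dunkl_measure k)"
proof -
  have k1: "k > -1" "k + 1 > -1" using k by auto
  note [measurable] = hyp01_measurable[OF k1(1)] hyp01_measurable[OF k1(2)]
  have [measurable]: "(of_real :: real \<Rightarrow> complex) \<in> borel_measurable borel"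
    by (auto intro!: borel_measurable_continuous_onI continuous_intros)
  have "dunkl_kernel k l x = of_real (dunkl_cos k (l * x)) - \<i> * of_real (dunkl_sin k (l * x))" for l x
    by (simp add: dunkl_kernel_eq[OF k] complex_eq_iff)
  then show ?thesis unfolding dunkl_cos_def dunkl_sin_def by simp
qed

lemma ennreal_halves: "a / 2 + a / 2 = (a :: ennreal)"
proof (cases a)
  case (real r)
  have "a / 2 = ennreal (r / 2)" using real by (simp add: divide_ennreal[symmetric])
  then show ?thesis using real by (simp add: ennreal_plus[symmetric] del: ennreal_plus)
qed (simp add: ennreal_top_divide)

text \<open>Against the weight \<open>exp (- \<epsilon> * l\<^sup>2)\<close> the bounded function
  \<open>H\<close> has an integrable square, and two applications of Fubini turn the weighted
  integral into a quadratic form in \<open>g\<close> with the heat kernel. The bound for this form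
  does not involve \<open>\<epsilon>\<close>, so Fatou's lemma removes the weight.\<close>

theorem dunkl_plancherel_le:
  fixes g :: "real \<Rightarrow> complex"
  assumes k: "k \<ge> -1/2" and b: "b \<noteq> 0" and g: "integrable (dunkl_measure k) g"
  shows "(\<integral>\<^sup>+l. ennreal ((norm (LINT x|dunkl_measure k. g x * dunkl_kernel k (l / b) x))\<^sup>2) \<partial>dunkl_measure k)
    \<le> ennreal (\<bar>b\<bar> powr (2 * (k + 1))) * (\<integral>\<^sup>+x. ennreal ((norm (g x))\<^sup>2) \<partial>dunkl_measure k)"
proof -
  have k1: "k > -1" using k by auto
  let ?M = "dunkl_measure k"
  interpret sigma_finite_measure ?M by (rule sigma_finite_dunkl[OF k1])
  interpret P: pair_sigma_finite ?M ?M ..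
  note [measurable] = borel_measurable_integrable[OF g]
  define E where "E l x = dunkl_kernel k (l / b) x" for l x
  \<comment> \<open>The scale \<open>b\<close> can be moved from \<open>l\<close> to
    \<open>x\<close>; the heat kernel then appears at the points \<open>x / b\<close> and
    \<open>y / b\<close>.\<close>
  have E_swap: "E l x = dunkl_kernel k l (x / b)" for l x
    by (simp add: E_def dunkl_kernel_eq[OF k])
  have Em [measurable]: "(\<lambda>z. E (fst z) (snd z)) \<in> borel_measurable (?M \<Otimes>\<^sub>M ?M)"
    unfolding E_def by (rule dunkl_kernel_measurable_pair[OF k])
  have E1: "norm (E l x) \<le> 1" for l x unfolding E_def by (rule norm_dunkl_kernel_le[OF k])
  have [measurable]: "cnj \<in> borel_measurable borel" "(of_real :: real \<Rightarrow> complex) \<in> borel_measurable borel"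
    by (auto intro!: borel_measurable_continuous_onI continuous_intros)
  define H where "H l = (LINT x|?M. g x * E l x)" for l
  have Hm [measurable]: "H \<in> borel_measurable ?M"
  proof -
    have "(\<lambda>z. g (snd z) * E (fst z) (snd z)) \<in> borel_measurable (?M \<Otimes>\<^sub>M ?M)" by measurable
    then show ?thesis unfolding H_def by (intro borel_measurable_lebesgue_integral) (simp add: case_prod_beta')
  qed
  have El [measurable]: "E l \<in> borel_measurable ?M" for l
    using measurable_compose[OF measurable_Pair1' Em, of l] by simp
  have El2 [measurable]: "(\<lambda>l. E l x) \<in> borel_measurable ?M" for x
    using measurable_compose[OF measurable_Pair2' Em, of x] by simp
  have HK: "norm (H l) \<le> (LINT x|?M. norm (g x))" for l
  proof -
    have "norm (H l) \<le> (LINT x|?M. norm (g x * E l x))" unfolding H_def by (rule integral_norm_bound)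
    also have "\<dots> \<le> (LINT x|?M. norm (g x))"
    proof (rule integral_mono)
      show "integrable ?M (\<lambda>x. norm (g x * E l x))"
        by (rule integrable_norm, rule integrable_dominated[OF g])
           (use E1 in \<open>auto simp: norm_mult intro!: mult_left_le\<close>)
    qed (use g E1 in \<open>auto simp: norm_mult intro!: mult_left_le\<close>)
    finally show ?thesis .
  qed
  define B where "B = ennreal (\<bar>b\<bar> powr (2 * (k + 1)))"
  define G2 where "G2 = (\<integral>\<^sup>+x. ennreal ((norm (g x))\<^sup>2) \<partial>?M)"
  have main: "(\<integral>\<^sup>+l. ennreal (exp (- \<epsilon> * l\<^sup>2) * (norm (H l))\<^sup>2) \<partial>?M) \<le> B * G2" if \<epsilon>: "\<epsilon> > 0" for \<epsilon>
  proof -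
    define w :: "real \<Rightarrow> complex" where "w l = of_real (exp (- \<epsilon> * l\<^sup>2))" for l
    define K where "K x y = heat k \<epsilon> (x / b) (y / b)" for x y
    have wi: "integrable ?M w"
      unfolding w_def by (intro integrable_of_real gaussian_integrable k1 \<epsilon>)
    note [measurable] = borel_measurable_integrable[OF wi]
    have K0: "K x y \<ge> 0" for x y unfolding K_def by (rule heat_nonneg[OF k])
    have Ksym: "K x y = K y x" for x y unfolding K_def by (rule heat_sym)
    have Kint: "(\<integral>\<^sup>+y. ennreal (K x y) \<partial>?M) = B" for x
      unfolding K_def B_def by (rule heat_nn_integral[OF k \<epsilon> b])
    have Kw: "(LINT l|?M. (w l * E l x) * cnj (E l y)) = of_real (K x y)" for x y
      using heat_kernel_integral[OF k \<epsilon>, of "x / b" "y / b"] by (simp add: w_def K_def E_swap mult.assoc)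
    have Km [measurable]: "(\<lambda>z. K (fst z) (snd z)) \<in> borel_measurable (?M \<Otimes>\<^sub>M ?M)"
    proof -
      have "k + 1 > -1" using k by simp
      note [measurable] = hyp01_measurable[OF k1] hyp01_measurable[OF this]
      show ?thesis unfolding K_def heat_def by measurable
    qed
    \<comment> \<open>Schur's test in symmetric form: \<open>norm (g x) * norm (g y)\<close> is at
      most the mean of the two squares. By symmetry of \<open>K\<close> and Tonelli the terms
      \<open>?U\<close> and \<open>?V\<close> have equal double integrals, each being half of
      \<open>B * G2\<close>.\<close>
    let ?U = "\<lambda>x y. ennreal ((norm (g x))\<^sup>2 / 2 * K x y)" and ?V = "\<lambda>x y. ennreal ((norm (g y))\<^sup>2 / 2 * K x y)"
    have hi: "integrable ?M (\<lambda>l. w l * cnj (H l))"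
    proof (rule integrable_dominated[where f = "\<lambda>l. w l * of_real (LINT x|?M. norm (g x))"])
      show "integrable ?M (\<lambda>l. w l * of_real (LINT x|?M. norm (g x)))" using wi by simp
      show "AE l in ?M. norm (w l * cnj (H l)) \<le> norm (w l * of_real (LINT x|?M. norm (g x)))"
        using HK by (auto simp: norm_mult intro!: mult_left_mono order_trans[OF _ abs_ge_self])
    qed measurable
    \<comment> \<open>The inner use of Fubini: \<open>cnj (H l)\<close> is expanded and the
      integration over \<open>l\<close> produces the heat kernel. The outer use, which follows,
      expands the remaining \<open>H l\<close>.\<close>
    have step2: "(LINT l|?M. w l * cnj (H l) * E l x) = (LINT y|?M. cnj (g y) * of_real (K x y))" for x
    proof -
      have cH: "cnj (H l) = (LINT y|?M. cnj (g y) * cnj (E l y))" for l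
        unfolding H_def Bochner_Integration.integral_cnj[symmetric] by (simp only: complex_cnj_mult)
      have "(LINT l|?M. w l * cnj (H l) * E l x) = (LINT l|?M. (w l * E l x) * (LINT y|?M. cnj (g y) * cnj (E l y)))"
        unfolding cH[symmetric] by (simp only: mult_ac)
      also have "\<dots> = (LINT y|?M. cnj (g y) * (LINT l|?M. (w l * E l x) * cnj (E l y)))"
      proof (rule fubini_bounded_kernel)
        show "integrable ?M (\<lambda>y. cnj (g y))" using g by simp
        show "integrable ?M (\<lambda>l. w l * E l x)"
          by (rule integrable_dominated[OF wi]) (use E1 in \<open>auto simp: norm_mult intro!: mult_left_le\<close>)
        show "(\<lambda>z. cnj (E (fst z) (snd z))) \<in> borel_measurable (?M \<Otimes>\<^sub>M ?M)" by measurable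
      qed (simp add: E1)
      finally show ?thesis by (simp add: Kw)
    qed
    have "(LINT l|?M. w l * cnj (H l) * H l) = (LINT l|?M. w l * cnj (H l) * (LINT x|?M. g x * E l x))"
      by (simp only: H_def)
    also have "\<dots> = (LINT x|?M. g x * (LINT l|?M. w l * cnj (H l) * E l x))"
      by (rule fubini_bounded_kernel[OF g hi Em E1])
    also have "\<dots> = (LINT x|?M. g x * (LINT y|?M. cnj (g y) * of_real (K x y)))" by (simp add: step2)
    finally have I: "(LINT l|?M. w l * cnj (H l) * H l) = (LINT x|?M. g x * (LINT y|?M. cnj (g y) * of_real (K x y)))" .
    have wH: "w l * cnj (H l) * H l = of_real (exp (- \<epsilon> * l\<^sup>2) * (norm (H l))\<^sup>2)" for l
      unfolding w_def of_real_mult complex_norm_square by (simp only: mult_ac)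
    have iwH: "integrable ?M (\<lambda>l. exp (- \<epsilon> * l\<^sup>2) * (norm (H l))\<^sup>2)"
    proof (rule integrable_dominated[where f = "\<lambda>l. exp (- \<epsilon> * l\<^sup>2) * (LINT x|?M. norm (g x))\<^sup>2"])
      show "integrable ?M (\<lambda>l. exp (- \<epsilon> * l\<^sup>2) * (LINT x|?M. norm (g x))\<^sup>2)"
        using gaussian_integrable[OF k1 \<epsilon>] by simp
      have [measurable]: "(\<lambda>l. exp (- \<epsilon> * l\<^sup>2)) \<in> borel_measurable ?M" by (rule borel_measurable_dunklI) auto
      show "(\<lambda>l. exp (- \<epsilon> * l\<^sup>2) * (norm (H l))\<^sup>2) \<in> borel_measurable ?M" by measurable
      show "AE l in ?M. norm (exp (- \<epsilon> * l\<^sup>2) * (norm (H l))\<^sup>2) \<le> norm (exp (- \<epsilon> * l\<^sup>2) * (LINT x|?M. norm (g x))\<^sup>2)"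
      proof (rule AE_I2)
        fix l
        have "(norm (H l))\<^sup>2 \<le> (LINT x|?M. norm (g x))\<^sup>2" by (rule power_mono[OF HK]) simp
        then show "norm (exp (- \<epsilon> * l\<^sup>2) * (norm (H l))\<^sup>2) \<le> norm (exp (- \<epsilon> * l\<^sup>2) * (LINT x|?M. norm (g x))\<^sup>2)"
          by (simp only: norm_mult) (intro mult_left_mono, auto)
      qed
    qed
    have "(\<integral>\<^sup>+l. ennreal (exp (- \<epsilon> * l\<^sup>2) * (norm (H l))\<^sup>2) \<partial>?M) = ennreal (LINT l|?M. exp (- \<epsilon> * l\<^sup>2) * (norm (H l))\<^sup>2)"
      by (rule nn_integral_eq_integral[OF iwH]) simp
    also have "\<dots> \<le> ennreal (norm (LINT l|?M. w l * cnj (H l) * H l))"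
    proof -
      have "(LINT l|?M. w l * cnj (H l) * H l) = of_real (LINT l|?M. exp (- \<epsilon> * l\<^sup>2) * (norm (H l))\<^sup>2)"
        unfolding wH by (rule Bochner_Integration.integral_of_real[OF iwH])
      then show ?thesis by (simp only: norm_of_real) (intro ennreal_leI abs_ge_self)
    qed
    also have "\<dots> \<le> (\<integral>\<^sup>+x. ennreal (norm (g x * (LINT y|?M. cnj (g y) * of_real (K x y)))) \<partial>?M)"
      unfolding I by (rule norm_integral_le_nn_integral)
    also have "\<dots> \<le> (\<integral>\<^sup>+x. (\<integral>\<^sup>+y. ?U x y + ?V x y \<partial>?M) \<partial>?M)"
    proof (rule nn_integral_mono)
      fix x
      have [measurable]: "K x \<in> borel_measurable ?M"
        using measurable_compose[OF measurable_Pair1' Km, of x] by simp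
      have "ennreal (norm (g x * (LINT y|?M. cnj (g y) * of_real (K x y)))) \<le>
         ennreal (norm (g x)) * (\<integral>\<^sup>+y. ennreal (norm (cnj (g y) * of_real (K x y))) \<partial>?M)"
        by (simp only: norm_mult[of "g x"] ennreal_mult'[OF norm_ge_zero, of "g x"])
           (intro mult_left_mono norm_integral_le_nn_integral zero_le)
      also have "\<dots> = (\<integral>\<^sup>+y. ennreal (norm (g x)) * ennreal (norm (cnj (g y) * of_real (K x y))) \<partial>?M)"
        by (rule nn_integral_cmult[symmetric]) measurable
      also have "\<dots> \<le> (\<integral>\<^sup>+y. ?U x y + ?V x y \<partial>?M)"
      proof (rule nn_integral_mono)
        fix y
        have "norm (g x) * (norm (g y) * K x y) \<le> ((norm (g x))\<^sup>2 + (norm (g y))\<^sup>2) / 2 * K x y"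
          using mult_right_mono[OF sum_squares_bound[of "norm (g x)" "norm (g y)"] K0[of x y]] by simp
        then have "ennreal (norm (g x) * (norm (g y) * K x y)) \<le> ennreal ((norm (g x))\<^sup>2 / 2 * K x y + (norm (g y))\<^sup>2 / 2 * K x y)"
          by (intro ennreal_leI) (simp add: algebra_simps add_divide_distrib)
        then show "ennreal (norm (g x)) * ennreal (norm (cnj (g y) * of_real (K x y))) \<le>
          ?U x y + ?V x y"
          using K0[of x y] by (simp add: norm_mult ennreal_mult'[symmetric])
      qed
      finally show "ennreal (norm (g x * (LINT y|?M. cnj (g y) * of_real (K x y)))) \<le>
        (\<integral>\<^sup>+y. ?U x y + ?V x y \<partial>?M)" .
    qed
    also have "\<dots> = (\<integral>\<^sup>+x. (\<integral>\<^sup>+y. ?U x y \<partial>?M) \<partial>?M) +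
        (\<integral>\<^sup>+x. (\<integral>\<^sup>+y. ?V x y \<partial>?M) \<partial>?M)"
    proof -
      have Kx [measurable]: "K x \<in> borel_measurable ?M" for x
        using measurable_compose[OF measurable_Pair1' Km, of x] by simp
      have [measurable]: "(\<lambda>x. \<integral>\<^sup>+y. ?U x y \<partial>?M) \<in> borel_measurable ?M"
        "(\<lambda>x. \<integral>\<^sup>+y. ?V x y \<partial>?M) \<in> borel_measurable ?M"
      proof -
        have "(\<lambda>z. ennreal ((norm (g (fst z)))\<^sup>2 / 2 * K (fst z) (snd z))) \<in> borel_measurable (?M \<Otimes>\<^sub>M ?M)"
          "(\<lambda>z. ennreal ((norm (g (snd z)))\<^sup>2 / 2 * K (fst z) (snd z))) \<in> borel_measurable (?M \<Otimes>\<^sub>M ?M)"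
          by measurable
        then show "(\<lambda>x. \<integral>\<^sup>+y. ?U x y \<partial>?M) \<in> borel_measurable ?M"
        "(\<lambda>x. \<integral>\<^sup>+y. ?V x y \<partial>?M) \<in> borel_measurable ?M"
          using borel_measurable_nn_integral_fst by fastforce+
      qed
      show ?thesis
      proof -
        have "(\<integral>\<^sup>+y. ?U x y + ?V x y \<partial>?M) =
          (\<integral>\<^sup>+y. ?U x y \<partial>?M) + (\<integral>\<^sup>+y. ?V x y \<partial>?M)" for x
          by (rule nn_integral_add) measurable
        then show ?thesis
          by (simp only:) (rule nn_integral_add; measurable)
      qed
    qed
    also have "(\<integral>\<^sup>+x. (\<integral>\<^sup>+y. ?V x y \<partial>?M) \<partial>?M) =
      (\<integral>\<^sup>+y. (\<integral>\<^sup>+x. ?V x y \<partial>?M) \<partial>?M)"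
    proof (rule P.Fubini'[symmetric])
      have "(\<lambda>z. ennreal ((norm (g (snd z)))\<^sup>2 / 2 * K (fst z) (snd z))) \<in> borel_measurable (?M \<Otimes>\<^sub>M ?M)"
        by measurable
      then show "(\<lambda>(x, y). ?V x y) \<in> borel_measurable (?M \<Otimes>\<^sub>M ?M)"
        by (simp add: case_prod_beta')
    qed
    also have "(\<integral>\<^sup>+y. (\<integral>\<^sup>+x. ?V x y \<partial>?M) \<partial>?M) =
      (\<integral>\<^sup>+y. (\<integral>\<^sup>+x. ?U y x \<partial>?M) \<partial>?M)"
      by (intro nn_integral_cong) (simp only: Ksym)
    also have "(\<integral>\<^sup>+x. (\<integral>\<^sup>+y. ?U x y \<partial>?M) \<partial>?M) = B * G2 / 2"
    proof -
      have "(\<integral>\<^sup>+y. ?U x y \<partial>?M) = ennreal ((norm (g x))\<^sup>2) * (B / 2)" for x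
      proof -
        have [measurable]: "K x \<in> borel_measurable ?M"
          using measurable_compose[OF measurable_Pair1' Km, of x] by simp
        have "(\<integral>\<^sup>+y. ?U x y \<partial>?M) = (\<integral>\<^sup>+y. ennreal ((norm (g x))\<^sup>2 / 2) * ennreal (K x y) \<partial>?M)"
          by (intro nn_integral_cong ennreal_mult') simp
        also have "\<dots> = ennreal ((norm (g x))\<^sup>2 / 2) * B"
          unfolding Kint[of x, symmetric] by (rule nn_integral_cmult) measurable
        also have "ennreal ((norm (g x))\<^sup>2 / 2) = ennreal ((norm (g x))\<^sup>2) / 2"
          by (simp add: divide_ennreal[symmetric])
        finally show ?thesis unfolding divide_ennreal_def by (simp only: mult_ac)
      qed
      then have "(\<integral>\<^sup>+x. (\<integral>\<^sup>+y. ?U x y \<partial>?M) \<partial>?M) = (\<integral>\<^sup>+x. ennreal ((norm (g x))\<^sup>2) * (B / 2) \<partial>?M)"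
        by simp
      also have "\<dots> = G2 * (B / 2)" unfolding G2_def by (rule nn_integral_multc) measurable
      finally show ?thesis unfolding divide_ennreal_def by (simp only: mult_ac)
    qed
    also have "B * G2 / 2 + B * G2 / 2 = B * G2" by (rule ennreal_halves)
    finally show ?thesis .
  qed
  have [measurable]: "(\<lambda>l. exp (- (1 / real (Suc n)) * l\<^sup>2)) \<in> borel_measurable ?M" for n
    by (rule borel_measurable_dunklI) auto
  have "(\<integral>\<^sup>+l. ennreal ((norm (H l))\<^sup>2) \<partial>?M) =
      (\<integral>\<^sup>+l. liminf (\<lambda>n. ennreal (exp (- (1 / real (Suc n)) * l\<^sup>2) * (norm (H l))\<^sup>2)) \<partial>?M)"
  proof (rule nn_integral_cong)
    fix l
    have "(\<lambda>n. exp (- (1 / real (Suc n)) * l\<^sup>2) * (norm (H l))\<^sup>2) \<longlonglongrightarrow> exp (- 0 * l\<^sup>2) * (norm (H l))\<^sup>2"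
      by (intro tendsto_intros LIMSEQ_Suc lim_1_over_n)
    then show "ennreal ((norm (H l))\<^sup>2) = liminf (\<lambda>n. ennreal (exp (- (1 / real (Suc n)) * l\<^sup>2) * (norm (H l))\<^sup>2))"
      by (intro lim_imp_Liminf[symmetric] tendsto_ennrealI) simp_all
  qed
  also have "\<dots> \<le> liminf (\<lambda>n. \<integral>\<^sup>+l. ennreal (exp (- (1 / real (Suc n)) * l\<^sup>2) * (norm (H l))\<^sup>2) \<partial>?M)"
    by (rule nn_integral_liminf) measurable
  also have "\<dots> \<le> liminf (\<lambda>n. B * G2)"
    by (intro Liminf_mono always_eventually allI main) simp
  also have "\<dots> = B * G2" by (simp add: Liminf_const)
  finally show ?thesis by (simp add: H_def E_def B_def G2_def)
qed

section \<open>Convergence in the mean\<close>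

abbreviation powint :: "'a measure \<Rightarrow> real \<Rightarrow> ('a \<Rightarrow> complex) \<Rightarrow> ennreal" where
  "powint M p f \<equiv> \<integral>\<^sup>+x. ennreal (norm (f x) powr p) \<partial>M"

text \<open>Summability of the integrals of \<open>(2^j G_j)^q\<close> makes \<open>2^j G_j\<close> bounded almost everywhere; this replaces
  the usual appeal to Minkowski's inequality.\<close>

lemma AE_summable_of_fast_decay:
  fixes G :: "nat \<Rightarrow> 'a \<Rightarrow> real"
  assumes [measurable]: "\<And>j. G j \<in> borel_measurable M" and G0: "\<And>j x. G j x \<ge> 0" and q: "q > 0"
    and le: "\<And>j. (\<integral>\<^sup>+x. ennreal (G j x powr q) \<partial>M) \<le> ennreal ((4 powr (- q)) ^ j)"
  shows "AE x in M. summable (\<lambda>j. G j x)"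
proof -
  \<comment> \<open>The ratio that survives when the decay \<open>4 powr (- q)\<close> is weighted
    with \<open>2 powr q\<close>.\<close>
  define a where "a = (2::real) powr (- q)"
  have a: "0 < a" "a < 1" using q by (auto simp: a_def powr_less_one)
  have "(\<integral>\<^sup>+x. (\<Sum>j. ennreal ((2 ^ j * G j x) powr q)) \<partial>M) = (\<Sum>j. \<integral>\<^sup>+x. ennreal ((2 ^ j * G j x) powr q) \<partial>M)"
    by (rule nn_integral_suminf) measurable
  also have "\<dots> \<le> (\<Sum>j. ennreal (a ^ j))"
  proof (rule suminf_le)
    fix j
    have "(\<integral>\<^sup>+x. ennreal ((2 ^ j * G j x) powr q) \<partial>M) = (\<integral>\<^sup>+x. ennreal ((2 ^ j) powr q) * ennreal (G j x powr q) \<partial>M)"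
      using G0 by (intro nn_integral_cong) (simp add: powr_mult ennreal_mult')
    also have "\<dots> = ennreal ((2 ^ j) powr q) * (\<integral>\<^sup>+x. ennreal (G j x powr q) \<partial>M)"
      by (rule nn_integral_cmult) measurable
    also have "\<dots> \<le> ennreal ((2 ^ j) powr q) * ennreal ((4 powr (- q)) ^ j)"
      by (intro mult_left_mono le) simp
    also have "\<dots> = ennreal (a ^ j)"
    proof -
      have "(4::real) powr (- q) = 2 powr (- q) * 2 powr (- q)"
        using powr_mult[of 2 2 "- q"] by simp
      moreover have "((2::real) ^ j) powr q = (2 powr q) ^ j"
        by (simp add: powr_powr powr_realpow[symmetric] mult.commute)
      moreover have "(2::real) powr q * (2 powr (- q) * 2 powr (- q)) = a"
        by (simp add: a_def mult.assoc[symmetric] powr_add[symmetric])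
      ultimately show ?thesis
        by (simp add: ennreal_mult'[symmetric] power_mult_distrib[symmetric])
    qed
    finally show "(\<integral>\<^sup>+x. ennreal ((2 ^ j * G j x) powr q) \<partial>M) \<le> ennreal (a ^ j)" .
  qed auto
  also have "\<dots> = ennreal (\<Sum>j. a ^ j)"
    using a by (intro suminf_ennreal2) (auto intro: summable_geometric)
  also have "\<dots> < \<infinity>" by simp
  finally have "(\<integral>\<^sup>+x. (\<Sum>j. ennreal ((2 ^ j * G j x) powr q)) \<partial>M) \<noteq> \<infinity>" by simp
  then have "AE x in M. (\<Sum>j. ennreal ((2 ^ j * G j x) powr q)) \<noteq> \<infinity>"
    by (intro nn_integral_PInf_AE) measurable
  then show ?thesis
  proof eventually_elim
    case (elim x)
    have term_le: "F j \<le> (\<Sum>j. F j)" for F :: "nat \<Rightarrow> ennreal" and j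
      using sum_le_suminf[of F "{j}"] by simp
    define s where "s = enn2real (\<Sum>j. ennreal ((2 ^ j * G j x) powr q))"
    have s: "s \<ge> 0" "(\<Sum>j. ennreal ((2 ^ j * G j x) powr q)) = ennreal s"
      using elim by (auto simp: s_def less_top)
    have le: "G j x \<le> s powr (1 / q) * (1 / 2) ^ j" for j
    proof -
      have "ennreal ((2 ^ j * G j x) powr q) \<le> (\<Sum>j. ennreal ((2 ^ j * G j x) powr q))"
        by (rule term_le)
      then have "(2 ^ j * G j x) powr q \<le> s" unfolding s(2) by (simp only: ennreal_le_iff[OF s(1)])
      then have "((2 ^ j * G j x) powr q) powr (1 / q) \<le> s powr (1 / q)" using q by (intro powr_mono2) auto
      then have "2 ^ j * G j x \<le> s powr (1 / q)" using q G0[of j x] by (simp add: powr_powr)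
      then have "G j x \<le> s powr (1 / q) / 2 ^ j" by (simp add: pos_le_divide_eq mult.commute)
      then show ?thesis by (simp add: power_one_over)
    qed
    have "summable (\<lambda>j. s powr (1 / q) * (1 / 2) ^ j)" by (intro summable_mult summable_geometric) simp
    then show ?case
      by (rule summable_comparison_test'[where N = 0]) (use G0 le in simp)
  qed
qed

lemma nn_integral_powr_fatou:
  fixes u :: "nat \<Rightarrow> 'a \<Rightarrow> complex"
  assumes [measurable]: "\<And>n. u n \<in> borel_measurable M" and q: "q > 0"
    and ae: "AE x in M. (\<lambda>n. u n x) \<longlonglongrightarrow> h x"
    and le: "\<forall>\<^sub>F n in sequentially. (powint M q (\<lambda>x. u n x)) \<le> c"
  shows "powint M q h \<le> c"
proof -
  have "powint M q h = (\<integral>\<^sup>+x. liminf (\<lambda>n. ennreal (norm (u n x) powr q)) \<partial>M)"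
  proof (rule nn_integral_cong_AE, use ae in eventually_elim)
    fix x assume "(\<lambda>n. u n x) \<longlonglongrightarrow> h x"
    then have "(\<lambda>n. ennreal (norm (u n x) powr q)) \<longlonglongrightarrow> ennreal (norm (h x) powr q)"
      using q by (intro tendsto_ennrealI tendsto_powr' tendsto_norm tendsto_const) auto
    then show "ennreal (norm (h x) powr q) = liminf (\<lambda>n. ennreal (norm (u n x) powr q))"
      by (intro lim_imp_Liminf[symmetric]) simp_all
  qed
  also have "\<dots> \<le> liminf (\<lambda>n. powint M q (\<lambda>x. u n x))"
    by (rule nn_integral_liminf) measurable
  also have "\<dots> \<le> liminf (\<lambda>n. c)" by (rule Liminf_mono) (rule le)
  also have "\<dots> = c" by (simp add: Liminf_const)
  finally show ?thesis .
qed

lemma ex_strict_mono_choice: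
  fixes P :: "nat \<Rightarrow> nat \<Rightarrow> bool"
  assumes "\<And>m j. \<exists>n>m. P j n"
  obtains r where "strict_mono r" "\<And>j. P j (r j)"
proof -
  obtain f where f: "\<And>m j. f m j > m \<and> P j (f m j)" using assms by metis
  define r where "r = rec_nat (f 0 0) (\<lambda>j m. f m (Suc j))"
  have "strict_mono r" using f by (simp add: strict_mono_Suc_iff r_def)
  moreover have "P j (r j)" for j using f by (cases j) (simp_all add: r_def)
  ultimately show ?thesis using that by blast
qed

text \<open>Along a subsequence whose errors decay geometrically, the pointwise errors are summable
  almost everywhere and hence tend to 0.\<close>

lemma Lp_tendsto_AE_subseq:
  fixes u :: "nat \<Rightarrow> 'a \<Rightarrow> complex"
  assumes [measurable]: "\<And>n. u n \<in> borel_measurable M" "h \<in> borel_measurable M" and q: "q > 0"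
    and lim: "(\<lambda>n. powint M q (\<lambda>x. h x - u n x)) \<longlonglongrightarrow> 0"
  obtains r where "strict_mono r" "AE x in M. (\<lambda>n. u (r n) x) \<longlonglongrightarrow> h x"
proof -
  have ex: "\<exists>n>m. (powint M q (\<lambda>x. h x - u n x)) \<le> ennreal ((4 powr (- q)) ^ j)" for m j :: nat
  proof -
    have "\<forall>\<^sub>F n in sequentially. (powint M q (\<lambda>x. h x - u n x)) < ennreal ((4 powr (- q)) ^ j)"
      using order_tendstoD(2)[OF lim, of "ennreal ((4 powr (- q)) ^ j)"] by simp
    from eventually_conj[OF this eventually_gt_at_top[of m]] show ?thesis
      unfolding eventually_sequentially by (meson less_imp_le order_refl)
  qed
  obtain r where sm: "strict_mono r"
    and r: "\<And>j. (powint M q (\<lambda>x. h x - u (r j) x)) \<le> ennreal ((4 powr (- q)) ^ j)"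
    using ex_strict_mono_choice[where P = "\<lambda>j n. (powint M q (\<lambda>x. h x - u n x)) \<le> ennreal ((4 powr (- q)) ^ j)", OF ex]
    by blast
  have "AE x in M. summable (\<lambda>j. norm (h x - u (r j) x))"
    by (rule AE_summable_of_fast_decay[OF _ _ q r]) auto
  then have "AE x in M. (\<lambda>n. u (r n) x) \<longlonglongrightarrow> h x"
  proof eventually_elim
    case (elim x)
    then have "(\<lambda>j. norm (h x - u (r j) x)) \<longlonglongrightarrow> 0" by (rule summable_LIMSEQ_zero)
    then have "(\<lambda>j. h x - u (r j) x) \<longlonglongrightarrow> 0" by (rule tendsto_norm_zero_cancel)
    then have "(\<lambda>j. h x - (h x - u (r j) x)) \<longlonglongrightarrow> h x - 0" by (intro tendsto_intros)
    then show ?case by simp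
  qed
  with sm show ?thesis using that by blast
qed

lemma tendsto_0_if_eventually_le_ennreal:
  fixes f :: "nat \<Rightarrow> ennreal"
  assumes "\<And>e::real. e > 0 \<Longrightarrow> \<forall>\<^sub>F n in sequentially. f n \<le> ennreal e"
  shows "f \<longlonglongrightarrow> 0"
proof (rule order_tendstoI)
  fix a :: ennreal assume "0 < a"
  then obtain b where b: "0 < b" "b < a" using dense by blast
  then obtain e where e: "b = ennreal e" "e > 0"
    by (cases b) (auto simp: top_unique)
  from assms[OF e(2)] show "\<forall>\<^sub>F n in sequentially. f n < a"
    by eventually_elim (use b e in auto)
qed simp

text \<open>A subsequence with geometrically decaying increments telescopes to an almost everywhere
  limit. Fatou along this subsequence, with the other index fixed, gives convergence of the whole
  sequence. Working with integrals of \<open>q\<close>-th powers avoids any triangle inequality for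
  norms.\<close>

lemma riesz_fischer:
  fixes u :: "nat \<Rightarrow> 'a \<Rightarrow> complex"
  assumes [measurable]: "\<And>n. u n \<in> borel_measurable M" and q: "q > 0"
    and cauchy: "\<And>e. e > 0 \<Longrightarrow> \<exists>N. \<forall>m\<ge>N. \<forall>n\<ge>N. (powint M q (\<lambda>x. u m x - u n x)) \<le> ennreal e"
  obtains h where "h \<in> borel_measurable M" "(\<lambda>n. powint M q (\<lambda>x. h x - u n x)) \<longlonglongrightarrow> 0"
proof -
  define J where "J m n = (powint M q (\<lambda>x. u m x - u n x))" for m n
  have ex: "\<exists>n>m. \<forall>i\<ge>n. \<forall>l\<ge>n. J i l \<le> ennreal ((4 powr (- q)) ^ j)" for m j :: nat
  proof -
    have "(4 powr (- q)) ^ j > (0::real)" by simp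
    from cauchy[OF this] obtain N where "\<forall>m\<ge>N. \<forall>n\<ge>N. J m n \<le> ennreal ((4 powr (- q)) ^ j)"
      unfolding J_def by blast
    then show ?thesis by (intro exI[of _ "max N (Suc m)"]) auto
  qed
  obtain r where sm: "strict_mono r" and r: "\<And>j. \<forall>i\<ge>r j. \<forall>l\<ge>r j. J i l \<le> ennreal ((4 powr (- q)) ^ j)"
    using ex_strict_mono_choice[where P = "\<lambda>j n. \<forall>i\<ge>n. \<forall>l\<ge>n. J i l \<le> ennreal ((4 powr (- q)) ^ j)", OF ex]
    by blast
  \<comment> \<open>Where the sequence diverges, \<open>lim\<close> has some unspecified value;
    \<open>h\<close> is measurable all the same, and the divergence set turns out to be
    null.\<close>
  define h where "h x = lim (\<lambda>j. u (r j) x)" for x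
  have hm [measurable]: "h \<in> borel_measurable M" unfolding h_def by (rule borel_measurable_lim_metric) measurable
  have "AE x in M. summable (\<lambda>j. norm (u (r (Suc j)) x - u (r j) x))"
  proof (rule AE_summable_of_fast_decay[OF _ _ q])
    show "(powint M q (\<lambda>x. u (r (Suc j)) x - u (r j) x)) \<le> ennreal ((4 powr (- q)) ^ j)" for j
      using r[of j] strict_monoD[OF sm, of j "Suc j"] unfolding J_def by auto
  qed auto
  then have ae: "AE x in M. (\<lambda>j. u (r j) x) \<longlonglongrightarrow> h x"
  proof eventually_elim
    case (elim x)
    then have "summable (\<lambda>j. u (r (Suc j)) x - u (r j) x)" by (rule summable_norm_cancel)
    then have "convergent (\<lambda>n. \<Sum>j<n. u (r (Suc j)) x - u (r j) x)"
      by (simp add: summable_iff_convergent)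
    then have "convergent (\<lambda>n. u (r n) x - u (r 0) x)" by (simp add: sum_lessThan_telescope[of "\<lambda>n. u (r n) x"])
    then have "convergent (\<lambda>n. (u (r n) x - u (r 0) x) + u (r 0) x)"
      by (intro convergent_add convergent_const)
    then show ?case by (simp add: h_def convergent_LIMSEQ_iff)
  qed
  have "(\<lambda>n. powint M q (\<lambda>x. h x - u n x)) \<longlonglongrightarrow> 0"
  proof (rule tendsto_0_if_eventually_le_ennreal)
    fix e :: real assume "e > 0"
    from cauchy[OF this] obtain N where N: "\<forall>m\<ge>N. \<forall>n\<ge>N. J m n \<le> ennreal e" unfolding J_def by blast
    have "(powint M q (\<lambda>x. h x - u n x)) \<le> ennreal e" if n: "n \<ge> N" for n
    proof (rule nn_integral_powr_fatou[OF _ q])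
      show "AE x in M. (\<lambda>j. u (r j) x - u n x) \<longlonglongrightarrow> h x - u n x"
        using ae by eventually_elim (intro tendsto_intros)
      have "J (r j) n \<le> ennreal e" if "j \<ge> N" for j
        using N n that seq_suble[OF sm, of j] by auto
      then show "\<forall>\<^sub>F j in sequentially. (powint M q (\<lambda>x. u (r j) x - u n x)) \<le> ennreal e"
        unfolding J_def eventually_sequentially by blast
    qed measurable
    then show "\<forall>\<^sub>F n in sequentially. (powint M q (\<lambda>x. h x - u n x)) \<le> ennreal e"
      unfolding eventually_sequentially by blast
  qed
  then show ?thesis using that hm by blast
qed

text \<open>The larger of the two norms controls the sum. The constant is crude, but it only serves
  to derive finiteness and convergence to 0.\<close>

lemma norm_add_powr_le:
  fixes a b :: "'a::real_normed_vector"
  assumes "q > 0"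
  shows "norm (a + b) powr q \<le> 2 powr q * (norm a powr q + norm b powr q)"
proof -
  have "norm (a + b) powr q \<le> (2 * max (norm a) (norm b)) powr q"
    using assms norm_triangle_ineq[of a b] by (intro powr_mono2) auto
  also have "\<dots> = 2 powr q * max (norm a) (norm b) powr q" by (simp add: powr_mult)
  also have "max (norm a) (norm b) powr q \<le> norm a powr q + norm b powr q"
    by (auto simp: max_def)
  finally show ?thesis by simp
qed

lemma nn_integral_norm_add_powr_le:
  fixes f g :: "'a \<Rightarrow> complex"
  assumes q: "q > 0" and [measurable]: "f \<in> borel_measurable M" "g \<in> borel_measurable M"
  shows "(powint M q (\<lambda>x. f x + g x)) \<le>
    ennreal (2 powr q) * ((powint M q f) + (powint M q g))"
proof -
  have "(powint M q (\<lambda>x. f x + g x)) \<le>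
     (\<integral>\<^sup>+x. ennreal (2 powr q) * (ennreal (norm (f x) powr q) + ennreal (norm (g x) powr q)) \<partial>M)"
    using norm_add_powr_le[OF q]
    by (intro nn_integral_mono) (auto simp: ennreal_mult'[symmetric] ennreal_plus[symmetric] simp del: ennreal_plus intro!: ennreal_leI)
  also have "\<dots> = ennreal (2 powr q) * ((powint M q f) + (powint M q g))"
    by (simp add: nn_integral_cmult nn_integral_add)
  finally show ?thesis .
qed

lemma Lp_limit_unique:
  fixes u :: "nat \<Rightarrow> 'a \<Rightarrow> complex"
  assumes [measurable]: "\<And>n. u n \<in> borel_measurable M" "h \<in> borel_measurable M" "h' \<in> borel_measurable M"
    and q: "q > 0"
    and lim: "(\<lambda>n. powint M q (\<lambda>x. h x - u n x)) \<longlonglongrightarrow> 0"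
    and lim': "(\<lambda>n. powint M q (\<lambda>x. h' x - u n x)) \<longlonglongrightarrow> 0"
  shows "AE x in M. h x = h' x"
proof -
  obtain r where r: "strict_mono r" "AE x in M. (\<lambda>n. u (r n) x) \<longlonglongrightarrow> h x"
    using Lp_tendsto_AE_subseq[OF _ _ q lim] by auto
  have "(\<lambda>n. powint M q (\<lambda>x. h' x - u (r n) x)) \<longlonglongrightarrow> 0"
    using LIMSEQ_subseq_LIMSEQ[OF lim' r(1)] by (simp add: o_def)
  then obtain s where s: "strict_mono s" "AE x in M. (\<lambda>n. u (r (s n)) x) \<longlonglongrightarrow> h' x"
    by (rule Lp_tendsto_AE_subseq[of "\<lambda>n. u (r n)" M h', rotated 3]) (use q in auto)
  from r(2) s(2) show ?thesis
  proof eventually_elim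
    case (elim x)
    have "(\<lambda>n. u (r (s n)) x) \<longlonglongrightarrow> h x"
      using LIMSEQ_subseq_LIMSEQ[OF elim(1) s(1)] by (simp add: o_def)
    then show ?case using elim(2) LIMSEQ_unique by blast
  qed
qed

section \<open>Concentration and Hoelder's inequality\<close>

lemma nn_integral_powr_split:
  fixes f :: "'a \<Rightarrow> complex"
  assumes [measurable]: "f \<in> borel_measurable M" "E \<in> sets M"
  shows "(powint M p f) =
    (powint M p (\<lambda>x. f x - indicator E x * f x)) + (powint M p (\<lambda>x. indicator E x * f x))"
  by (subst nn_integral_add[symmetric]) (auto intro!: nn_integral_cong simp: indicator_def)

text \<open>Takes the place of Minkowski's inequality for the parts of \<open>f\<close> on
  \<open>E\<close> and off \<open>E\<close>: their supports are disjoint, so the integrals of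
  \<open>p\<close>-th powers add up exactly.\<close>

lemma powr_superadditive:
  fixes x y p :: real
  assumes "x \<ge> 0" "y \<ge> 0" "p \<ge> 1"
  shows "x powr p + y powr p \<le> (x + y) powr p"
proof -
  have le: "x powr p \<le> x * (x + y) powr (p - 1)" if "x \<ge> 0" "y \<ge> 0" for x y
  proof (cases "x = 0")
    case False
    have "x powr p = x * x powr (p - 1)" using powr_add[of x 1 "p - 1"] that False by simp
    also have "\<dots> \<le> x * (x + y) powr (p - 1)" using that assms by (intro mult_left_mono powr_mono2) auto
    finally show ?thesis .
  qed simp
  have "x powr p + y powr p \<le> x * (x + y) powr (p - 1) + y * (x + y) powr (p - 1)"
    using le[of x y] le[of y x] assms by (simp add: add.commute)
  also have "\<dots> = (x + y) powr p"
    using assms powr_add[of "x + y" 1 "p - 1"] by (cases "x + y = 0") (auto simp: distrib_right[symmetric])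
  finally show ?thesis .
qed

section \<open>Norms with values in [0, \<infinity>] and restriction to a set\<close>

lemma enn_powr_ennreal: "a \<ge> 0 \<Longrightarrow> enn_powr (ennreal a) r = ennreal (a powr r)"
  by (simp add: enn_powr_def)

lemma Lp_norm_ennreal:
  assumes "(powint (dunkl_measure k) p f) = ennreal a" "a \<ge> 0"
  shows "Lp_norm k p f = ennreal (a powr (1 / p))"
  unfolding Lp_norm_def assms(1) by (rule enn_powr_ennreal[OF assms(2)])

lemma Lp_norm_le_iff:
  assumes p: "p > 0" and c: "c \<ge> 0"
  shows "Lp_norm k p f \<le> ennreal c \<longleftrightarrow> (powint (dunkl_measure k) p f) \<le> ennreal (c powr p)"
proof (cases "(powint (dunkl_measure k) p f)")
  case (real a)
  have "a powr (1 / p) \<le> c \<longleftrightarrow> a \<le> c powr p"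
  proof
    assume "a powr (1 / p) \<le> c"
    then have "(a powr (1 / p)) powr p \<le> c powr p" using p by (intro powr_mono2) auto
    then show "a \<le> c powr p" using p real by (simp add: powr_powr)
  next
    assume "a \<le> c powr p"
    then have "a powr (1 / p) \<le> (c powr p) powr (1 / p)" using p real by (intro powr_mono2) auto
    then show "a powr (1 / p) \<le> c" using p c by (simp add: powr_powr)
  qed
  then show ?thesis unfolding Lp_norm_ennreal[OF real(2,1)] real(2) using c by (simp add: ennreal_le_iff)
next
  case top
  then show ?thesis by (simp add: Lp_norm_def enn_powr_def top_unique)
qed

lemma Lp_space_iff:
  "f \<in> Lp_space k p \<longleftrightarrow> f \<in> borel_measurable (dunkl_measure k) \<and>
    (powint (dunkl_measure k) p f) < \<infinity>"
  by (auto simp: Lp_space_def Lp_norm_def enn_powr_def less_top)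

lemma Lp_spaceE:
  assumes "f \<in> Lp_space k p"
  obtains a where "a \<ge> 0" "(powint (dunkl_measure k) p f) = ennreal a"
    "Lp_norm k p f = ennreal (a powr (1 / p))"
proof (cases "(powint (dunkl_measure k) p f)")
  case (real a)
  then show ?thesis using that Lp_norm_ennreal by blast
next
  case top
  then show ?thesis using assms by (simp add: Lp_space_iff)
qed

text \<open>The norm of \<open>f\<close> is at most the sum of the norms of its two parts, and
  concentration bounds the part off \<open>E\<close> by \<open>\<epsilon>\<close> times the whole.
  Finiteness of the norm allows this share to be subtracted.\<close>

lemma concentrated_le:
  assumes f: "f \<in> Lp_space k p" and p: "p \<ge> 1" and E: "E \<in> sets lebesgue"
    and \<epsilon>: "0 \<le> \<epsilon>" "\<epsilon> < 1" and conc: "concentrated k p \<epsilon> E f"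
  shows "ennreal (1 - \<epsilon>) * Lp_norm k p f \<le> Lp_norm k p (\<lambda>x. indicator E x * f x)"
proof -
  have fm: "f \<in> borel_measurable (dunkl_measure k)" using f by (simp add: Lp_space_iff)
  have Em: "E \<in> sets (dunkl_measure k)" using E by simp
  obtain a where a: "a \<ge> 0" "(powint (dunkl_measure k) p f) = ennreal a"
    "Lp_norm k p f = ennreal (a powr (1 / p))" by (rule Lp_spaceE[OF f])
  define B where "B = (powint (dunkl_measure k) p (\<lambda>x. f x - indicator E x * f x))"
  define D where "D = (powint (dunkl_measure k) p (\<lambda>x. indicator E x * f x))"
  have BD: "ennreal a = B + D"
    unfolding a(2)[symmetric] B_def D_def by (rule nn_integral_powr_split[OF fm Em])
  then have "B \<noteq> top" "D \<noteq> top" using ennreal_neq_top[of a] by auto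
  then obtain b d where b: "B = ennreal b" "b \<ge> 0" and d: "D = ennreal d" "d \<ge> 0"
    by (cases B; cases D) auto
  have abd: "a = b + d" using BD a(1) b d by (simp flip: ennreal_plus)
  have nb: "Lp_norm k p (\<lambda>x. f x - indicator E x * f x) = ennreal (b powr (1 / p))"
    by (rule Lp_norm_ennreal) (use b in \<open>simp_all add: B_def\<close>)
  have nd: "Lp_norm k p (\<lambda>x. indicator E x * f x) = ennreal (d powr (1 / p))"
    by (rule Lp_norm_ennreal) (use d in \<open>simp_all add: D_def\<close>)
  have "b powr (1 / p) \<le> \<epsilon> * a powr (1 / p)"
    using conc \<epsilon> unfolding concentrated_def nb a(3) by (simp add: ennreal_mult'[symmetric])
  moreover have "a powr (1 / p) \<le> b powr (1 / p) + d powr (1 / p)"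
  proof -
    have "b + d \<le> (b powr (1 / p) + d powr (1 / p)) powr p"
      using powr_superadditive[of "b powr (1 / p)" "d powr (1 / p)" p] p b d by (simp add: powr_powr)
    then have "a powr (1 / p) \<le> ((b powr (1 / p) + d powr (1 / p)) powr p) powr (1 / p)"
      unfolding abd using p b d by (intro powr_mono2) auto
    then show ?thesis using p by (simp add: powr_powr)
  qed
  ultimately have "(1 - \<epsilon>) * a powr (1 / p) \<le> d powr (1 / p)" by (simp add: algebra_simps)
  then show ?thesis unfolding nd a(3) using \<epsilon> by (simp add: ennreal_mult'[symmetric])
qed

text \<open>Hoelder's inequality against the indicator of \<open>A\<close>, obtained by integrating
  a pointwise Young inequality over \<open>A\<close>. The degenerate values are treated separately
  because the right-hand side is a product in [0, \<infinity>].\<close>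

lemma Lp_norm_indicator_le:
  fixes g :: "real \<Rightarrow> complex"
  assumes gm: "g \<in> borel_measurable (dunkl_measure k)" and A: "A \<in> sets lebesgue"
    and rs: "0 < r" "r < s"
  shows "Lp_norm k r (\<lambda>x. indicator A x * g x) \<le> enn_powr (dunkl_gamma k A) (1 / r - 1 / s) * Lp_norm k s g"
proof -
  let ?M = "dunkl_measure k"
  note [measurable] = gm
  have [measurable]: "A \<in> sets ?M" using A by simp
  have s: "s > 0" using rs by simp
  have e: "1 / r - 1 / s > 0" using rs by (simp add: field_simps)
  have gamma: "dunkl_gamma k A = emeasure ?M A" using A by (simp add: dunkl_gamma_def)
  have zero: "Lp_norm k r (\<lambda>x. indicator A x * g x) = 0" if "AE x in ?M. indicator A x * g x = 0"
  proof -
    have "(powint ?M r (\<lambda>x. indicator A x * g x)) = (\<integral>\<^sup>+x. 0 \<partial>?M)"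
      by (rule nn_integral_cong_AE, use that in eventually_elim) simp
    then show ?thesis using Lp_norm_ennreal[where f = "\<lambda>x. indicator A x * g x" and p = r and k = k and a = 0] by simp
  qed
  \<comment> \<open>If one factor is 0, the left side vanishes as well, in accordance with 0 times
    \<infinity> being 0. If one factor is infinite and the other is not 0, the right side is
    infinite. Only the last case has content.\<close>
  consider "emeasure ?M A = 0" | "powint ?M s g = 0" |
    "emeasure ?M A = \<infinity>" "powint ?M s g \<noteq> 0" |
    "powint ?M s g = \<infinity>" "emeasure ?M A \<noteq> 0" |
    "emeasure ?M A \<noteq> 0" "powint ?M s g \<noteq> 0"
    "emeasure ?M A \<noteq> \<infinity>" "powint ?M s g \<noteq> \<infinity>"
    by blast
  then show ?thesis
  proof cases
    case 1
    then have "AE x in ?M. x \<notin> A" using A by (intro AE_not_in) (simp add: null_sets_def)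
    then have "AE x in ?M. indicator A x * g x = 0" by eventually_elim simp
    then show ?thesis using zero by simp
  next
    case 2
    then have "AE x in ?M. ennreal (norm (g x) powr s) = 0" by (subst (asm) nn_integral_0_iff_AE) auto
    then have "AE x in ?M. indicator A x * g x = 0" by eventually_elim simp
    then show ?thesis using zero by simp
  next
    case 3
    then have "Lp_norm k s g \<noteq> 0"
      by (auto simp: Lp_norm_def enn_powr_def enn2real_eq_0_iff)
    then show ?thesis using 3 by (simp add: gamma enn_powr_def ennreal_top_mult)
  next
    case 4
    have "enn_powr (emeasure ?M A) (1 / r - 1 / s) \<noteq> 0"
      using 4 by (auto simp: enn_powr_def enn2real_eq_0_iff)
    then show ?thesis using 4 by (simp add: gamma Lp_norm_def enn_powr_def[of \<infinity>] enn_powr_def[of top] ennreal_mult_top)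
  next
    case 5
    obtain c where c: "emeasure ?M A = ennreal c" "c > 0"
      using 5(1,3) by (cases "emeasure ?M A") (auto simp: less_le)
    obtain a where a: "powint ?M s g = ennreal a" "a > 0"
      using 5(2,4) by (cases "(powint ?M s g)") (auto simp: less_le)
    \<comment> \<open>The height of the constant function on \<open>A\<close> with the same
      \<open>s\<close> norm as \<open>g\<close>. Scaling by it makes Young's inequality yield the
      sharp Hoelder constant.\<close>
    define m where "m = (a / c) powr (1 / s)"
    have m: "m > 0" "m powr s = a / c" using a c s by (auto simp: m_def powr_powr)
    define \<theta> where "\<theta> = r / s"
    have \<theta>: "0 < \<theta>" "\<theta> < 1" using rs by (auto simp: \<theta>_def)
    have young: "t powr r \<le> m powr r * (\<theta> * (t powr s / m powr s) + (1 - \<theta>))" if t: "t \<ge> 0" for t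
    proof (cases "t = 0")
      case False
      then have "(t / m) powr s > 0" using t m by simp
      then have "((t / m) powr s) powr \<theta> * 1 powr (1 - \<theta>) \<le> \<theta> * (t / m) powr s + (1 - \<theta>) * 1"
        using \<theta> by (intro Youngs_inequality_0) auto
      then have "(t / m) powr r \<le> \<theta> * (t / m) powr s + (1 - \<theta>)"
        using s by (simp add: powr_powr \<theta>_def)
      then have "m powr r * (t / m) powr r \<le> m powr r * (\<theta> * (t / m) powr s + (1 - \<theta>))"
        by (intro mult_left_mono) auto
      then show ?thesis using t m by (simp add: powr_divide)
    qed (use \<theta> m in simp)
    define u v where "u = m powr r * \<theta> / m powr s" and "v = m powr r * (1 - \<theta>)"
    have uv: "u \<ge> 0" "v \<ge> 0" using \<theta> by (simp_all add: u_def v_def)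
    have split: "ennreal (u * t + v * z) = ennreal u * ennreal t + ennreal v * ennreal z" if "t \<ge> 0" "z \<ge> 0" for t z
      using uv that by (simp only: ennreal_plus mult_nonneg_nonneg ennreal_mult')
    have "(powint ?M r (\<lambda>x. indicator A x * g x)) \<le>
      (\<integral>\<^sup>+x. ennreal u * ennreal (norm (g x) powr s) + ennreal v * indicator A x \<partial>?M)"
    proof (rule nn_integral_mono)
      fix x
      have "norm (g x) powr r \<le> u * norm (g x) powr s + v * 1"
        using young[of "norm (g x)"] by (simp add: u_def v_def algebra_simps)
      then have "ennreal (norm (g x) powr r) \<le> ennreal (u * norm (g x) powr s + v * 1)"
        by (rule ennreal_leI)
      also have "\<dots> = ennreal u * ennreal (norm (g x) powr s) + ennreal v" by (subst split) simp_all
      finally show "ennreal (norm (indicator A x * g x) powr r) \<le>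
        ennreal u * ennreal (norm (g x) powr s) + ennreal v * indicator A x"
        by (cases "x \<in> A") simp_all
    qed
    also have "\<dots> = ennreal u * ennreal a + ennreal v * ennreal c"
      using A by (simp add: nn_integral_add nn_integral_cmult a(1) c(1))
    also have "\<dots> = ennreal (m powr r * \<theta> / m powr s * a + m powr r * (1 - \<theta>) * c)"
      using split[of a c] a c by (simp add: u_def v_def)
    also have "m powr r * \<theta> / m powr s * a + m powr r * (1 - \<theta>) * c = m powr r * c"
      unfolding m(2) using a c by (simp add: field_simps)
    also have "m powr r * c = (c powr (1 / r - 1 / s) * a powr (1 / s)) powr r"
    proof -
      have "m powr r = a powr (r / s) * c powr (- (r / s))"
      proof -
        have "m powr r = (a / c) powr (r / s)" by (simp add: m_def powr_powr)
        then show ?thesis using a c by (simp add: powr_divide powr_minus_divide)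
      qed
      moreover have "(c powr (1 / r - 1 / s) * a powr (1 / s)) powr r = c powr (1 - r / s) * a powr (r / s)"
        using rs by (simp add: powr_mult powr_powr left_diff_distrib)
      moreover have "c powr (1 - r / s) = c * c powr (- (r / s))"
        using c powr_add[of c 1 "- (r / s)"] by simp
      ultimately show ?thesis by simp
    qed
    finally have "Lp_norm k r (\<lambda>x. indicator A x * g x) \<le> ennreal (c powr (1 / r - 1 / s) * a powr (1 / s))"
      using rs by (subst Lp_norm_le_iff) auto
    also have "\<dots> = enn_powr (dunkl_gamma k A) (1 / r - 1 / s) * Lp_norm k s g"
      using a c by (simp add: gamma enn_powr_ennreal Lp_norm_ennreal[OF a(1)] ennreal_mult')
    finally show ?thesis .
  qed
qed

section \<open>The linear canonical Dunkl transform\<close>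

locale lcdt_kernel =
  fixes k :: real and M :: "real^2^2"
  assumes k: "k \<ge> -1/2" and b: "M$1$2 \<noteq> 0"
begin

abbreviation "\<mu> \<equiv> dunkl_measure k"

definition chirp :: "real \<Rightarrow> real \<Rightarrow> complex" where
  "chirp c x = exp (\<i> / 2 * of_real (c * x\<^sup>2))"

text \<open>The prefactor is part of the kernel, so that the sup bound becomes |b|^(-(k+1)) and the
  L^2 bound becomes 1.\<close>

definition ker :: "real \<Rightarrow> real \<Rightarrow> complex" where
  "ker l x = 1 / ((\<i> * of_real (M$1$2)) powr of_real (k + 1)) *
    (exp (\<i> / 2 * of_real (M$2$2 / M$1$2 * l\<^sup>2 + M$1$1 / M$1$2 * x\<^sup>2)) * dunkl_kernel k (l / M$1$2) x)"

lemma norm_chirp [simp]: "norm (chirp c x) = 1"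
  by (simp add: chirp_def)

lemma chirp_measurable [measurable]: "chirp c \<in> borel_measurable borel"
  unfolding chirp_def[abs_def] by (intro borel_measurable_continuous_onI continuous_intros)

lemma norm_prefactor: "norm (1 / ((\<i> * of_real (M$1$2)) powr of_real (k + 1)) :: complex) = \<bar>M$1$2\<bar> powr (- (k + 1))"
proof -
  have "norm ((\<i> * of_real (M$1$2)) powr of_real (k + 1) :: complex) = \<bar>M$1$2\<bar> powr (k + 1)"
    using b by (subst norm_powr_real_powr') (auto simp: norm_mult)
  then show ?thesis by (simp add: norm_divide powr_minus_divide del: minus_add_distrib)
qed

lemma ker_eq: "ker l x = 1 / ((\<i> * of_real (M$1$2)) powr of_real (k + 1)) *
    (chirp (M$2$2 / M$1$2) l * (chirp (M$1$1 / M$1$2) x * dunkl_kernel k (l / M$1$2) x))"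
  by (simp add: ker_def chirp_def distrib_left exp_add mult.assoc)

lemma norm_ker_le: "norm (ker l x) \<le> \<bar>M$1$2\<bar> powr (- (k + 1))"
  unfolding ker_eq norm_mult norm_prefactor norm_chirp
  using norm_dunkl_kernel_le[OF k, of "l / M$1$2" x] by (simp add: mult_left_le)

lemma lcdt_integral_eq: "lcdt_integral k M f l = (LINT x|\<mu>. f x * ker l x)"
proof -
  have "(LINT x|\<mu>. f x * ker l x) = (LINT x|\<mu>. 1 / ((\<i> * of_real (M$1$2)) powr of_real (k + 1)) *
        (f x * exp (\<i> / 2 * of_real (M$2$2 / M$1$2 * l\<^sup>2 + M$1$1 / M$1$2 * x\<^sup>2)) * dunkl_kernel k (l / M$1$2) x))"
    by (simp only: ker_def mult_ac)
  then show ?thesis unfolding lcdt_integral_def by (simp only: integral_mult_right_zero)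
qed

lemma ker_measurable: "(\<lambda>(l, x). ker l x) \<in> borel_measurable (\<mu> \<Otimes>\<^sub>M \<mu>)"
proof -
  note [measurable] = dunkl_kernel_measurable_pair[OF k, of "M$1$2"]
  have "(\<lambda>z. ker (fst z) (snd z)) \<in> borel_measurable (\<mu> \<Otimes>\<^sub>M \<mu>)"
    unfolding ker_eq by measurable
  then show ?thesis by (simp add: case_prod_beta')
qed

text \<open>The chirp in \<open>x\<close> is absorbed into the function without changing its
  modulus, and the chirp in \<open>l\<close> disappears under the norm. The squared prefactor is the
  exact inverse of the factor |b|^(2(k+1)) in \<open>dunkl_plancherel_le\<close>.\<close>

lemma ker_plancherel:
  fixes f :: "real \<Rightarrow> complex"
  assumes f: "integrable \<mu> f" and f2: "integrable \<mu> (\<lambda>x. (norm (f x))\<^sup>2)"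
  shows "integrable \<mu> (\<lambda>l. (norm (LINT x|\<mu>. f x * ker l x))\<^sup>2) \<and>
    (LINT l|\<mu>. (norm (LINT x|\<mu>. f x * ker l x))\<^sup>2) \<le> (LINT x|\<mu>. (norm (f x))\<^sup>2)"
proof -
  interpret sigma_finite_measure \<mu> by (rule sigma_finite_dunkl) (use k in simp)
  note [measurable] = borel_measurable_integrable[OF f]
  have [measurable]: "chirp c \<in> borel_measurable \<mu>" for c by (rule borel_measurable_dunklI) auto
  define g where "g x = f x * chirp (M$1$1 / M$1$2) x" for x
  have g: "integrable \<mu> g"
    by (rule integrable_dominated[OF f]) (auto simp: g_def[abs_def] norm_mult)
  define B where "B = \<bar>M$1$2\<bar> powr (- (k + 1))"
  define H where "H l = (LINT x|\<mu>. g x * dunkl_kernel k (l / M$1$2) x)" for l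
  have S: "norm (LINT x|\<mu>. f x * ker l x) = B * norm (H l)" for l
  proof -
    have "(LINT x|\<mu>. f x * ker l x) = (LINT x|\<mu>. 1 / ((\<i> * of_real (M$1$2)) powr of_real (k + 1)) *
       (chirp (M$2$2 / M$1$2) l * (g x * dunkl_kernel k (l / M$1$2) x)))"
      by (simp only: ker_eq g_def mult_ac)
    also have "\<dots> = 1 / ((\<i> * of_real (M$1$2)) powr of_real (k + 1)) * (chirp (M$2$2 / M$1$2) l * H l)"
      unfolding H_def by (simp only: integral_mult_right_zero)
    finally show ?thesis by (simp only: norm_mult norm_prefactor B_def norm_chirp mult_1)
  qed
  have Hm [measurable]: "H \<in> borel_measurable \<mu>"
  proof -
    note [measurable] = dunkl_kernel_measurable_pair[OF k, of "M$1$2"] borel_measurable_integrable[OF g]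
    have "(\<lambda>z. g (snd z) * dunkl_kernel k (fst z / M$1$2) (snd z)) \<in> borel_measurable (\<mu> \<Otimes>\<^sub>M \<mu>)" by measurable
    then show ?thesis unfolding H_def by (intro borel_measurable_lebesgue_integral) (simp add: case_prod_beta')
  qed
  have "(\<integral>\<^sup>+l. ennreal ((B * norm (H l))\<^sup>2) \<partial>\<mu>) = (\<integral>\<^sup>+l. ennreal (B\<^sup>2) * ennreal ((norm (H l))\<^sup>2) \<partial>\<mu>)"
    by (intro nn_integral_cong) (simp add: power_mult_distrib ennreal_mult')
  also have "\<dots> = ennreal (B\<^sup>2) * (\<integral>\<^sup>+l. ennreal ((norm (H l))\<^sup>2) \<partial>\<mu>)"
    by (rule nn_integral_cmult) measurable
  also have "\<dots> \<le> ennreal (B\<^sup>2) * (ennreal (\<bar>M$1$2\<bar> powr (2 * (k + 1))) * (\<integral>\<^sup>+x. ennreal ((norm (g x))\<^sup>2) \<partial>\<mu>))"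
    unfolding H_def by (intro mult_left_mono dunkl_plancherel_le k b g) simp
  also have "\<dots> = ennreal (B\<^sup>2 * \<bar>M$1$2\<bar> powr (2 * (k + 1))) * (\<integral>\<^sup>+x. ennreal ((norm (g x))\<^sup>2) \<partial>\<mu>)"
    by (simp add: ennreal_mult' mult.assoc)
  also have "B\<^sup>2 * \<bar>M$1$2\<bar> powr (2 * (k + 1)) = 1"
    using b by (simp add: B_def power2_eq_square powr_add[symmetric])
  also have "(\<integral>\<^sup>+x. ennreal ((norm (g x))\<^sup>2) \<partial>\<mu>) = ennreal (LINT x|\<mu>. (norm (f x))\<^sup>2)"
    unfolding g_def norm_mult norm_chirp mult_1_right by (rule nn_integral_eq_integral[OF f2]) simp
  finally have le: "(\<integral>\<^sup>+l. ennreal ((B * norm (H l))\<^sup>2) \<partial>\<mu>) \<le> ennreal (LINT x|\<mu>. (norm (f x))\<^sup>2)" by simp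
  have int: "integrable \<mu> (\<lambda>l. (B * norm (H l))\<^sup>2)"
  proof (rule integrableI_bounded)
    show "(\<integral>\<^sup>+l. ennreal (norm ((B * norm (H l))\<^sup>2)) \<partial>\<mu>) < \<infinity>"
      using order_le_less_trans[OF le ennreal_less_top] by simp
  qed measurable
  have "ennreal (LINT l|\<mu>. (B * norm (H l))\<^sup>2) \<le> ennreal (LINT x|\<mu>. (norm (f x))\<^sup>2)"
    using le nn_integral_eq_integral[OF int] by simp
  then have "(LINT l|\<mu>. (B * norm (H l))\<^sup>2) \<le> (LINT x|\<mu>. (norm (f x))\<^sup>2)"
    by (subst (asm) ennreal_le_iff) (auto intro: bochner_nonneg)
  with int show ?thesis by (simp add: S)
qed

sublocale bounded_kernel_transform \<mu> ker "\<bar>M$1$2\<bar> powr (- (k + 1))"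
proof (rule bounded_kernel_transform.intro)
  show "sigma_finite_measure \<mu>" by (rule sigma_finite_dunkl) (use k in simp)
  show "bounded_kernel_transform_axioms \<mu> ker (\<bar>M$1$2\<bar> powr (- (k + 1)))"
    using ker_measurable norm_ker_le ker_plancherel b by unfold_locales auto
qed

lemma T_eq: "T f = lcdt_integral k M f"
  by (rule ext) (simp add: T_def lcdt_integral_eq)

abbreviation "C \<equiv> \<bar>M$1$2\<bar> powr (- (k + 1))"

lemma T_bound:
  assumes f: "integrable \<mu> f" and fp: "f \<in> Lp_space k p"
    and p: "1 < p" "p \<le> 2" and pq: "1 / p + 1 / q = 1"
  shows "Lp_norm k q (T f) \<le> ennreal (C powr (1 - 2 / q)) * Lp_norm k p f"
proof -
  have q: "q > 0" using conjugate_exponent(1)[OF p pq] by simp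
  obtain a where a: "a \<ge> 0" "powint \<mu> p f = ennreal a"
    "Lp_norm k p f = ennreal (a powr (1 / p))" by (rule Lp_spaceE[OF fp])
  note [measurable] = borel_measurable_integrable[OF f]
  have int: "integrable \<mu> (\<lambda>x. norm (f x) powr p)"
    by (rule integrableI_bounded) (auto simp: a(2))
  have "ennreal a = ennreal (LINT x|\<mu>. norm (f x) powr p)"
    unfolding a(2)[symmetric] by (rule nn_integral_eq_integral[OF int]) simp
  then have "(LINT x|\<mu>. norm (f x) powr p) = a"
    using a(1) by (subst (asm) ennreal_inj) (auto intro: bochner_nonneg)
  then have "(\<integral>\<^sup>+l. norm (T f l) powr q \<partial>\<mu>) \<le> ennreal ((C powr (1 - 2 / q) * a powr (1 / p)) powr q)"
    using hausdorff_young[OF f int p pq] by simp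
  then have "Lp_norm k q (T f) \<le> ennreal (C powr (1 - 2 / q) * a powr (1 / p))"
    by (subst Lp_norm_le_iff[OF q]) auto
  then show ?thesis by (simp add: a(3) ennreal_mult')
qed

definition cut :: "nat \<Rightarrow> (real \<Rightarrow> complex) \<Rightarrow> real \<Rightarrow> complex" where
  "cut n f x = indicator {- real n..real n} x * f x"

lemma interval_sets [measurable]: "{- real n..real n} \<in> sets \<mu>"
  by simp

lemma cut_measurable [measurable]: "f \<in> borel_measurable \<mu> \<Longrightarrow> cut n f \<in> borel_measurable \<mu>"
  unfolding cut_def[abs_def] by (intro borel_measurable_times borel_measurable_indicator interval_sets)

lemma emeasure_interval_finite: "emeasure \<mu> {- real n..real n} < \<infinity>"
  using emeasure_dunkl_interval[of k n] k by (simp add: less_top)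

lemma norm_cut_le: "norm (cut n f x) \<le> norm (f x)"
  by (simp add: cut_def indicator_def)

lemma Lp_space_mono:
  assumes f: "f \<in> Lp_space k p" and p: "p > 0" and g: "g \<in> borel_measurable \<mu>"
    and le: "\<And>x. norm (g x) \<le> norm (f x)"
  shows "g \<in> Lp_space k p" "Lp_norm k p g \<le> Lp_norm k p f"
proof -
  have I: "powint \<mu> p g \<le> (powint \<mu> p f)"
    using le p by (intro nn_integral_mono ennreal_leI powr_mono2) auto
  then show "g \<in> Lp_space k p" using f g by (auto simp: Lp_space_iff)
  obtain a where a: "a \<ge> 0" "powint \<mu> p f = ennreal a"
    "Lp_norm k p f = ennreal (a powr (1 / p))" by (rule Lp_spaceE[OF f])
  show "Lp_norm k p g \<le> Lp_norm k p f"
    unfolding a(3) using I p a by (subst Lp_norm_le_iff) (auto simp: powr_powr)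
qed

lemma cut_Lp:
  assumes "f \<in> Lp_space k p" "p > 0"
  shows "cut n f \<in> Lp_space k p" "Lp_norm k p (cut n f) \<le> Lp_norm k p f"
  using Lp_space_mono[OF assms, of "cut n f"] assms(1) norm_cut_le by (auto simp: Lp_space_iff)

text \<open>Because \<open>t \<le> 1 + t powr p\<close> and a bounded interval has finite
  measure.\<close>

lemma cut_integrable:
  assumes f: "f \<in> Lp_space k p" and p: "p \<ge> 1"
  shows "integrable \<mu> (cut n f)"
proof (rule integrableI_bounded)
  have [measurable]: "f \<in> borel_measurable \<mu>" using f by (simp add: Lp_space_iff)
  show "cut n f \<in> borel_measurable \<mu>" by measurable
  have "(\<integral>\<^sup>+x. ennreal (norm (cut n f x)) \<partial>\<mu>) \<le> (\<integral>\<^sup>+x. indicator {- real n..real n} x + ennreal (norm (f x) powr p) \<partial>\<mu>)"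
  proof (rule nn_integral_mono)
    fix x
    have "t \<le> 1 + t powr p" if "t \<ge> 0" for t :: real
    proof (cases "t \<le> 1")
      case False
      then have "t powr 1 \<le> t powr p" using p by (intro powr_mono) auto
      then show ?thesis using False by simp
    qed (simp add: add_increasing2)
    from this[of "norm (f x)"] have "ennreal (norm (f x)) \<le> ennreal (1 + norm (f x) powr p)"
      by (intro ennreal_leI) simp
    also have "\<dots> = 1 + ennreal (norm (f x) powr p)" by (subst ennreal_plus) auto
    finally have "ennreal (norm (f x)) \<le> 1 + ennreal (norm (f x) powr p)" .
    then show "ennreal (norm (cut n f x)) \<le> indicator {- real n..real n} x + ennreal (norm (f x) powr p)"
      by (cases "x \<in> {- real n..real n}") (simp_all add: cut_def)
  qed
  also have "\<dots> = emeasure \<mu> {- real n..real n} + (powint \<mu> p f)"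
    by (subst nn_integral_add) auto
  also have "\<dots> < \<infinity>" using f emeasure_interval_finite by (simp add: Lp_space_iff)
  finally show "(\<integral>\<^sup>+x. ennreal (norm (cut n f x)) \<partial>\<mu>) < \<infinity>" .
qed

lemma cut_tendsto: "(\<lambda>n. cut n f x) \<longlonglongrightarrow> f x"
proof (rule tendsto_eventually)
  obtain m where m: "\<bar>x\<bar> \<le> real m" using real_arch_simple by blast
  show "\<forall>\<^sub>F n in sequentially. cut n f x = f x"
    using eventually_ge_at_top[of m]
    by eventually_elim (use m in \<open>auto simp: cut_def indicator_def abs_le_iff\<close>)
qed

text \<open>Dominated convergence with majorant \<open>norm (f x) powr p\<close>. The truncation
  itself does not refer to \<open>p\<close>, so a single sequence approximates \<open>f\<close> in
  every L^p that contains it; this links the transforms at two exponents.\<close>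

lemma cut_tail:
  assumes f: "f \<in> Lp_space k p" and p: "p > 0"
  shows "(\<lambda>n. powint \<mu> p (\<lambda>x. f x - cut n f x)) \<longlonglongrightarrow> 0"
proof -
  have [measurable]: "f \<in> borel_measurable \<mu>" using f by (simp add: Lp_space_iff)
  have "(\<lambda>n. powint \<mu> p (\<lambda>x. f x - cut n f x)) \<longlonglongrightarrow> (\<integral>\<^sup>+x. 0 \<partial>\<mu>)"
  proof (rule nn_integral_dominated_convergence[where w = "\<lambda>x. ennreal (norm (f x) powr p)"])
    show "AE x in \<mu>. ennreal (norm (f x - cut n f x) powr p) \<le> ennreal (norm (f x) powr p)" for n
      using p by (intro AE_I2 ennreal_leI powr_mono2) (auto simp: cut_def indicator_def)
    show "AE x in \<mu>. (\<lambda>n. ennreal (norm (f x - cut n f x) powr p)) \<longlonglongrightarrow> 0"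
    proof (rule AE_I2)
      fix x
      have "(\<lambda>n. f x - cut n f x) \<longlonglongrightarrow> f x - f x" by (intro tendsto_intros cut_tendsto)
      then have "(\<lambda>n. norm (f x - cut n f x) powr p) \<longlonglongrightarrow> norm (f x - f x) powr p"
        using p by (intro tendsto_powr' tendsto_norm tendsto_const) auto
      then show "(\<lambda>n. ennreal (norm (f x - cut n f x) powr p)) \<longlonglongrightarrow> 0"
        using tendsto_ennrealI[of "\<lambda>n. norm (f x - cut n f x) powr p" 0] by simp
    qed
  qed (use f in \<open>auto simp: Lp_space_iff\<close>)
  then show ?thesis by simp
qed

lemma nn_integral_scale_powr:
  fixes u :: "real \<Rightarrow> complex"
  assumes [measurable]: "u \<in> borel_measurable \<mu>"
  shows "(powint \<mu> q (\<lambda>l. \<alpha> * u l)) = ennreal (norm \<alpha> powr q) * (powint \<mu> q u)"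
  by (simp add: norm_mult powr_mult ennreal_mult' nn_integral_cmult)

lemma Lp_space_lincomb:
  assumes f: "f \<in> Lp_space k p" and g: "g \<in> Lp_space k p" and p: "p > 0"
  shows "(\<lambda>x. \<alpha> * f x + \<beta> * g x) \<in> Lp_space k p"
proof -
  have [measurable]: "f \<in> borel_measurable \<mu>" "g \<in> borel_measurable \<mu>"
    using f g by (auto simp: Lp_space_iff)
  have "(powint \<mu> p (\<lambda>x. \<alpha> * f x + \<beta> * g x)) \<le> ennreal (2 powr p) *
      ((powint \<mu> p (\<lambda>x. \<alpha> * f x)) + (powint \<mu> p (\<lambda>x. \<beta> * g x)))"
    by (rule nn_integral_norm_add_powr_le[OF p]) measurable
  also have "\<dots> < \<infinity>"
    using f g by (simp add: nn_integral_scale_powr Lp_space_iff ennreal_mult_less_top)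
  finally show ?thesis by (simp add: Lp_space_iff)
qed

text \<open>The exponent \<open>q\<close> only selects the mode of convergence, so limits for different \<open>q\<close> agree almost everywhere.\<close>

definition cut_limit :: "real \<Rightarrow> (real \<Rightarrow> complex) \<Rightarrow> (real \<Rightarrow> complex) \<Rightarrow> bool" where
  "cut_limit q f h \<longleftrightarrow> h \<in> borel_measurable \<mu> \<and>
     (\<lambda>n. powint \<mu> q (\<lambda>l. h l - T (cut n f) l)) \<longlonglongrightarrow> 0"

lemma T_cut_measurable:
  "f \<in> Lp_space k p \<Longrightarrow> T (cut n f) \<in> borel_measurable \<mu>"
  by (auto simp: Lp_space_iff)

lemma T_diff:
  assumes "integrable \<mu> f" "integrable \<mu> g"
  shows "T (\<lambda>x. f x - g x) l = T f l - T g l"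
  unfolding T_def using integrable_N[OF assms(1), of l] integrable_N[OF assms(2), of l]
  by (simp add: left_diff_distrib)

lemma T_lincomb:
  assumes "integrable \<mu> f" "integrable \<mu> g"
  shows "T (\<lambda>x. \<alpha> * f x + \<beta> * g x) l = \<alpha> * T f l + \<beta> * T g l"
  unfolding T_def using integrable_N[OF assms(1), of l] integrable_N[OF assms(2), of l]
  by (simp add: distrib_right mult.assoc)

text \<open>From \<open>N\<close> on, the difference of two truncations is dominated by the tail of
  \<open>f\<close>. The bound \<open>T_bound\<close> carries the Cauchy property over to the
  transforms, and completeness gives the limit.\<close>

lemma cut_limit_exists:
  assumes f: "f \<in> Lp_space k p" and p: "1 < p" "p \<le> 2" and pq: "1 / p + 1 / q = 1"
  shows "\<exists>h. cut_limit q f h"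
proof -
  have q: "q > 0" using conjugate_exponent(1)[OF p pq] by simp
  have fm [measurable]: "f \<in> borel_measurable \<mu>" using f by (simp add: Lp_space_iff)
  define K where "K = C powr (1 - 2 / q)"
  have K: "K > 0" using b by (simp add: K_def)
  have p0: "p > 0" using p by simp
  obtain h where "h \<in> borel_measurable \<mu>"
    "(\<lambda>n. powint \<mu> q (\<lambda>l. h l - T (cut n f) l)) \<longlonglongrightarrow> 0"
  proof (rule riesz_fischer[of "\<lambda>n. T (cut n f)" \<mu> q, OF T_cut_measurable[OF f] q])
    fix e :: real assume e: "e > 0"
    \<comment> \<open>Solves \<open>K * d powr (1 / p) = e powr (1 / q)\<close>, the relation under
      which a \<open>p\<close> integral of size \<open>d\<close> leads to a \<open>q\<close>
      integral of size \<open>e\<close>.\<close>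
    define d where "d = (e powr (1 / q) / K) powr p"
    have d: "d > 0" using e K by (simp add: d_def)
    have "\<forall>\<^sub>F n in sequentially. (powint \<mu> p (\<lambda>x. f x - cut n f x)) < ennreal d"
      using order_tendstoD(2)[OF cut_tail[OF f p0], of "ennreal d"] d by simp
    then obtain N where N: "(powint \<mu> p (\<lambda>x. f x - cut N f x)) < ennreal d"
      unfolding eventually_sequentially by blast
    have "(powint \<mu> q (\<lambda>l. T (cut m f) l - T (cut n f) l)) \<le> ennreal e"
      if mn: "m \<ge> N" "n \<ge> N" for m n
    proof -
      define g where "g x = cut m f x - cut n f x" for x
      have ci: "integrable \<mu> (cut n f)" for n by (rule cut_integrable[OF f]) (use p in simp)
      have gi: "integrable \<mu> g" unfolding g_def using ci by simp
      have Tg: "T g l = T (cut m f) l - T (cut n f) l" for l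
        unfolding g_def by (rule T_diff[OF ci ci])
      have "norm (g x) \<le> norm (f x - cut N f x)" for x
        using mn by (auto simp: g_def cut_def indicator_def)
      then have "powint \<mu> p g \<le> (powint \<mu> p (\<lambda>x. f x - cut N f x))"
        using p by (intro nn_integral_mono ennreal_leI powr_mono2) auto
      also have "\<dots> \<le> ennreal ((e powr (1 / q) / K) powr p)" using N by (simp add: d_def)
      finally have I: "powint \<mu> p g \<le> ennreal ((e powr (1 / q) / K) powr p)" .
      then have gp: "g \<in> Lp_space k p"
        using borel_measurable_integrable[OF gi] order_le_less_trans[OF I ennreal_less_top]
        by (simp add: Lp_space_iff)
      have "Lp_norm k q (T g) \<le> ennreal K * Lp_norm k p g"
        unfolding K_def by (rule T_bound[OF gi gp p pq])
      also have "\<dots> \<le> ennreal K * ennreal (e powr (1 / q) / K)"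
        using I K by (intro mult_left_mono) (simp_all add: Lp_norm_le_iff[OF p0])
      also have "\<dots> = ennreal (e powr (1 / q))" using K by (simp add: ennreal_mult'[symmetric])
      finally have "(powint \<mu> q (\<lambda>l. T g l)) \<le> ennreal ((e powr (1 / q)) powr q)"
        by (subst (asm) Lp_norm_le_iff[OF q]) auto
      then show ?thesis using e q by (simp add: Tg powr_powr)
    qed
    then show "\<exists>N. \<forall>m\<ge>N. \<forall>n\<ge>N. (powint \<mu> q (\<lambda>l. T (cut m f) l - T (cut n f) l)) \<le> ennreal e"
      by blast
  qed
  then show ?thesis unfolding cut_limit_def by blast
qed

text \<open>The exponent \<open>q\<close> of the convergence and the pair \<open>p'\<close>,
  \<open>q'\<close> of the estimate are independent of each other. Convergence in L^q is used only
  through an almost everywhere convergent subsequence, and Fatou's lemma then applies the bound for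
  \<open>p'\<close> to the limit.\<close>

lemma cut_limit_norm_le:
  assumes lim: "cut_limit q f h" and q: "q > 0"
    and f: "f \<in> Lp_space k p'" and p: "1 < p'" "p' \<le> 2" and pq: "1 / p' + 1 / q' = 1"
  shows "Lp_norm k q' h \<le> ennreal (C powr (1 - 2 / q')) * Lp_norm k p' f"
proof -
  have q': "q' > 0" using conjugate_exponent(1)[OF p pq] by simp
  obtain r where r: "strict_mono r" "AE l in \<mu>. (\<lambda>n. T (cut (r n) f) l) \<longlonglongrightarrow> h l"
    by (rule Lp_tendsto_AE_subseq[of "\<lambda>n. T (cut n f)" \<mu> h q])
      (use lim q T_cut_measurable[OF f] in \<open>auto simp: cut_limit_def\<close>)
  obtain a where a: "a \<ge> 0" "Lp_norm k p' f = ennreal (a powr (1 / p'))" by (rule Lp_spaceE[OF f])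
  define c where "c = C powr (1 - 2 / q') * a powr (1 / p')"
  have c: "c \<ge> 0" "ennreal c = ennreal (C powr (1 - 2 / q')) * Lp_norm k p' f"
    by (simp_all add: c_def a(2) ennreal_mult')
  have "powint \<mu> q' h \<le> ennreal (c powr q')"
  proof (rule nn_integral_powr_fatou[OF _ q' r(2)])
    have "Lp_norm k q' (T (cut n f)) \<le> ennreal c" for n
    proof -
      have "Lp_norm k q' (T (cut n f)) \<le> ennreal (C powr (1 - 2 / q')) * Lp_norm k p' (cut n f)"
        using p by (intro T_bound[OF _ _ p pq] cut_integrable[OF f] cut_Lp[OF f]) auto
      also have "\<dots> \<le> ennreal c"
        unfolding c(2) using p by (intro mult_left_mono cut_Lp[OF f]) auto
      finally show ?thesis .
    qed
    then show "\<forall>\<^sub>F n in sequentially. (powint \<mu> q' (\<lambda>l. T (cut (r n) f) l)) \<le> ennreal (c powr q')"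
      using Lp_norm_le_iff[OF q' c(1)] by simp
  qed (rule T_cut_measurable[OF f])
  then show ?thesis unfolding c(2)[symmetric] by (subst Lp_norm_le_iff[OF q' c(1)])
qed

lemma cut_limit_lincomb:
  assumes f: "f \<in> Lp_space k p" and g: "g \<in> Lp_space k p" and p: "p \<ge> 1" and q: "q > 0"
    and hf: "cut_limit q f hf" and hg: "cut_limit q g hg"
  shows "cut_limit q (\<lambda>x. \<alpha> * f x + \<beta> * g x) (\<lambda>l. \<alpha> * hf l + \<beta> * hg l)"
proof -
  have m [measurable]: "hf \<in> borel_measurable \<mu>" "hg \<in> borel_measurable \<mu>"
    using hf hg by (auto simp: cut_limit_def)
  note [measurable] = T_cut_measurable[OF f] T_cut_measurable[OF g]
  have cut: "cut n (\<lambda>x. \<alpha> * f x + \<beta> * g x) = (\<lambda>x. \<alpha> * cut n f x + \<beta> * cut n g x)" for n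
    by (auto simp: cut_def algebra_simps)
  have Tc: "T (cut n (\<lambda>x. \<alpha> * f x + \<beta> * g x)) l = \<alpha> * T (cut n f) l + \<beta> * T (cut n g) l" for n l
    unfolding cut by (rule T_lincomb[OF cut_integrable[OF f p] cut_integrable[OF g p]])
  let ?D = "\<lambda>n l. \<alpha> * hf l + \<beta> * hg l - T (cut n (\<lambda>x. \<alpha> * f x + \<beta> * g x)) l"
  define R where "R n = ennreal (2 powr q) *
      (ennreal (norm \<alpha> powr q) * (powint \<mu> q (\<lambda>l. hf l - T (cut n f) l)) +
       ennreal (norm \<beta> powr q) * (powint \<mu> q (\<lambda>l. hg l - T (cut n g) l)))" for n
  have "R \<longlonglongrightarrow> ennreal (2 powr q) * (ennreal (norm \<alpha> powr q) * 0 + ennreal (norm \<beta> powr q) * 0)"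
    unfolding R_def using hf hg unfolding cut_limit_def
    by (intro tendsto_add ennreal_tendsto_cmult) auto
  then have R: "R \<longlonglongrightarrow> 0" by simp
  have le: "(powint \<mu> q (\<lambda>l. ?D n l)) \<le> R n" for n
  proof -
    have "?D n l =
        \<alpha> * (hf l - T (cut n f) l) + \<beta> * (hg l - T (cut n g) l)" for l
      unfolding Tc by (simp add: algebra_simps)
    then have "(powint \<mu> q (\<lambda>l. ?D n l)) =
       (powint \<mu> q (\<lambda>l. \<alpha> * (hf l - T (cut n f) l) + \<beta> * (hg l - T (cut n g) l)))"
      by (simp only:)
    also have "\<dots> \<le> ennreal (2 powr q) * ((powint \<mu> q (\<lambda>l. \<alpha> * (hf l - T (cut n f) l))) +
        (powint \<mu> q (\<lambda>l. \<beta> * (hg l - T (cut n g) l))))"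
      by (rule nn_integral_norm_add_powr_le[OF q]) measurable
    also have "\<dots> = R n"
      unfolding R_def by (subst (1 2) nn_integral_scale_powr) measurable
    finally show ?thesis .
  qed
  have "(\<lambda>n. powint \<mu> q (\<lambda>l. ?D n l)) \<longlonglongrightarrow> 0"
    by (rule tendsto_sandwich[OF _ _ tendsto_const R]) (use le in auto)
  then show ?thesis unfolding cut_limit_def by simp
qed

lemma cut_limit_unique:
  assumes "f \<in> Lp_space k p" "q > 0" "cut_limit q f h" "cut_limit q f h'"
  shows "AE l in \<mu>. h l = h' l"
  using assms by (intro Lp_limit_unique[of "\<lambda>n. T (cut n f)" \<mu> h h' q] T_cut_measurable)
    (auto simp: cut_limit_def)

text \<open>For integrable \<open>f\<close> the transforms of the truncations converge to
  \<open>T f\<close> at every point by dominated convergence, so the mean limit must agree with it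
  almost everywhere.\<close>

lemma cut_limit_eq_T:
  assumes f: "integrable \<mu> f" and q: "q > 0" and h: "cut_limit q f h"
  shows "AE l in \<mu>. h l = T f l"
proof -
  have [measurable]: "f \<in> borel_measurable \<mu>" using f by simp
  have Tm: "T (cut n f) \<in> borel_measurable \<mu>" for n by measurable
  obtain r where r: "strict_mono r" "AE l in \<mu>. (\<lambda>n. T (cut (r n) f) l) \<longlonglongrightarrow> h l"
    by (rule Lp_tendsto_AE_subseq[of "\<lambda>n. T (cut n f)" \<mu> h q])
      (use h q Tm in \<open>auto simp: cut_limit_def\<close>)
  from r(2) show ?thesis
  proof eventually_elim
    case (elim l)
    have "(\<lambda>n. T (cut n f) l) \<longlonglongrightarrow> T f l"
      by (rule T_tendsto[OF f, where K = 1]) (auto simp: norm_cut_le cut_tendsto)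
    from LIMSEQ_subseq_LIMSEQ[OF this r(1)] elim show ?case by (auto simp: o_def intro: LIMSEQ_unique)
  qed
qed

text \<open>Without a witness the choice operator in \<open>lcdt\<close> would say nothing. The
  witness picks some limit for each \<open>f\<close> separately, so its linearity holds only almost
  everywhere, by uniqueness of limits.\<close>

lemma lcdt_extension_exists:
  assumes p: "1 < p" "p \<le> 2"
  shows "\<exists>S. is_lcdt_extension k M p S"
proof -
  define q where "q = p / (p - 1)"
  have pq: "1 / p + 1 / q = 1" using p by (simp add: q_def field_simps)
  have q: "q > 0" using p by (simp add: q_def)
  define S where "S f = (SOME h. cut_limit q f h)" for f
  have S: "cut_limit q f (S f)" if "f \<in> Lp_space k p" for f
    unfolding S_def using cut_limit_exists[OF that p pq] by (rule someI_ex)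
  have bound: "Lp_norm k q (S f) \<le> ennreal (C powr (1 - 2 / q)) * Lp_norm k p f" if "f \<in> Lp_space k p" for f
    by (rule cut_limit_norm_le[OF S[OF that] q that p pq])
  have "is_lcdt_extension k M p S"
    unfolding is_lcdt_extension_def q_def[symmetric]
  proof (intro conjI ballI allI)
    fix f assume f: "f \<in> Lp_space k p"
    have "ennreal (C powr (1 - 2 / q)) * Lp_norm k p f < \<infinity>"
      using f by (simp add: Lp_space_def ennreal_mult_less_top)
    then have "Lp_norm k q (S f) < \<infinity>" using bound[OF f] by (rule order_le_less_trans[rotated])
    then show "S f \<in> Lp_space k q" using S[OF f] by (simp add: Lp_space_def cut_limit_def)
  next
    fix f g \<alpha> \<beta> assume f: "f \<in> Lp_space k p" and g: "g \<in> Lp_space k p"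
    show "AE l in \<mu>. S (\<lambda>x. \<alpha> * f x + \<beta> * g x) l = \<alpha> * S f l + \<beta> * S g l"
    proof (rule cut_limit_unique[OF _ q S])
      show lin: "(\<lambda>x. \<alpha> * f x + \<beta> * g x) \<in> Lp_space k p"
        using p by (intro Lp_space_lincomb f g) simp
      show "(\<lambda>x. \<alpha> * f x + \<beta> * g x) \<in> Lp_space k p" by (rule lin)
      show "cut_limit q (\<lambda>x. \<alpha> * f x + \<beta> * g x) (\<lambda>l. \<alpha> * S f l + \<beta> * S g l)"
        by (rule cut_limit_lincomb[OF f g _ q S[OF f] S[OF g]]) (use p in simp)
    qed
  next
    show "\<exists>C. \<forall>f\<in>Lp_space k p. Lp_norm k q (S f) \<le> ennreal C * Lp_norm k p f"
      using bound by blast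
  next
    fix f assume "f \<in> Lp_space k 1 \<inter> Lp_space k p"
    then have f: "integrable \<mu> f" "f \<in> Lp_space k p"
      by (auto simp: Lp_space_iff integrable_iff_bounded)
    show "AE l in \<mu>. S f l = lcdt_integral k M f l"
      unfolding T_eq[symmetric] by (rule cut_limit_eq_T[OF f(1) q S[OF f(2)]])
  qed
  then show ?thesis by blast
qed

text \<open>On truncations, which lie in both L^1 and L^p, an extension must coincide with
  \<open>T\<close>. Linearity and boundedness control the rest by the tail of
  \<open>f\<close>.\<close>

lemma extension_cut_limit:
  assumes S: "is_lcdt_extension k M p S" and p: "1 < p" and pq: "1 / p + 1 / q = 1"
    and f: "f \<in> Lp_space k p"
  shows "cut_limit q f (S f)"
proof -
  have "1 / q = (p - 1) / p" using pq p by (simp add: field_simps)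
  then have q_eq: "q = p / (p - 1)" by (metis inverse_divide inverse_eq_divide inverse_inverse_eq)
  have q: "q > 0" using p by (simp add: q_eq)
  have p0: "p > 0" "p \<ge> 1" using p by auto
  from S obtain B where B: "\<And>f. f \<in> Lp_space k p \<Longrightarrow> Lp_norm k q (S f) \<le> ennreal B * Lp_norm k p f"
    unfolding is_lcdt_extension_def q_eq by blast
  have Sq: "S f \<in> Lp_space k q" if "f \<in> Lp_space k p" for f
    using S that unfolding is_lcdt_extension_def q_eq by blast
  \<comment> \<open>The coefficients 1 and -1 put a difference into the shape in which linearity is
    available.\<close>
  have lin: "AE l in \<mu>. S (\<lambda>x. 1 * f x + (-1) * g x) l = 1 * S f l + (-1) * S g l"
    if "f \<in> Lp_space k p" "g \<in> Lp_space k p" for f g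
    using S that unfolding is_lcdt_extension_def by blast
  have L1: "AE l in \<mu>. S (cut n f) l = T (cut n f) l" for n
  proof -
    have "cut n f \<in> Lp_space k 1"
      using cut_integrable[OF f p0(2), of n] by (auto simp: Lp_space_iff integrable_iff_bounded)
    then show ?thesis using S cut_Lp(1)[OF f p0(1), of n] unfolding is_lcdt_extension_def T_eq by blast
  qed
  define I where "I n = (powint \<mu> p (\<lambda>x. f x - cut n f x))" for n
  have I0: "I \<longlonglongrightarrow> 0" unfolding I_def by (rule cut_tail[OF f p0(1)])
  \<comment> \<open>The constant \<open>B\<close> may be negative, in which case
    \<open>ennreal B\<close> is 0; \<open>max B 0\<close> is a nonnegative real that serves in both
    cases.\<close>
  let ?R = "\<lambda>n. (max B 0 * enn2real (I n) powr (1 / p)) powr q"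
  let ?d = "\<lambda>n. (\<lambda>x. 1 * f x + (-1) * cut n f x)"
  have le: "(powint \<mu> q (\<lambda>l. S f l - T (cut n f) l)) \<le> ennreal (?R n)" for n
  proof -
    have d: "?d n \<in> Lp_space k p"
      using p0 by (intro Lp_space_lincomb f cut_Lp) auto
    have In: "I n = ennreal (enn2real (I n))"
      using d by (simp add: I_def Lp_space_iff less_top)
    have nd: "Lp_norm k p (?d n) = ennreal (enn2real (I n) powr (1 / p))"
      using In by (intro Lp_norm_ennreal) (simp_all add: I_def)
    have "Lp_norm k q (S (?d n)) \<le> ennreal B * ennreal (enn2real (I n) powr (1 / p))"
      using B[OF d] unfolding nd .
    also have "\<dots> \<le> ennreal (max B 0) * ennreal (enn2real (I n) powr (1 / p))"
      by (intro mult_right_mono ennreal_leI) auto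
    also have "\<dots> = ennreal (max B 0 * enn2real (I n) powr (1 / p))" by (simp add: ennreal_mult')
    finally have "(powint \<mu> q (\<lambda>l. S (?d n) l)) \<le>
        ennreal (?R n)"
      by (subst (asm) Lp_norm_le_iff[OF q]) auto
    also have "(powint \<mu> q (\<lambda>l. S (?d n) l)) =
      (powint \<mu> q (\<lambda>l. S f l - T (cut n f) l))"
      by (rule nn_integral_cong_AE)
        (use lin[OF f cut_Lp(1)[OF f p0(1), of n]] L1[of n] in eventually_elim, simp)
    finally show ?thesis .
  qed
  have "(\<lambda>n. enn2real (I n)) \<longlonglongrightarrow> 0"
    using tendsto_enn2real[of I 0 sequentially] I0 by simp
  then have "(\<lambda>n. ?R n) \<longlonglongrightarrow> (max B 0 * 0 powr (1 / p)) powr q"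
    using p0 q by (intro tendsto_powr' tendsto_mult tendsto_const) (auto simp: eventually_sequentially)
  then have "(\<lambda>n. ennreal (?R n)) \<longlonglongrightarrow> ennreal 0"
    by (intro tendsto_ennrealI) simp
  then have "(\<lambda>n. ennreal (?R n)) \<longlonglongrightarrow> 0" by simp
  then have "(\<lambda>n. powint \<mu> q (\<lambda>l. S f l - T (cut n f) l)) \<longlonglongrightarrow> 0"
    by (rule tendsto_sandwich[OF _ _ tendsto_const, rotated 2]) (use le in auto)
  then show ?thesis using Sq[OF f] by (simp add: cut_limit_def Lp_space_iff)
qed

lemma lcdt_is_extension:
  assumes "1 < p" "p \<le> 2"
  shows "is_lcdt_extension k M p (lcdt k M p)"
  unfolding lcdt_def using lcdt_extension_exists[OF assms] by (rule someI_ex)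

end

section \<open>The concentration inequality\<close>

theorem theorem3p13:
  fixes k p\<^sub>1 p\<^sub>2 q\<^sub>1 q\<^sub>2 \<epsilon>\<^sub>E \<epsilon>\<^sub>F :: real
    and M :: "real^2^2"
    and E F :: "real set"
    and f :: "real \<Rightarrow> complex"
  assumes "k \<ge> -1/2"
    and "det M = 1" and "M$1$2 \<noteq> 0"
    and "E \<in> sets lebesgue" and "F \<in> sets lebesgue"
    and "1 < p\<^sub>1" and "p\<^sub>1 < p\<^sub>2" and "p\<^sub>2 \<le> 2"
    and "1 / p\<^sub>1 + 1 / q\<^sub>1 = 1" and "1 / p\<^sub>2 + 1 / q\<^sub>2 = 1"
    and "f \<in> Lp_space k p\<^sub>1 \<inter> Lp_space k p\<^sub>2"
    and "0 \<le> \<epsilon>\<^sub>E" and "\<epsilon>\<^sub>E < 1" and "0 \<le> \<epsilon>\<^sub>F" and "\<epsilon>\<^sub>F < 1"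
    and "concentrated k p\<^sub>1 \<epsilon>\<^sub>E E f"
    and "concentrated k q\<^sub>2 \<epsilon>\<^sub>F F (lcdt k M p\<^sub>2 f)"
  shows "Lp_norm k q\<^sub>2 (lcdt k M p\<^sub>2 f)
    \<le> ennreal ((\<bar>M$1$2\<bar> powr (- (k + 1))) powr (1 - 2 / q\<^sub>1))
      * (enn_powr (dunkl_gamma k E) ((p\<^sub>2 - p\<^sub>1) / (p\<^sub>1 * p\<^sub>2))
         * enn_powr (dunkl_gamma k F) ((q\<^sub>1 - q\<^sub>2) / (q\<^sub>1 * q\<^sub>2))
         / ennreal ((1 - \<epsilon>\<^sub>E) * (1 - \<epsilon>\<^sub>F)))
      * Lp_norm k p\<^sub>2 f"
proof -
  interpret lcdt_kernel k M by unfold_locales (use assms in auto)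
  have p1: "1 < p\<^sub>1" "p\<^sub>1 \<le> 2" and p2: "1 < p\<^sub>2" "p\<^sub>2 \<le> 2" using assms by auto
  have f1: "f \<in> Lp_space k p\<^sub>1" and f2: "f \<in> Lp_space k p\<^sub>2" using assms by auto
  have q1: "q\<^sub>1 \<ge> 2" and q2: "q\<^sub>2 \<ge> 2"
    using conjugate_exponent(1)[OF p1] conjugate_exponent(1)[OF p2] assms by auto
  \<comment> \<open>Conjugation reverses the order of the exponents, so the power of
    \<open>dunkl_gamma k F\<close> is positive and Hoelder on \<open>F\<close> is
    applicable.\<close>
  have "1 / p\<^sub>2 < 1 / p\<^sub>1" using assms by (intro divide_strict_left_mono) auto
  then have "1 / q\<^sub>1 < 1 / q\<^sub>2" using assms by linarith
  then have q12: "q\<^sub>2 < q\<^sub>1" using q1 q2 by (simp add: field_simps)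
  define h where "h = lcdt k M p\<^sub>2 f"
  have ext: "is_lcdt_extension k M p\<^sub>2 (lcdt k M p\<^sub>2)" by (rule lcdt_is_extension[OF p2])
  have lim: "cut_limit q\<^sub>2 f h"
    unfolding h_def by (rule extension_cut_limit[OF ext p2(1) _ f2]) (use assms in simp)
  have hm: "h \<in> borel_measurable \<mu>" using lim by (simp add: cut_limit_def)
  \<comment> \<open>The transform taken at \<open>p\<^sub>2\<close> is estimated with the exponents
    of \<open>p\<^sub>1\<close>; this is possible since \<open>h\<close> is a limit of truncated
    transforms.\<close>
  have h1: "Lp_norm k q\<^sub>1 h \<le> ennreal (C powr (1 - 2 / q\<^sub>1)) * Lp_norm k p\<^sub>1 f"
    by (rule cut_limit_norm_le[OF lim _ f1 p1]) (use q2 assms in auto)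
  \<comment> \<open>A finite \<open>q\<^sub>2\<close> norm is what \<open>concentrated_le\<close>
    requires of the transform.\<close>
  have h2: "h \<in> Lp_space k q\<^sub>2"
  proof -
    have "Lp_norm k q\<^sub>2 h \<le> ennreal (C powr (1 - 2 / q\<^sub>2)) * Lp_norm k p\<^sub>2 f"
      by (rule cut_limit_norm_le[OF lim _ f2 p2]) (use q2 assms in auto)
    also have "\<dots> < \<infinity>" using f2 by (simp add: Lp_space_def ennreal_mult_less_top)
    finally show ?thesis using hm by (simp add: Lp_space_def)
  qed
  define \<alpha> where "\<alpha> = enn_powr (dunkl_gamma k E) ((p\<^sub>2 - p\<^sub>1) / (p\<^sub>1 * p\<^sub>2))"
  define \<beta> where "\<beta> = enn_powr (dunkl_gamma k F) ((q\<^sub>1 - q\<^sub>2) / (q\<^sub>1 * q\<^sub>2))"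
  define K where "K = ennreal (C powr (1 - 2 / q\<^sub>1))"
  have eE: "1 / p\<^sub>1 - 1 / p\<^sub>2 = (p\<^sub>2 - p\<^sub>1) / (p\<^sub>1 * p\<^sub>2)" using p1 p2 by (simp add: field_simps)
  have eF: "1 / q\<^sub>2 - 1 / q\<^sub>1 = (q\<^sub>1 - q\<^sub>2) / (q\<^sub>1 * q\<^sub>2)" using q1 q2 by (simp add: field_simps)
  have A: "ennreal (1 - \<epsilon>\<^sub>E) * Lp_norm k p\<^sub>1 f \<le> \<alpha> * Lp_norm k p\<^sub>2 f"
  proof -
    have "ennreal (1 - \<epsilon>\<^sub>E) * Lp_norm k p\<^sub>1 f \<le> Lp_norm k p\<^sub>1 (\<lambda>x. indicator E x * f x)"
      by (rule concentrated_le[OF f1]) (use assms in auto)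
    also have "\<dots> \<le> \<alpha> * Lp_norm k p\<^sub>2 f"
      unfolding \<alpha>_def eE[symmetric] using f2 assms
      by (intro Lp_norm_indicator_le) (auto simp: Lp_space_iff)
    finally show ?thesis .
  qed
  have B: "ennreal (1 - \<epsilon>\<^sub>F) * Lp_norm k q\<^sub>2 h \<le> \<beta> * Lp_norm k q\<^sub>1 h"
  proof -
    have "ennreal (1 - \<epsilon>\<^sub>F) * Lp_norm k q\<^sub>2 h \<le> Lp_norm k q\<^sub>2 (\<lambda>x. indicator F x * h x)"
      by (rule concentrated_le[OF h2]) (use assms q2 in \<open>auto simp: h_def\<close>)
    also have "\<dots> \<le> \<beta> * Lp_norm k q\<^sub>1 h"
      unfolding \<beta>_def eF[symmetric] using hm assms q2 q12
      by (intro Lp_norm_indicator_le) auto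
    finally show ?thesis .
  qed
  define c where "c = (1 - \<epsilon>\<^sub>E) * (1 - \<epsilon>\<^sub>F)"
  have c: "c > 0" using assms by (simp add: c_def)
  have "ennreal c * Lp_norm k q\<^sub>2 h = ennreal (1 - \<epsilon>\<^sub>E) * (ennreal (1 - \<epsilon>\<^sub>F) * Lp_norm k q\<^sub>2 h)"
    using assms by (simp add: c_def ennreal_mult' mult.assoc)
  also have "\<dots> \<le> ennreal (1 - \<epsilon>\<^sub>E) * (\<beta> * (K * Lp_norm k p\<^sub>1 f))"
    unfolding K_def by (intro mult_left_mono order_trans[OF B] h1) auto
  also have "\<dots> = \<beta> * K * (ennreal (1 - \<epsilon>\<^sub>E) * Lp_norm k p\<^sub>1 f)" by (simp only: mult_ac)
  also have "\<dots> \<le> \<beta> * K * (\<alpha> * Lp_norm k p\<^sub>2 f)" by (intro mult_left_mono A) auto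
  finally have main: "ennreal c * Lp_norm k q\<^sub>2 h \<le> \<beta> * K * (\<alpha> * Lp_norm k p\<^sub>2 f)" .
  \<comment> \<open>Cancelling \<open>ennreal c\<close> is legitimate in [0, \<infinity>] because
    \<open>c\<close> is positive and finite, both \<epsilon>'s being below 1.\<close>
  have "Lp_norm k q\<^sub>2 h = inverse (ennreal c) * (ennreal c * Lp_norm k q\<^sub>2 h)"
    using c by (simp add: inverse_ennreal mult.assoc[symmetric] ennreal_mult'[symmetric])
  also have "\<dots> \<le> inverse (ennreal c) * (\<beta> * K * (\<alpha> * Lp_norm k p\<^sub>2 f))"
    by (intro mult_left_mono main) auto
  also have "\<dots> = K * (\<alpha> * \<beta> / ennreal c) * Lp_norm k p\<^sub>2 f"
    unfolding divide_ennreal_def by (simp only: mult_ac)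
  finally show ?thesis unfolding h_def K_def \<alpha>_def \<beta>_def c_def .
qed

end
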